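(* A board $B$ with $c=3$ colors has a perfect layout if and only if all of the following hold: (1) for every sink and every one of the four directions, there are at least two blank cells between the sink and the boundary of the grid in that direction; (2) none of the following configurations occurs: (a) a sink two cells away from three sides of the boundary and adjacent to another sink; (b) a sink two cells away from two perpendicular sides of the boundary and adjacent to the two other sinks; (c) a sink two cells away from two opposite sides of the boundary and adjacent to the two other sinks; (d) a sink two cells away from three sides of the boundary such that, in the remaining direction, exactly one blank cell separates it from another sink which is adjacent to the third sink; (3) with $p,q$ the numbers of rows and columns containing a sink: if $p=q=3$, $B$ has size at least $7\times8$; if $\{p,q\}=\{2,3\}$, size at least $7\times8$ or $6\times9$; if $p=q=2$, size at least $7\times7$ or $6\times9$; if $\{p,q\}=\{1,3\}$, size at least $7\times7$, $6\times9$, or $5\times11$.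
   Context: A board is an $m\times n$ grid of unit cells in which exactly $c$ cells are sinks, one of each of $c$ colors, and all other cells are empty. A layout places, in some of the empty cells, arrows, each having one of the $c$ colors and one of the four cardinal directions. A packet of color $i$ may enter the grid through any unit edge of the outer boundary of the grid, into the adjacent cell, moving perpendicular to that edge into the grid; it moves one cell at a time in its current direction, and whenever it enters a cell containing an arrow of color $i$ its direction becomes that arrow's direction (arrows of other colors are ignored). The packet succeeds if it enters the sink of color $i$; it fails if it enters a sink of another color, leaves the grid, or travels forever without reaching a sink. A perfect layout is a layout in which every packet of every color entering through every boundary edge succeeds. A sink is "two cells away" from a side of the boundary if, along its row or column toward that side, there are exactly two cells between the sink and that side, both empty. Two sinks are adjacent if their cells share an edge. A board has size at least $a\times b$ if it has at least $a$ rows and at least $b$ columns, or at least $b$ rows and at least $a$ columns. *)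

theory Defs
  imports Main
begin

(* Cells are (row, column) pairs of integers; the grid has rows 0..m-1 and
   columns 0..n-1.  Row index increases downwards (direction S). *)

type_synonym cell = "int \<times> int"

datatype dir = N | S | E | W

fun delta :: "dir \<Rightarrow> int \<times> int" where
  "delta N = (-1, 0)"
| "delta S = (1, 0)"
| "delta E = (0, 1)"
| "delta W = (0, -1)"

fun opp :: "dir \<Rightarrow> dir" where
  "opp N = S" | "opp S = N" | "opp E = W" | "opp W = E"

definition perp :: "dir \<Rightarrow> dir \<Rightarrow> bool" where
  "perp d e \<longleftrightarrow> d \<noteq> e \<and> e \<noteq> opp d"

definition shift :: "cell \<Rightarrow> dir \<Rightarrow> nat \<Rightarrow> cell" where
  "shift p d k = (fst p + int k * fst (delta d), snd p + int k * snd (delta d))"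

definition in_grid :: "nat \<Rightarrow> nat \<Rightarrow> cell \<Rightarrow> bool" where
  "in_grid m n p \<longleftrightarrow> 0 \<le> fst p \<and> fst p < int m \<and> 0 \<le> snd p \<and> snd p < int n"

(* A board: m x n grid, sinks of colours 0..c-1, at distinct cells in the grid *)
definition is_board :: "nat \<Rightarrow> nat \<Rightarrow> nat \<Rightarrow> (nat \<Rightarrow> cell) \<Rightarrow> bool" where
  "is_board m n c sink \<longleftrightarrow> inj_on sink {..<c} \<and> (\<forall>i<c. in_grid m n (sink i))"

definition is_sink :: "nat \<Rightarrow> (nat \<Rightarrow> cell) \<Rightarrow> cell \<Rightarrow> bool" where
  "is_sink c sink p \<longleftrightarrow> (\<exists>i<c. sink i = p)"

definition blank :: "nat \<Rightarrow> nat \<Rightarrow> nat \<Rightarrow> (nat \<Rightarrow> cell) \<Rightarrow> cell \<Rightarrow> bool" where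
  "blank m n c sink p \<longleftrightarrow> in_grid m n p \<and> \<not> is_sink c sink p"

(* A layout assigns to some cells an arrow (colour, direction) *)
type_synonym layout = "cell \<Rightarrow> (nat \<times> dir) option"

definition is_layout :: "nat \<Rightarrow> nat \<Rightarrow> nat \<Rightarrow> (nat \<Rightarrow> cell) \<Rightarrow> layout \<Rightarrow> bool" where
  "is_layout m n c sink L \<longleftrightarrow>
     (\<forall>p a. L p = Some a \<longrightarrow> blank m n c sink p \<and> fst a < c)"

definition turn :: "layout \<Rightarrow> nat \<Rightarrow> cell \<Rightarrow> dir \<Rightarrow> dir" where
  "turn L i p d = (case L p of None \<Rightarrow> d | Some (col, e) \<Rightarrow> if col = i then e else d)"

fun traj :: "layout \<Rightarrow> nat \<Rightarrow> cell \<Rightarrow> dir \<Rightarrow> nat \<Rightarrow> cell \<times> dir" where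
  "traj L i p0 d0 0 = (p0, turn L i p0 d0)"
| "traj L i p0 d0 (Suc k) =
     (let (p, d) = traj L i p0 d0 k; q = shift p d 1 in (q, turn L i q d))"

definition succeeds ::
  "nat \<Rightarrow> nat \<Rightarrow> nat \<Rightarrow> (nat \<Rightarrow> cell) \<Rightarrow> layout \<Rightarrow> nat \<Rightarrow> cell \<Rightarrow> dir \<Rightarrow> bool" where
  "succeeds m n c sink L i p0 d0 \<longleftrightarrow>
     (\<exists>k. fst (traj L i p0 d0 k) = sink i \<and>
          (\<forall>j<k. blank m n c sink (fst (traj L i p0 d0 j))))"

(* entry points: one per unit edge of the boundary (cell entered, direction) *)
definition entries :: "nat \<Rightarrow> nat \<Rightarrow> (cell \<times> dir) set" where
  "entries m n =
     {((0, int j), S) | j. j < n} \<union> {((int m - 1, int j), N) | j. j < n} \<union>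
     {((int r, 0), E) | r. r < m} \<union> {((int r, int n - 1), W) | r. r < m}"

definition perfect_layout :: "nat \<Rightarrow> nat \<Rightarrow> nat \<Rightarrow> (nat \<Rightarrow> cell) \<Rightarrow> layout \<Rightarrow> bool" where
  "perfect_layout m n c sink L \<longleftrightarrow> is_layout m n c sink L \<and>
     (\<forall>i<c. \<forall>(p, d) \<in> entries m n. succeeds m n c sink L i p d)"

definition has_perfect_layout :: "nat \<Rightarrow> nat \<Rightarrow> nat \<Rightarrow> (nat \<Rightarrow> cell) \<Rightarrow> bool" where
  "has_perfect_layout m n c sink \<longleftrightarrow> (\<exists>L. perfect_layout m n c sink L)"

definition blanks_towards :: "nat \<Rightarrow> nat \<Rightarrow> nat \<Rightarrow> (nat \<Rightarrow> cell) \<Rightarrow> cell \<Rightarrow> dir \<Rightarrow> nat" where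
  "blanks_towards m n c sink p d = card {k::nat. 1 \<le> k \<and> blank m n c sink (shift p d k)}"

definition cond1 :: "nat \<Rightarrow> nat \<Rightarrow> nat \<Rightarrow> (nat \<Rightarrow> cell) \<Rightarrow> bool" where
  "cond1 m n c sink \<longleftrightarrow> (\<forall>i<c. \<forall>d. blanks_towards m n c sink (sink i) d \<ge> 2)"

definition two_away :: "nat \<Rightarrow> nat \<Rightarrow> nat \<Rightarrow> (nat \<Rightarrow> cell) \<Rightarrow> cell \<Rightarrow> dir \<Rightarrow> bool" where
  "two_away m n c sink p d \<longleftrightarrow>
     blank m n c sink (shift p d 1) \<and> blank m n c sink (shift p d 2) \<and>
     \<not> in_grid m n (shift p d 3)"

definition adjacent :: "cell \<Rightarrow> cell \<Rightarrow> bool" where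
  "adjacent p q \<longleftrightarrow> (\<exists>d. q = shift p d 1)"

definition config_a :: "nat \<Rightarrow> nat \<Rightarrow> nat \<Rightarrow> (nat \<Rightarrow> cell) \<Rightarrow> bool" where
  "config_a m n c sink \<longleftrightarrow>
     (\<exists>s<c. \<exists>d. (\<forall>e. e \<noteq> d \<longrightarrow> two_away m n c sink (sink s) e) \<and>
        (\<exists>t<c. t \<noteq> s \<and> adjacent (sink s) (sink t)))"

definition config_b :: "nat \<Rightarrow> nat \<Rightarrow> nat \<Rightarrow> (nat \<Rightarrow> cell) \<Rightarrow> bool" where
  "config_b m n c sink \<longleftrightarrow>
     (\<exists>s<c. \<exists>d e. perp d e \<and> two_away m n c sink (sink s) d \<and> two_away m n c sink (sink s) e \<and>
        (\<forall>t<c. t \<noteq> s \<longrightarrow> adjacent (sink s) (sink t)))"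

definition config_c :: "nat \<Rightarrow> nat \<Rightarrow> nat \<Rightarrow> (nat \<Rightarrow> cell) \<Rightarrow> bool" where
  "config_c m n c sink \<longleftrightarrow>
     (\<exists>s<c. \<exists>d. two_away m n c sink (sink s) d \<and> two_away m n c sink (sink s) (opp d) \<and>
        (\<forall>t<c. t \<noteq> s \<longrightarrow> adjacent (sink s) (sink t)))"

definition config_d :: "nat \<Rightarrow> nat \<Rightarrow> nat \<Rightarrow> (nat \<Rightarrow> cell) \<Rightarrow> bool" where
  "config_d m n c sink \<longleftrightarrow>
     (\<exists>s<c. \<exists>d. (\<forall>e. e \<noteq> d \<longrightarrow> two_away m n c sink (sink s) e) \<and>
        blank m n c sink (shift (sink s) d 1) \<and>
        (\<exists>t<c. \<exists>u<c. t \<noteq> s \<and> u \<noteq> s \<and> u \<noteq> t \<and>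
           sink t = shift (sink s) d 2 \<and> adjacent (sink t) (sink u)))"

definition size_at_least :: "nat \<Rightarrow> nat \<Rightarrow> nat \<Rightarrow> nat \<Rightarrow> bool" where
  "size_at_least m n a b \<longleftrightarrow> (m \<ge> a \<and> n \<ge> b) \<or> (m \<ge> b \<and> n \<ge> a)"

definition sink_rows :: "nat \<Rightarrow> (nat \<Rightarrow> cell) \<Rightarrow> nat" where
  "sink_rows c sink = card ((\<lambda>i. fst (sink i)) ` {..<c})"

definition sink_cols :: "nat \<Rightarrow> (nat \<Rightarrow> cell) \<Rightarrow> nat" where
  "sink_cols c sink = card ((\<lambda>i. snd (sink i)) ` {..<c})"

definition cond3 :: "nat \<Rightarrow> nat \<Rightarrow> nat \<Rightarrow> (nat \<Rightarrow> cell) \<Rightarrow> bool" where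
  "cond3 m n c sink \<longleftrightarrow>
     (let p = sink_rows c sink; q = sink_cols c sink in
       (p = 3 \<and> q = 3 \<longrightarrow> size_at_least m n 7 8) \<and>
       ({p, q} = {2, 3} \<longrightarrow> size_at_least m n 7 8 \<or> size_at_least m n 6 9) \<and>
       (p = 2 \<and> q = 2 \<longrightarrow> size_at_least m n 7 7 \<or> size_at_least m n 6 9) \<and>
       ({p, q} = {1, 3} \<longrightarrow> size_at_least m n 7 7 \<or> size_at_least m n 6 9 \<or>
                              size_at_least m n 5 11))"

end

(* Necessity. A packet that enters a row or column can only leave it at a perpendicular arrow of its
   own colour. Hence every line contains at least three perpendicular arrows, and at least four if it
   contains a sink: two colours must turn before the first sink, two after the last one. This yields
   condition (1), and counting all arrows gives 3(m+n) + p + q + 3 <= mn, hence condition (3). On a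
   side that is two cells away from the boundary both cells are needed by the other two colours, so
   the sink can be entered there only by the packet that comes straight from the boundary; in the
   configurations of (2) all four sides of some sink are of this kind or blocked.

   Sufficiency. A free line can be inserted between two lines if each colour has its own position
   where packets of that colour cross only in one direction: put an arrow of the colour with that
   direction there. Positions on the boundary always qualify, so boards can always be enlarged at
   the boundary. Up to symmetry, every board that satisfies the conditions arises by such insertions
   from one of 85 small boards, whose layouts (found by a SAT solver) are checked by evaluation. *)

theory Submission
  imports Defs
begin

text \<open>Sufficiency becomes finite only because something stronger than perfection survives an
  insertion. A new row must turn all three colours, so it needs arrows in three different cells, and
  each arrow also acts on packets of its colour that cross the row. It does no harm if they already
  move in its direction. A layout is therefore carried together with sets \<open>F i\<close> of
  one-way edges, certified by runs that avoid the reversals of \<open>F i\<close>. Both edges at a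
  new arrow are again one-way, so insertions can be repeated. Up to symmetry and recolouring, a
  board is given by a pattern (which sink lies in which sink row and column) and two vectors of gaps
  between these lines. Insertions reach every pointwise larger pair of vectors, so only minimal
  admissible vectors need a layout. The margins force at least two lines at both ends; the size
  conditions demand a surplus of one to four further lines, which can be distributed in finitely
  many ways.\<close>

section \<open>Trajectories\<close>

text \<open>The packet of colour \<open>i\<close> succeeds without ever being in a state in \<open>A\<close>; a state is a cell
  together with the direction in which the packet enters it.\<close>

inductive reaches ::
  "nat \<Rightarrow> nat \<Rightarrow> nat \<Rightarrow> (nat \<Rightarrow> cell) \<Rightarrow> layout \<Rightarrow> nat \<Rightarrow> (cell \<times> dir) set \<Rightarrow> cell \<Rightarrow> dir \<Rightarrow> bool"
  for m n c s L i A where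
  sink: "(s i, d) \<notin> A \<Longrightarrow> reaches m n c s L i A (s i) d"
| step: "(p, d) \<notin> A \<Longrightarrow> blank m n c s p \<Longrightarrow> e = turn L i p d \<Longrightarrow>
    reaches m n c s L i A (shift p e 1) e \<Longrightarrow> reaches m n c s L i A p d"

text \<open>\<open>traj\<close> adds steps at the end of a run while \<open>reaches\<close> peels
  them off at the start; this recursion translates one into the other.\<close>

lemma traj_Suc_left:
  "traj L i p d (Suc k) = traj L i (shift p (turn L i p d) 1) (turn L i p d) k"
proof (induction k)
  case (Suc k)
  then show ?case
    by (subst traj.simps(2)) (simp add: Let_def split: prod.splits)
qed (simp add: Let_def)

lemma reaches_imp_succeeds: "reaches m n c s L i A p d \<Longrightarrow> succeeds m n c s L i p d"
proof (induction rule: reaches.induct)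
  case (sink d)
  show ?case unfolding succeeds_def by (rule exI[of _ 0]) auto
next
  case (step p d e)
  then obtain k where k: "fst (traj L i (shift p e 1) e k) = s i"
      "\<And>j. j < k \<Longrightarrow> blank m n c s (fst (traj L i (shift p e 1) e j))"
    unfolding succeeds_def by auto
  have "blank m n c s (fst (traj L i p d j))" if "j < Suc k" for j
  proof (cases j)
    case 0
    then show ?thesis using step by simp
  next
    case (Suc j')
    then show ?thesis using k(2)[of j'] that step(3) traj_Suc_left[of L i p d j'] by simp
  qed
  moreover have "fst (traj L i p d (Suc k)) = s i"
    using k(1) step(3) traj_Suc_left[of L i p d k] by simp
  ultimately show ?case unfolding succeeds_def by blast
qed

lemma succeeds_imp_reaches:
  assumes "succeeds m n c s L i p d"
  shows "reaches m n c s L i {} p d"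
proof -
  obtain k where "fst (traj L i p d k) = s i" "\<forall>j<k. blank m n c s (fst (traj L i p d j))"
    using assms unfolding succeeds_def by blast
  then show ?thesis
  proof (induction k arbitrary: p d)
    case 0
    then have "p = s i" by simp
    then show ?case by (auto intro: reaches.sink)
  next
    case (Suc k)
    let ?e = "turn L i p d"
    have "blank m n c s p" using Suc.prems(2) by (metis fst_conv traj.simps(1) zero_less_Suc)
    moreover have "reaches m n c s L i {} (shift p ?e 1) ?e"
    proof (rule Suc.IH)
      show "fst (traj L i (shift p ?e 1) ?e k) = s i"
        using Suc.prems(1) traj_Suc_left[of L i p d k] by simp
      show "\<forall>j<k. blank m n c s (fst (traj L i (shift p ?e 1) ?e j))"
      proof (intro allI impI)
        fix j assume "j < k"
        then have "blank m n c s (fst (traj L i p d (Suc j)))" using Suc.prems(2) by blast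
        then show "blank m n c s (fst (traj L i (shift p ?e 1) ?e j))"
          using traj_Suc_left[of L i p d j] by simp
      qed
    qed
    ultimately show ?case using reaches.step[OF _ _ refl] by fast
  qed
qed

lemma succeeds_iff_reaches: "succeeds m n c s L i p d \<longleftrightarrow> reaches m n c s L i {} p d"
  using reaches_imp_succeeds succeeds_imp_reaches by blast

lemma reaches_imp_notin: "reaches m n c s L i A p d \<Longrightarrow> (p, d) \<notin> A"
  by (auto elim: reaches.cases)

lemma reaches_imp_in_grid:
  "reaches m n c s L i A p d \<Longrightarrow> in_grid m n (s i) \<Longrightarrow> in_grid m n p"
  by (auto elim: reaches.cases simp: blank_def)

lemma reaches_antimono:
  "reaches m n c s L i A p d \<Longrightarrow> B \<subseteq> A \<Longrightarrow> reaches m n c s L i B p d"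
proof (induction rule: reaches.induct)
  case (sink d)
  then show ?case by (intro reaches.sink) auto
next
  case (step p d e)
  then show ?case by (intro reaches.step[OF _ step.hyps(2,3)]) auto
qed

lemma blank_cong: "(\<And>i. i < c \<Longrightarrow> s i = t i) \<Longrightarrow> blank m n c s = blank m n c t"
  by (auto simp: blank_def is_sink_def fun_eq_iff)

lemma reaches_cong:
  assumes "reaches m n c s L i A p d" "i < c" "\<And>i. i < c \<Longrightarrow> s i = t i"
  shows "reaches m n c t L i A p d"
  using assms(1)
proof (induction rule: reaches.induct)
  case (sink d)
  then show ?case using reaches.sink[of t i d A m n c L] assms by simp
next
  case (step p d e)
  have "blank m n c s = blank m n c t" using assms(3) by (rule blank_cong)
  with step show ?case by (intro reaches.step[OF _ _ step.hyps(3)]) auto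
qed

lemma opp_opp [simp]: "opp (opp d) = d"
  by (cases d) auto

lemma shift_opp [simp]: "shift (shift p d 1) (opp d) 1 = p" "shift (shift p (opp d) 1) d 1 = p"
  by (cases d; simp add: shift_def)+

lemma entries_iff:
  "((x, y), d) \<in> entries m n \<longleftrightarrow>
    (0 \<le> y \<and> y < int n \<and> (x = 0 \<and> d = S \<or> x = int m - 1 \<and> d = N)) \<or>
    (0 \<le> x \<and> x < int m \<and> (y = 0 \<and> d = E \<or> y = int n - 1 \<and> d = W))"
proof -
  have "(\<exists>j<n. y = int j) \<longleftrightarrow> 0 \<le> y \<and> y < int n" for y n
    by (auto intro!: exI[of _ "nat y"])
  moreover have "((x, y), d) \<in> entries m n \<longleftrightarrow>
    (\<exists>j<n. y = int j) \<and> (x = 0 \<and> d = S \<or> x = int m - 1 \<and> d = N) \<or>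
    (\<exists>r<m. x = int r) \<and> (y = 0 \<and> d = E \<or> y = int n - 1 \<and> d = W)"
    by (auto simp: entries_def)
  ultimately show ?thesis by simp
qed

section \<open>Inserting a line\<close>

text \<open>A state stands for the crossing of the edge through which the packet enters the cell;
  its reversal is the crossing of the same edge in the other direction.\<close>

definition reversal :: "cell \<times> dir \<Rightarrow> cell \<times> dir" where
  "reversal = (\<lambda>(p, d). (shift p (opp d) 1, opp d))"

text \<open>Crossing a boundary edge outwards leaves the grid, which a successful packet never does;
  so boundary edges are one-way without further checks.\<close>

lemma reversal_off_grid: "(p, d) \<in> reversal ` entries m n \<Longrightarrow> \<not> in_grid m n p"
  by (auto simp: reversal_def entries_def in_grid_def shift_def)

text \<open>\<open>g\<close> is the index that a row inserted between rows \<open>g - 1\<close> and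
  \<open>g\<close> gets. The columns \<open>j i\<close> are distinct because a cell of the new row
  can hold only one arrow.\<close>

definition row_cut :: "nat \<Rightarrow> nat \<Rightarrow> (nat \<Rightarrow> (cell \<times> dir) set) \<Rightarrow> int \<Rightarrow> bool" where
  "row_cut n c F g \<longleftrightarrow> (\<exists>j. inj_on j {..<c} \<and>
     (\<forall>i<c. 0 \<le> j i \<and> j i < int n \<and> (((g, j i), S) \<in> F i \<or> ((g - 1, j i), N) \<in> F i)))"

definition col_cut :: "nat \<Rightarrow> nat \<Rightarrow> (nat \<Rightarrow> (cell \<times> dir) set) \<Rightarrow> int \<Rightarrow> bool" where
  "col_cut m c F g \<longleftrightarrow> (\<exists>j. inj_on j {..<c} \<and>
     (\<forall>i<c. 0 \<le> j i \<and> j i < int m \<and> (((j i, g), E) \<in> F i \<or> ((j i, g - 1), W) \<in> F i)))"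

text \<open>\<open>F i\<close> is a set of states from which packets of colour \<open>i\<close> succeed and such that none of these packets
  ever crosses an edge against the direction of a state in \<open>F i\<close>. An arrow of colour \<open>i\<close> in that
  direction can therefore be put on such an edge without disturbing any packet.\<close>

definition one_way :: "nat \<Rightarrow> nat \<Rightarrow> nat \<Rightarrow> (nat \<Rightarrow> cell) \<Rightarrow> layout \<Rightarrow> (nat \<Rightarrow> (cell \<times> dir) set) \<Rightarrow> bool" where
  "one_way m n c s L F \<longleftrightarrow> is_layout m n c s L \<and> (\<forall>i<c. in_grid m n (s i)) \<and>
     (\<forall>i<c. entries m n \<subseteq> F i \<and> (\<forall>(p, d) \<in> F i. reaches m n c s L i (reversal ` F i) p d))"

lemma one_way_reaches:
  "one_way m n c s L F \<Longrightarrow> i < c \<Longrightarrow> (p, d) \<in> F i \<Longrightarrow> reaches m n c s L i (reversal ` F i) p d"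
  unfolding one_way_def by blast

lemma one_way_entries: "one_way m n c s L F \<Longrightarrow> i < c \<Longrightarrow> st \<in> entries m n \<Longrightarrow> st \<in> F i"
  unfolding one_way_def by blast

text \<open>Only the place of a new row relative to the sinks matters, so one cut somewhere between
  two sink rows is enough. Outside the sink rows the boundary provides a cut.\<close>

definition rows_separated :: "nat \<Rightarrow> nat \<Rightarrow> (nat \<Rightarrow> cell) \<Rightarrow> (nat \<Rightarrow> (cell \<times> dir) set) \<Rightarrow> bool" where
  "rows_separated n c s F \<longleftrightarrow> (\<forall>i<c. \<forall>j<c. fst (s i) < fst (s j) \<longrightarrow>
     (\<exists>g. fst (s i) < g \<and> g \<le> fst (s j) \<and> row_cut n c F g))"

definition cols_separated :: "nat \<Rightarrow> nat \<Rightarrow> (nat \<Rightarrow> cell) \<Rightarrow> (nat \<Rightarrow> (cell \<times> dir) set) \<Rightarrow> bool" where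
  "cols_separated m c s F \<longleftrightarrow> (\<forall>i<c. \<forall>j<c. snd (s i) < snd (s j) \<longrightarrow>
     (\<exists>g. snd (s i) < g \<and> g \<le> snd (s j) \<and> col_cut m c F g))"

definition extensible :: "nat \<Rightarrow> nat \<Rightarrow> nat \<Rightarrow> (nat \<Rightarrow> cell) \<Rightarrow> bool" where
  "extensible m n c s \<longleftrightarrow>
     (\<exists>L F. one_way m n c s L F \<and> rows_separated n c s F \<and> cols_separated m c s F)"

section \<open>Runs of packets after the insertion of one row\<close>

definition lift :: "int \<Rightarrow> cell \<Rightarrow> cell" where
  "lift k p = (if fst p < k then p else (fst p + 1, snd p))"

lemma lift_inj: "lift k p = lift k q \<longleftrightarrow> p = q"
  by (cases p; cases q) (auto simp: lift_def split: if_splits)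

lemma lift_neq: "fst (lift k p) \<noteq> k"
  by (auto simp: lift_def)

lemma in_grid_lift: "0 \<le> k \<Longrightarrow> k \<le> int m \<Longrightarrow> in_grid (Suc m) n (lift k p) \<longleftrightarrow> in_grid m n p"
  by (auto simp: lift_def in_grid_def)

lemma blank_lift: "0 \<le> k \<Longrightarrow> k \<le> int m \<Longrightarrow>
  blank (Suc m) n c (\<lambda>i. lift k (s i)) (lift k p) \<longleftrightarrow> blank m n c s p"
  by (auto simp: blank_def is_sink_def in_grid_lift lift_inj)

locale row_insertion =
  fixes m n c :: nat and s :: "nat \<Rightarrow> cell" and L :: layout and F :: "nat \<Rightarrow> (cell \<times> dir) set"
    and k :: int and j :: "nat \<Rightarrow> int"
  assumes ow: "one_way m n c s L F"
    and k: "0 \<le> k" "k \<le> int m"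
    and j_inj: "inj_on j {..<c}"
    and j_range: "i < c \<Longrightarrow> 0 \<le> j i \<and> j i < int n"
    and j_cut: "i < c \<Longrightarrow> ((k, j i), S) \<in> F i \<or> ((k - 1, j i), N) \<in> F i"
begin

text \<open>By \<open>one_way\<close> at most one of the two states is in \<open>F i\<close>, since
  each is the reversal of the other; testing \<open>S\<close> first is no real choice.\<close>

definition f :: "nat \<Rightarrow> dir" where "f i = (if ((k, j i), S) \<in> F i then S else N)"

definition L' :: layout where
  "L' = (\<lambda>(x, y). if x < k then L (x, y)
     else if x = k then (if y \<in> j ` {..<c} then let i = the_inv_into {..<c} j y in Some (i, f i) else None)
     else L (x - 1, y))"

text \<open>The arrow of colour \<open>i\<close> splits its cut edge into the edge into the new
  cell, which is added here, and the edge out of it, which is the lifted old state. The entries are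
  added because the new row has two of its own, and may itself be the first or last row.\<close>

definition F' :: "nat \<Rightarrow> (cell \<times> dir) set" where
  "F' i = (\<lambda>(p, d). (lift k p, d)) ` F i \<union> {((k, j i), f i)} \<union> entries (Suc m) n"

abbreviation "s' \<equiv> \<lambda>i. lift k (s i)"

abbreviation "reaches' i \<equiv> reaches (Suc m) n c s' L' i (reversal ` F' i)"

lemma rch: "i < c \<Longrightarrow> (p, d) \<in> F i \<Longrightarrow> reaches m n c s L i (reversal ` F i) p d"
  using ow by (rule one_way_reaches)

lemma ent: "i < c \<Longrightarrow> st \<in> entries m n \<Longrightarrow> st \<in> F i"
  using ow unfolding one_way_def by blast

lemma turn_lift: "turn L' i (lift k p) d = turn L i p d"
  by (cases p) (auto simp: turn_def L'_def lift_def)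

lemma L'_new: "i < c \<Longrightarrow> L' (k, j i) = Some (i, f i)"
  using j_inj by (auto simp: L'_def Let_def the_inv_into_f_f)

lemma turn_new: "i < c \<Longrightarrow> turn L' i (k, y) d = (if y = j i then f i else d)"
proof -
  assume i: "i < c"
  show ?thesis
  proof (cases "y \<in> j ` {..<c}")
    case True
    then obtain i' where i': "i' < c" "y = j i'" by auto
    have "j i' = j i \<longleftrightarrow> i' = i" using j_inj i i' by (auto dest: inj_onD)
    then show ?thesis using L'_new[of i'] i' by (auto simp: turn_def)
  next
    case False
    then show ?thesis using i by (auto simp: turn_def L'_def)
  qed
qed

lemma blank_new: "0 \<le> y \<Longrightarrow> y < int n \<Longrightarrow> blank (Suc m) n c s' (k, y)"
proof -
  assume y: "0 \<le> y" "y < int n"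
  have "s' i \<noteq> (k, y)" for i using lift_neq[of k "s i"] by auto
  then show ?thesis using k y by (auto simp: blank_def is_sink_def in_grid_def)
qed

text \<open>Lifted states reverse as in the old board. The edge into the new cell, reversed, is
  entered exactly where the old cut edge was crossed the wrong way.\<close>

lemma notin_lift:
  assumes "i < c" "in_grid m n p" "(p, d) \<notin> reversal ` F i"
  shows "(lift k p, d) \<notin> reversal ` F' i"
proof
  assume "(lift k p, d) \<in> reversal ` F' i"
  then consider (1) p0 d0 where "(p0, d0) \<in> F i" "lift k p = shift (lift k p0) (opp d0) 1" "d = opp d0"
    | (2) "lift k p = shift (k, j i) (opp (f i)) 1" "d = opp (f i)"
    | (3) "(lift k p, d) \<in> reversal ` entries (Suc m) n"
    unfolding F'_def reversal_def by fastforce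
  then show False
  proof cases
    case 1
    have "p = shift p0 (opp d0) 1"
      using 1(2) by (cases p; cases p0; cases d0) (auto simp: lift_def shift_def split: if_splits)
    then have "(p, d) = reversal (p0, d0)" using 1 by (simp add: reversal_def)
    with 1 assms show False by blast
  next
    case 2
    show False
    proof (cases "((k, j i), S) \<in> F i")
      case True
      then have "p = (k - 1, j i)" "d = N" using 2
        by (cases p; auto simp: f_def lift_def shift_def split: if_splits)+
      then have "(p, d) = reversal ((k, j i), S)" by (simp add: reversal_def shift_def)
      with True assms show False by blast
    next
      case False
      then have "p = (k, j i)" "d = S" using 2
        by (cases p; auto simp: f_def lift_def shift_def split: if_splits)+
      then have "(p, d) = reversal ((k - 1, j i), N)" by (simp add: reversal_def shift_def)
      with False assms j_cut[of i] show False by blast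
    qed
  next
    case 3
    then show False using reversal_off_grid assms(2) in_grid_lift k by blast
  qed
qed

text \<open>Among the reversals of \<open>F' i\<close> only vertical ones lie in the new row, and
  each of these is half of a wrong-way crossing of the cut in the old board.\<close>

lemma notin_new:
  assumes "i < c" "0 \<le> y" "y < int n"
    and "d = S \<Longrightarrow> ((k, y), S) \<notin> reversal ` F i"
    and "d = N \<Longrightarrow> ((k - 1, y), N) \<notin> reversal ` F i"
  shows "((k, y), d) \<notin> reversal ` F' i"
proof
  assume "((k, y), d) \<in> reversal ` F' i"
  then consider (1) p0 d0 where "(p0, d0) \<in> F i" "(k, y) = shift (lift k p0) (opp d0) 1" "d = opp d0"
    | (2) "(k, y) = shift (k, j i) (opp (f i)) 1" "d = opp (f i)"
    | (3) "((k, y), d) \<in> reversal ` entries (Suc m) n"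
    unfolding F'_def reversal_def by fastforce
  then show False
  proof cases
    case 1
    have "d = S \<and> p0 = (k - 1, y) \<and> d0 = N \<or> d = N \<and> p0 = (k, y) \<and> d0 = S"
      using 1(2,3) by (cases p0; cases d0) (auto simp: lift_def shift_def split: if_splits)
    then show False
    proof
      assume *: "d = S \<and> p0 = (k - 1, y) \<and> d0 = N"
      then have "((k, y), S) = reversal (p0, d0)" by (simp add: reversal_def shift_def)
      with * 1 assms(4) show False by blast
    next
      assume *: "d = N \<and> p0 = (k, y) \<and> d0 = S"
      then have "((k - 1, y), N) = reversal (p0, d0)" by (simp add: reversal_def shift_def)
      with * 1 assms(5) show False by blast
    qed
  next
    case 2
    then show False by (auto simp: f_def shift_def split: if_splits)
  next
    case 3
    then show False using reversal_off_grid[of "(k, y)" d "Suc m" n] k assms by (auto simp: in_grid_def)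
  qed
qed

text \<open>A packet that crosses the cut passes one additional cell. If that cell holds an arrow of
  its own colour, the arrow agrees with its direction: otherwise the old crossing would have been a
  reversal of a state in \<open>F i\<close>.\<close>

lemma new_vertical:
  assumes i: "i < c" and y: "0 \<le> y" "y < int n"
    and q: "d = S \<and> q = (k, y) \<or> d = N \<and> q = (k - 1, y)"
    and notin: "(q, d) \<notin> reversal ` F i"
    and r: "reaches' i (lift k q) d"
  shows "reaches' i (k, y) d"
proof (rule reaches.step)
  show "((k, y), d) \<notin> reversal ` F' i" using notin_new[OF i y] q notin by auto
  show "blank (Suc m) n c s' (k, y)" using blank_new y by blast
  have "d = f i" if "y = j i"
  proof (rule ccontr)
    assume "d \<noteq> f i"
    then have "(q, d) = reversal (if d = N then ((k, y), S) else ((k - 1, y), N))"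
      and "(if d = N then ((k, y), S) else ((k - 1, y), N)) \<in> F i"
      using q that j_cut[OF i] by (auto simp: f_def reversal_def shift_def split: if_splits)
    with notin show False by blast
  qed
  then show "d = turn L' i (k, y) d" using turn_new[OF i] by auto
  have "shift (k, y) d 1 = lift k q" using q by (auto simp: shift_def lift_def)
  with r show "reaches' i (shift (k, y) d 1) d" by simp
qed

text \<open>The new run is the old one with one additional cell for each crossing of the
  cut.\<close>

lemma reaches_lift:
  assumes "reaches m n c s L i (reversal ` F i) p d" "i < c"
  shows "reaches' i (lift k p) d"
  using assms(1)
proof (induction rule: reaches.induct)
  case (sink d)
  have "in_grid m n (s i)" using ow assms(2) unfolding one_way_def by blast
  then have "(s' i, d) \<notin> reversal ` F' i" using notin_lift[OF assms(2) _ sink] by simp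
  then show ?case by (rule reaches.sink)
next
  case (step p d e)
  let ?q = "shift p e 1"
  have grid: "in_grid m n p" using step blank_def by blast
  have q_notin: "(?q, e) \<notin> reversal ` F i" using step(4) reaches_imp_notin by blast
  show ?case
  proof (rule reaches.step)
    show "(lift k p, d) \<notin> reversal ` F' i" using notin_lift[OF assms(2) grid] step by blast
    show "blank (Suc m) n c s' (lift k p)" using blank_lift k step by blast
    show "e = turn L' i (lift k p) d" using step turn_lift by simp
    show "reaches' i (shift (lift k p) e 1) e"
    proof (cases "shift (lift k p) e 1 = lift k ?q")
      case True
      then show ?thesis using step by simp
    next
      case False
      then have eq: "shift (lift k p) e 1 = (k, snd p)"
        and "e = S \<and> ?q = (k, snd p) \<or> e = N \<and> ?q = (k - 1, snd p)"
        by (cases p; cases e; auto simp: lift_def shift_def split: if_splits)+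
      then show ?thesis
        using new_vertical[OF assms(2), of "snd p" e ?q] q_notin step grid
        by (auto simp: in_grid_def)
    qed
  qed
qed

lemma new_arrow: "i < c \<Longrightarrow> reaches' i (k, j i) (f i)"
proof -
  assume i: "i < c"
  define q where "q = (if f i = S then (k, j i) else (k - 1, j i))"
  have F: "(q, f i) \<in> F i" using j_cut[OF i] by (auto simp: q_def f_def)
  then have r: "reaches m n c s L i (reversal ` F i) q (f i)" using rch i by blast
  show ?thesis
    by (rule new_vertical[OF i _ _ _ reaches_imp_notin[OF r] reaches_lift[OF r i]])
      (use j_range[OF i] in \<open>auto simp: q_def f_def\<close>)
qed

lemma new_horizontal_arrow:
  assumes "i < c" "d = E \<or> d = W"
  shows "reaches' i (k, j i) d"
proof (rule reaches.step[OF _ _ refl])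
  show "((k, j i), d) \<notin> reversal ` F' i"
    using notin_new[of i "j i" d] assms j_range by auto
  show "blank (Suc m) n c s' (k, j i)" using blank_new j_range assms by blast
  \<comment> \<open>Both states are turned to \<open>f i\<close> in this cell, so the vertical run
    can be reused after its first step.\<close>
  have *: "reaches' i (k, j i) (f i)" using new_arrow assms by blast
  have "(k, j i) \<noteq> s' i" using lift_neq[of k "s i"] by (metis fst_conv)
  with * have "reaches' i (shift (k, j i) (turn L' i (k, j i) (f i)) 1) (turn L' i (k, j i) (f i))"
    by (cases rule: reaches.cases) simp_all
  then show "reaches' i (shift (k, j i) (turn L' i (k, j i) d) 1) (turn L' i (k, j i) d)"
    using turn_new[OF assms(1)] by simp
qed

text \<open>Induction on the distance \<open>t\<close> to the packet's own arrow; the arrows of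
  other colours in between are ignored.\<close>

lemma new_horizontal:
  assumes i: "i < c" and d: "d = E \<or> d = W"
  shows "q = shift (k, j i) (opp d) t \<Longrightarrow> 0 \<le> snd q \<Longrightarrow> snd q < int n \<Longrightarrow> reaches' i q d"
proof (induction t arbitrary: q)
  case 0
  then show ?case using new_horizontal_arrow[OF i d] by (simp add: shift_def)
next
  case (Suc t)
  let ?q = "shift q d 1"
  have q: "q = (k, snd q)" "snd q \<noteq> j i" and next_q: "?q = shift (k, j i) (opp d) t"
    using Suc.prems(1) d by (auto simp: shift_def)
  have "0 \<le> snd ?q" "snd ?q < int n"
    using next_q Suc.prems(2,3) j_range[OF i] d by (auto simp: shift_def)
  then have "reaches' i ?q d" by (rule Suc.IH[OF next_q])
  moreover have "(q, d) \<notin> reversal ` F' i"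
    using notin_new[of i "snd q" d] i d Suc.prems(2,3) q(1) by auto
  moreover have "blank (Suc m) n c s' q" using blank_new[of "snd q"] Suc.prems(2,3) q(1) by simp
  moreover have "d = turn L' i q d" using turn_new[OF i, of "snd q" d] q by simp
  ultimately show ?case by (rule reaches.step[rotated 3])
qed

lemma new_entries:
  assumes i: "i < c" and e: "((x, y), d) \<in> entries (Suc m) n"
  shows "reaches' i (x, y) d"
proof -
  have lift_entry: "reaches' i (lift k (x', y')) d'" if "((x', y'), d') \<in> entries m n" for x' y' d'
    using reaches_lift[OF rch[OF i ent[OF i that]] i] .
  have notin_entry: "((x', y'), d') \<notin> reversal ` F i" if "((x', y'), d') \<in> entries m n" for x' y' d'
    using reaches_imp_notin[OF rch[OF i ent[OF i that]]] .
  have ji: "0 \<le> j i" "j i < int n" using j_range[OF i] by auto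
  consider (vertical) "0 \<le> y" "y < int n" "x = 0 \<and> d = S \<or> x = int m \<and> d = N"
    | (horizontal) "0 \<le> x" "x \<le> int m" "y = 0 \<and> d = E \<or> y = int n - 1 \<and> d = W"
    using e by (auto simp: entries_iff)
  then show ?thesis
  proof cases
    case vertical
    let ?p = "(if d = S then 0 else int m - 1, y)"
    have *: "(?p, d) \<in> entries m n" using vertical by (auto simp: entries_iff)
    show ?thesis
    proof (cases "x = k")
      \<comment> \<open>The new row is outermost here, and the packet crosses it before it enters
        the old board.\<close>
      case True
      then show ?thesis
        using new_vertical[OF i vertical(1,2) _ notin_entry[OF *] lift_entry[OF *]] vertical(3) by auto
    next
      case False
      then have "lift k ?p = (x, y)" using vertical(3) k by (auto simp: lift_def)
      then show ?thesis using lift_entry[OF *] by simp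
    qed
  next
    case horizontal
    show ?thesis
    proof (cases "x = k")
      case True
      let ?t = "nat (if d = E then j i else int n - 1 - j i)"
      have "(x, y) = shift (k, j i) (opp d) ?t" using True horizontal(3) ji by (auto simp: shift_def)
      then show ?thesis by (rule new_horizontal[OF i, rotated]) (use horizontal(3) ji in auto)
    next
      case False
      let ?x = "if x < k then x else x - 1"
      have "lift k (?x, y) = (x, y)" "((?x, y), d) \<in> entries m n"
        using False horizontal k by (auto simp: lift_def entries_iff)
      then show ?thesis using lift_entry[of ?x y d] by simp
    qed
  qed
qed

lemma is_layout_new: "is_layout (Suc m) n c s' L'"
  unfolding is_layout_def
proof (intro allI impI)
  fix p a assume a: "L' p = Some a"
  obtain x y where p: "p = (x, y)" by (cases p)
  have lay: "is_layout m n c s L" using ow unfolding one_way_def by blast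
  consider "x = k" | "x < k" | "k < x" by linarith
  then show "blank (Suc m) n c s' p \<and> fst a < c"
  proof cases
    case 1
    then obtain i where "i < c" "y = j i" using a p by (auto simp: L'_def split: if_splits)
    then show ?thesis using a 1 p L'_new[of i] blank_new[of y] j_range[of i] by auto
  next
    case 2
    then have "L (x, y) = Some a" "p = lift k (x, y)" using a p by (auto simp: L'_def lift_def)
    then show ?thesis using lay blank_lift[OF k] unfolding is_layout_def by metis
  next
    case 3
    then have "L (x - 1, y) = Some a" "p = lift k (x - 1, y)" using a p by (auto simp: L'_def lift_def)
    then show ?thesis using lay blank_lift[OF k] unfolding is_layout_def by metis
  qed
qed

lemma one_way_new: "one_way (Suc m) n c s' L' F'"
  unfolding one_way_def
proof (intro conjI allI impI ballI)
  show "is_layout (Suc m) n c s' L'" by (rule is_layout_new)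
next
  fix i assume "i < c"
  then show "in_grid (Suc m) n (s' i)" using ow in_grid_lift[OF k] unfolding one_way_def by simp
next
  fix i show "entries (Suc m) n \<subseteq> F' i" by (auto simp: F'_def)
next
  fix i st assume i: "i < c" and "st \<in> F' i"
  then consider p d where "st = (lift k p, d)" "(p, d) \<in> F i" | "st = ((k, j i), f i)"
    | x y d where "st = ((x, y), d)" "((x, y), d) \<in> entries (Suc m) n"
    by (cases st) (auto simp: F'_def)
  then show "case st of (p, d) \<Rightarrow> reaches' i p d"
    by cases (use reaches_lift[OF rch[OF i] i] new_arrow[OF i] new_entries[OF i] in auto)
qed

text \<open>In the column of each new arrow the edges above and below it are both one-way, so both
  sides of the new row are cuts and later rows can be inserted there.\<close>

lemma row_cut_new: "row_cut n c F' k" "row_cut n c F' (k + 1)"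
proof -
  have "((k, j i), S) \<in> F' i \<or> ((k - 1, j i), N) \<in> F' i"
    "((k + 1, j i), S) \<in> F' i \<or> ((k, j i), N) \<in> F' i" if "i < c" for i
  proof -
    have lf: "(lift k p, d) \<in> F' i" if "(p, d) \<in> F i" for p d using that by (force simp: F'_def)
    have new: "((k, j i), f i) \<in> F' i" by (simp add: F'_def)
    show "((k, j i), S) \<in> F' i \<or> ((k - 1, j i), N) \<in> F' i"
      using j_cut[OF \<open>i < c\<close>] new lf[of "(k - 1, j i)" N] by (auto simp: f_def lift_def split: if_splits)
    show "((k + 1, j i), S) \<in> F' i \<or> ((k, j i), N) \<in> F' i"
      using j_cut[OF \<open>i < c\<close>] new lf[of "(k, j i)" S] by (auto simp: f_def lift_def split: if_splits)
  qed
  then show "row_cut n c F' k" "row_cut n c F' (k + 1)"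
    using j_inj j_range unfolding row_cut_def by (auto intro!: exI[of _ j])
qed

lemma row_cut_lift:
  assumes "row_cut n c F g" "g \<noteq> k"
  shows "row_cut n c F' (if g < k then g else g + 1)" (is "row_cut n c F' ?g")
proof -
  obtain j where j: "inj_on j {..<c}" "\<And>i. i < c \<Longrightarrow> 0 \<le> j i \<and> j i < int n"
    "\<And>i. i < c \<Longrightarrow> ((g, j i), S) \<in> F i \<or> ((g - 1, j i), N) \<in> F i"
    using assms(1) unfolding row_cut_def by blast
  have "((?g, j i), S) \<in> F' i \<or> ((?g - 1, j i), N) \<in> F' i" if "i < c" for i
  proof -
    have lf: "(lift k p, d) \<in> F' i" if "(p, d) \<in> F i" for p d using that by (force simp: F'_def)
    show ?thesis
      using j(3)[OF that] lf[of "(g, j i)" S] lf[of "(g - 1, j i)" N] assms(2) by (auto simp: lift_def)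
  qed
  then show ?thesis using j unfolding row_cut_def by blast
qed

lemma col_cut_lift: "col_cut m c F g \<Longrightarrow> col_cut (Suc m) c F' g"
proof -
  assume "col_cut m c F g"
  then obtain r where r: "inj_on r {..<c}" "\<And>i. i < c \<Longrightarrow> 0 \<le> r i \<and> r i < int m"
    "\<And>i. i < c \<Longrightarrow> ((r i, g), E) \<in> F i \<or> ((r i, g - 1), W) \<in> F i"
    unfolding col_cut_def by blast
  have lf: "(lift k p, d) \<in> F' i" if "(p, d) \<in> F i" for p d i using that by (force simp: F'_def)
  let ?r = "\<lambda>i. if r i < k then r i else r i + 1"
  have "inj_on ?r {..<c}" using r(1) by (auto simp: inj_on_def split: if_splits)
  moreover have "0 \<le> ?r i \<and> ?r i < int (Suc m)" if "i < c" for i using r(2)[OF that] by auto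
  moreover have "((?r i, g), E) \<in> F' i \<or> ((?r i, g - 1), W) \<in> F' i" if "i < c" for i
    using r(3)[OF that] lf[of "(r i, g)" E i] lf[of "(r i, g - 1)" W i] by (auto simp: lift_def)
  ultimately show ?thesis unfolding col_cut_def by blast
qed

end

text \<open>Boundary edges are one-way for every colour, so colour \<open>i\<close> can simply take
  column \<open>i\<close>; this is where \<open>c \<le> n\<close> is used.\<close>

lemma row_cut_boundary:
  assumes "one_way m n c s L F" "c \<le> n" "g = 0 \<or> g = int m"
  shows "row_cut n c F g"
proof -
  have "((g, int i), S) \<in> F i \<or> ((g - 1, int i), N) \<in> F i" if "i < c" for i
  proof -
    have "entries m n \<subseteq> F i" using assms(1) that unfolding one_way_def by blast
    moreover have "((g, int i), S) \<in> entries m n \<or> ((g - 1, int i), N) \<in> entries m n"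
      using assms(2,3) that by (auto simp: entries_iff)
    ultimately show ?thesis by blast
  qed
  then show ?thesis unfolding row_cut_def using assms(2)
    by (intro exI[of _ int]) (auto simp: inj_on_def)
qed

section \<open>Repeated insertion up to prescribed sink positions\<close>

lemma extensible_cong:
  assumes "extensible m n c s" "\<And>i. i < c \<Longrightarrow> s i = t i"
  shows "extensible m n c t"
proof -
  obtain L F where F: "one_way m n c s L F" "rows_separated n c s F" "cols_separated m c s F"
    using assms(1) unfolding extensible_def by blast
  moreover have "one_way m n c t L F"
    using F(1) reaches_cong[OF _ _ assms(2)] blank_cong[of c s t m n] assms(2)
    unfolding one_way_def is_layout_def by fastforce
  moreover have "rows_separated n c t F" "cols_separated m c t F"
    using F(2,3) assms(2) unfolding rows_separated_def cols_separated_def by (metis (no_types, lifting))+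
  ultimately show ?thesis unfolding extensible_def by blast
qed

text \<open>The sinks in \<open>U\<close> move down by one. By \<open>sep\<close> they lie strictly
  below the others, so a cut between the lowest sink outside \<open>U\<close> and the highest one in
  \<open>U\<close> is the place for the row.\<close>

lemma extensible_insert_row:
  assumes "extensible m n c s" "c \<le> n"
    and sep: "\<And>i j. i < c \<Longrightarrow> j < c \<Longrightarrow> i \<in> U \<Longrightarrow> j \<notin> U \<Longrightarrow> fst (s j) < fst (s i)"
  shows "extensible (Suc m) n c (\<lambda>i. if i \<in> U then (fst (s i) + 1, snd (s i)) else s i)"
proof -
  obtain L F where ow: "one_way m n c s L F"
    and rows: "\<And>i j. i < c \<Longrightarrow> j < c \<Longrightarrow> fst (s i) < fst (s j) \<Longrightarrow>
      \<exists>g. fst (s i) < g \<and> g \<le> fst (s j) \<and> row_cut n c F g"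
    and cols: "\<And>i j. i < c \<Longrightarrow> j < c \<Longrightarrow> snd (s i) < snd (s j) \<Longrightarrow>
      \<exists>g. snd (s i) < g \<and> g \<le> snd (s j) \<and> col_cut m c F g"
    using assms(1) unfolding extensible_def rows_separated_def cols_separated_def by blast
  have grid: "0 \<le> fst (s i)" "fst (s i) < int m" if "i < c" for i
    using ow that unfolding one_way_def in_grid_def by auto
  let ?lo = "(\<lambda>i. fst (s i)) ` {i. i < c \<and> i \<notin> U}" and ?hi = "(\<lambda>i. fst (s i)) ` {i. i < c \<and> i \<in> U}"
  have "\<exists>k. 0 \<le> k \<and> k \<le> int m \<and> row_cut n c F k \<and> (\<forall>i<c. k \<le> fst (s i) \<longleftrightarrow> i \<in> U)"
  \<comment> \<open>If all sinks move, or none, the cut is taken on the boundary.\<close>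
  proof (cases "?lo = {} \<or> ?hi = {}")
    case True
    then show ?thesis
    proof
      assume "?lo = {}"
      then show ?thesis using row_cut_boundary[OF ow assms(2), of 0] grid by (intro exI[of _ 0]) auto
    next
      assume "?hi = {}"
      then show ?thesis using row_cut_boundary[OF ow assms(2), of "int m"] grid
        by (intro exI[of _ "int m"]) (auto simp: not_le)
    qed
  next
    case False
    have fin: "finite ?lo" "finite ?hi" by auto
    have "Max ?lo \<in> ?lo" "Min ?hi \<in> ?hi" using Max_in[OF fin(1)] Min_in[OF fin(2)] False by auto
    then obtain a b where a: "a < c" "a \<notin> U" "Max ?lo = fst (s a)"
      and b: "b < c" "b \<in> U" "Min ?hi = fst (s b)" by auto
    then obtain g where g: "fst (s a) < g" "g \<le> fst (s b)" "row_cut n c F g"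
      using rows[of a b] sep by blast
    have "g \<le> fst (s i) \<longleftrightarrow> i \<in> U" if "i < c" for i
    proof
      assume "g \<le> fst (s i)"
      show "i \<in> U"
      proof (rule ccontr)
        assume "i \<notin> U"
        then have "fst (s i) \<le> Max ?lo" using that by (intro Max_ge fin) auto
        with a g \<open>g \<le> fst (s i)\<close> show False by linarith
      qed
    next
      assume "i \<in> U"
      then have "Min ?hi \<le> fst (s i)" using that by (intro Min_le fin) auto
      with b g show "g \<le> fst (s i)" by linarith
    qed
    then show ?thesis using g grid[OF a(1)] grid[OF b(1)] by (intro exI[of _ g]) auto
  qed
  then obtain k where k: "0 \<le> k" "k \<le> int m" "row_cut n c F k"
    and kU: "\<And>i. i < c \<Longrightarrow> k \<le> fst (s i) \<longleftrightarrow> i \<in> U" by blast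
  obtain j where j: "inj_on j {..<c}" "\<And>i. i < c \<Longrightarrow> 0 \<le> j i \<and> j i < int n"
    "\<And>i. i < c \<Longrightarrow> ((k, j i), S) \<in> F i \<or> ((k - 1, j i), N) \<in> F i"
    using k(3) unfolding row_cut_def by blast
  interpret row_insertion m n c s L F k j
    using ow k j by unfold_locales blast+
  have "extensible (Suc m) n c s'"
    unfolding extensible_def rows_separated_def cols_separated_def
  proof (intro exI[of _ L'] exI[of _ F'] conjI allI impI one_way_new)
    fix a b assume ab: "a < c" "b < c" and less: "fst (s' a) < fst (s' b)"
    then have less': "fst (s a) < fst (s b)" by (auto simp: lift_def split: if_splits)
    then obtain g where g: "fst (s a) < g" "g \<le> fst (s b)" "row_cut n c F g" using rows ab by blast
    show "\<exists>g. fst (s' a) < g \<and> g \<le> fst (s' b) \<and> row_cut n c F' g"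
    proof (cases "fst (s a) < k \<and> k \<le> fst (s b)")
      case True
      then show ?thesis using row_cut_new(1) by (intro exI[of _ k]) (auto simp: lift_def)
    next
      case False
      then show ?thesis
        using g less' row_cut_lift[OF g(3)] row_cut_new(2)
        by (intro exI[of _ "if g < k then g else g + 1"]) (cases "g = k"; auto simp: lift_def)
    qed
  next
    fix a b assume ab: "a < c" "b < c" and "snd (s' a) < snd (s' b)"
    then have "snd (s a) < snd (s b)" by (auto simp: lift_def split: if_splits)
    then obtain g where "snd (s a) < g" "g \<le> snd (s b)" "col_cut m c F g" using cols ab by blast
    then show "\<exists>g. snd (s' a) < g \<and> g \<le> snd (s' b) \<and> col_cut (Suc m) c F' g"
      using col_cut_lift by (intro exI[of _ g]) (auto simp: lift_def)
  qed
  then show ?thesis by (rule extensible_cong) (use kU in \<open>force simp: lift_def\<close>)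
qed

text \<open>\<open>e\<close> lines are inserted in total, and \<open>b i - a i\<close> of them
  before line \<open>a i\<close>; hence the displacement is monotone in \<open>a i\<close>.\<close>

definition displaced :: "nat \<Rightarrow> nat \<Rightarrow> (nat \<Rightarrow> int) \<Rightarrow> (nat \<Rightarrow> int) \<Rightarrow> bool" where
  "displaced c e a b \<longleftrightarrow> (\<forall>i<c. a i \<le> b i \<and> b i \<le> a i + int e) \<and>
     (\<forall>i<c. \<forall>j<c. a i \<le> a j \<longrightarrow> b i - a i \<le> b j - a j)"

lemma extensible_insert_rows:
  assumes "extensible m n c s" "c \<le> n"
    and "displaced c e (\<lambda>i. fst (s i)) (\<lambda>i. fst (t i))"
    and "\<And>i. i < c \<Longrightarrow> snd (t i) = snd (s i)"
  shows "extensible (m + e) n c t"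
  using assms(1,3,4)
proof (induction e arbitrary: m s)
  case 0
  then have "s i = t i" if "i < c" for i using that by (force simp: displaced_def intro: prod_eqI)
  then show ?case using extensible_cong[OF 0(1)] by simp
next
  case (Suc e)
  \<comment> \<open>The current row goes in front of those sinks that need all \<open>Suc e\<close>
    new rows before them; every other sink still has at least as many rows to come as it
    needs.\<close>
  define U where "U = {i. fst (t i) = fst (s i) + int (Suc e)}"
  let ?s = "\<lambda>i. if i \<in> U then (fst (s i) + 1, snd (s i)) else s i"
  have bnd: "fst (s i) \<le> fst (t i)" "fst (t i) \<le> fst (s i) + int (Suc e)" if "i < c" for i
    using Suc.prems(2) that unfolding displaced_def by auto
  have mono: "fst (t i) - fst (s i) \<le> fst (t j) - fst (s j)"
    if "i < c" "j < c" "fst (s i) \<le> fst (s j)" for i j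
    using Suc.prems(2) that unfolding displaced_def by auto
  have sep: "fst (s j) < fst (s i)" if "i < c" "j < c" "i \<in> U" "j \<notin> U" for i j
    using mono[of i j] bnd[of j] that by (cases "fst (s i) \<le> fst (s j)") (auto simp: U_def)
  have "extensible (Suc m) n c ?s" by (rule extensible_insert_row[OF Suc.prems(1) assms(2) sep])
  moreover have "displaced c e (\<lambda>i. fst (?s i)) (\<lambda>i. fst (t i))"
    unfolding displaced_def
  proof (intro conjI allI impI)
    fix i assume i: "i < c"
    show "fst (?s i) \<le> fst (t i)" using bnd[OF i] by (auto simp: U_def)
    show "fst (t i) \<le> fst (?s i) + int e" using bnd[OF i] by (auto simp: U_def)
  next
    fix i j assume ij: "i < c" "j < c" "fst (?s i) \<le> fst (?s j)"
    then show "fst (t i) - fst (?s i) \<le> fst (t j) - fst (?s j)"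
      using mono[of i j] sep[of i j] bnd[of i] bnd[of j]
      by (cases "i \<in> U"; cases "j \<in> U") (auto simp: U_def)
  qed
  ultimately have "extensible (Suc m + e) n c t" by (rule Suc.IH) (use Suc.prems(3) in auto)
  then show ?case by simp
qed

section \<open>Symmetries\<close>

definition map_layout :: "(cell \<Rightarrow> cell) \<Rightarrow> (dir \<Rightarrow> dir) \<Rightarrow> layout \<Rightarrow> layout" where
  "map_layout f g L = (\<lambda>p. map_option (\<lambda>(i, d). (i, g d)) (L (f p)))"

text \<open>Involutions suffice: the transposition and the flip of the rows generate all eight
  symmetries, and with an involution the same map transports the layout back.\<close>

locale board_symmetry =
  fixes m n m' n' :: nat and f :: "cell \<Rightarrow> cell" and g :: "dir \<Rightarrow> dir"
  assumes ff [simp]: "f (f p) = p" and gg [simp]: "g (g d) = d"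
    and shift_f: "shift (f p) (g d) 1 = f (shift p d 1)"
    and in_grid_f [simp]: "in_grid m' n' (f p) \<longleftrightarrow> in_grid m n p"
    and entry_f: "(p, d) \<in> entries m' n' \<Longrightarrow> (f p, g d) \<in> entries m n"
begin

lemma blank_f [simp]: "blank m' n' c (\<lambda>i. f (s i)) (f p) \<longleftrightarrow> blank m n c s p"
  unfolding blank_def is_sink_def by (metis ff in_grid_f)

lemma turn_f: "turn (map_layout f g L) i (f p) (g d) = g (turn L i p d)"
  by (auto simp: turn_def map_layout_def split: option.splits)

lemma reaches_f:
  assumes "reaches m n c s L i A p d"
  shows "reaches m' n' c (\<lambda>i. f (s i)) (map_layout f g L) i (map_prod f g ` A) (f p) (g d)"
proof -
  have notin: "(f p, g d) \<notin> map_prod f g ` A" if "(p, d) \<notin> A" for p d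
  proof
    assume "(f p, g d) \<in> map_prod f g ` A"
    then obtain q e where "(q, e) \<in> A" "f p = f q" "g d = g e" by auto
    then have "p = q" "d = e" by (metis ff, metis gg)
    with \<open>(q, e) \<in> A\<close> that show False by blast
  qed
  show ?thesis using assms
  proof (induction rule: reaches.induct)
    case (sink d)
    then show ?case using notin by (intro reaches.sink)
  next
    case (step p d e)
    show ?case
    proof (rule reaches.step)
      show "(f p, g d) \<notin> map_prod f g ` A" by (rule notin[OF step.hyps(1)])
      show "blank m' n' c (\<lambda>i. f (s i)) (f p)" using step.hyps(2) by simp
      show "g e = turn (map_layout f g L) i (f p) (g d)" by (simp only: turn_f step.hyps(3))
      show "reaches m' n' c (\<lambda>i. f (s i)) (map_layout f g L) i (map_prod f g ` A)
          (shift (f p) (g e) 1) (g e)"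
        using step.IH shift_f by simp
    qed
  qed
qed

lemma is_layout_f: "is_layout m n c s L \<Longrightarrow> is_layout m' n' c (\<lambda>i. f (s i)) (map_layout f g L)"
proof -
  assume L: "is_layout m n c s L"
  show ?thesis unfolding is_layout_def
  proof (intro allI impI)
    fix p a assume "map_layout f g L p = Some a"
    then obtain d where "L (f p) = Some (fst a, d)" unfolding map_layout_def by auto
    then have "blank m n c s (f p)" "fst a < c" using L unfolding is_layout_def by fastforce+
    then show "blank m' n' c (\<lambda>i. f (s i)) p \<and> fst a < c" using blank_f[of c s "f p"] by simp
  qed
qed

lemma perfect_f:
  assumes "has_perfect_layout m n c s"
  shows "has_perfect_layout m' n' c (\<lambda>i. f (s i))"
proof -
  obtain L where L: "is_layout m n c s L"
    "\<And>i p d. i < c \<Longrightarrow> (p, d) \<in> entries m n \<Longrightarrow> succeeds m n c s L i p d"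
    using assms unfolding has_perfect_layout_def perfect_layout_def by blast
  have "succeeds m' n' c (\<lambda>i. f (s i)) (map_layout f g L) i p d"
    if "i < c" "(p, d) \<in> entries m' n'" for i p d
    using reaches_f[OF succeeds_imp_reaches[OF L(2)[OF that(1) entry_f[OF that(2)]]]]
      reaches_imp_succeeds by simp
  then show ?thesis using is_layout_f[OF L(1)]
    unfolding has_perfect_layout_def perfect_layout_def by blast
qed

end

fun transpose_dir :: "dir \<Rightarrow> dir" where
  "transpose_dir N = W" | "transpose_dir W = N" | "transpose_dir S = E" | "transpose_dir E = S"

fun flip_dir :: "dir \<Rightarrow> dir" where
  "flip_dir N = S" | "flip_dir S = N" | "flip_dir E = E" | "flip_dir W = W"

interpretation transposition: board_symmetry m n n m prod.swap transpose_dir for m n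
proof
  fix p d
  show "transpose_dir (transpose_dir d) = d" by (cases d) auto
  show "shift (prod.swap p) (transpose_dir d) 1 = prod.swap (shift p d 1)"
    by (cases d) (auto simp: shift_def)
qed (auto simp: in_grid_def entries_iff)

interpretation row_flip: board_symmetry m n m n "\<lambda>(x, y). (int m - 1 - x, y)" flip_dir for m n
proof
  fix p d
  show "flip_dir (flip_dir d) = d" by (cases d) auto
  show "shift (case p of (x, y) \<Rightarrow> (int m - 1 - x, y)) (flip_dir d) 1 =
      (case shift p d 1 of (x, y) \<Rightarrow> (int m - 1 - x, y))"
    by (cases d; cases p) (auto simp: shift_def)
qed (auto simp: in_grid_def entries_iff)

lemma reversal_transpose: "map_prod prod.swap transpose_dir (reversal st) = reversal (map_prod prod.swap transpose_dir st)"
  by (cases st; cases "snd st") (auto simp: reversal_def shift_def)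

text \<open>Row cuts and column cuts change places, so the insertion of columns becomes an instance
  of the insertion of rows.\<close>

lemma extensible_transpose:
  assumes "extensible m n c s"
  shows "extensible n m c (\<lambda>i. prod.swap (s i))"
proof -
  obtain L F where ow: "one_way m n c s L F"
    and sep: "rows_separated n c s F" "cols_separated m c s F"
    using assms unfolding extensible_def by blast
  let ?tr = "map_prod prod.swap transpose_dir :: cell \<times> dir \<Rightarrow> _"
  let ?F = "\<lambda>i. ?tr ` F i"
  have mem: "(p, d) \<in> ?F i \<longleftrightarrow> (prod.swap p, transpose_dir d) \<in> F i" for p d i
  proof
    assume "(prod.swap p, transpose_dir d) \<in> F i"
    then have "?tr (prod.swap p, transpose_dir d) \<in> ?F i" by blast
    then show "(p, d) \<in> ?F i" by simp
  qed auto
  have rev: "reversal ` ?F i = ?tr ` reversal ` F i" for i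
    by (simp add: image_image reversal_transpose)
  have "one_way n m c (\<lambda>i. prod.swap (s i)) (map_layout prod.swap transpose_dir L) ?F"
    unfolding one_way_def
  proof (intro conjI allI impI ballI)
    show "is_layout n m c (\<lambda>i. prod.swap (s i)) (map_layout prod.swap transpose_dir L)"
      using ow transposition.is_layout_f unfolding one_way_def by blast
  next
    fix i assume "i < c"
    then show "in_grid n m (prod.swap (s i))" using ow unfolding one_way_def by simp
    show "entries n m \<subseteq> ?F i"
    proof
      fix st assume st: "st \<in> entries n m"
      obtain p d where "st = (p, d)" by (cases st)
      then have "(prod.swap p, transpose_dir d) \<in> F i"
        using one_way_entries[OF ow \<open>i < c\<close>] transposition.entry_f st by simp
      then show "st \<in> ?F i" using \<open>st = (p, d)\<close> mem by simp
    qed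
  next
    fix i st assume i: "i < c" and "st \<in> ?F i"
    then obtain p d where pd: "(p, d) \<in> F i" "st = (prod.swap p, transpose_dir d)"
      by (metis imageE map_prod_simp surj_pair)
    from transposition.reaches_f[OF one_way_reaches[OF ow i pd(1)]]
    show "case st of (p, d) \<Rightarrow> reaches n m c (\<lambda>i. prod.swap (s i))
        (map_layout prod.swap transpose_dir L) i (reversal ` ?F i) p d"
      unfolding rev using pd by simp
  qed
  moreover have "row_cut n c F g = col_cut n c ?F g" "col_cut m c F g = row_cut m c ?F g" for g
    unfolding row_cut_def col_cut_def mem prod.swap_def transpose_dir.simps fst_conv snd_conv
    by (rule refl)+
  ultimately show ?thesis using sep unfolding extensible_def rows_separated_def cols_separated_def
    by (intro exI[of _ "map_layout prod.swap transpose_dir L"] exI[of _ ?F]) auto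
qed

text \<open>Insert the rows, transpose, insert the columns as rows, and transpose back. Both sides
  have at least \<open>c\<close> cells, as the boundary cuts require.\<close>

lemma perfect_if_displaced:
  assumes "extensible m n c s" "c \<le> m" "c \<le> n"
    and rows: "displaced c e (\<lambda>i. fst (s i)) (\<lambda>i. fst (t i))"
    and cols: "displaced c e' (\<lambda>i. snd (s i)) (\<lambda>i. snd (t i))"
  shows "has_perfect_layout (m + e) (n + e') c t"
proof -
  have "extensible (m + e) n c (\<lambda>i. (fst (t i), snd (s i)))"
    using extensible_insert_rows[OF assms(1,3)] rows by simp
  then have "extensible n (m + e) c (\<lambda>i. (snd (s i), fst (t i)))"
    using extensible_transpose[of "m + e" n c] by fastforce
  then have "extensible (n + e') (m + e) c (\<lambda>i. (snd (t i), fst (t i)))"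
    using extensible_insert_rows[of n "m + e" c _ e' "\<lambda>i. (snd (t i), fst (t i))"] assms(2) cols by simp
  then have "extensible (m + e) (n + e') c t"
    using extensible_transpose[of "n + e'" "m + e" c] by fastforce
  then obtain L F where ow: "one_way (m + e) (n + e') c t L F" unfolding extensible_def by blast
  then have "succeeds (m + e) (n + e') c t L i p d"
    if "i < c" "(p, d) \<in> entries (m + e) (n + e')" for i p d
    using that reaches_imp_succeeds unfolding one_way_def by blast
  then show ?thesis using ow
    unfolding has_perfect_layout_def perfect_layout_def one_way_def by blast
qed

lemma perfect_recolour:
  assumes "has_perfect_layout m n c s" and r: "\<And>i. r (r i) = i" "\<And>i. i < c \<Longrightarrow> r i < c"
  shows "has_perfect_layout m n c (\<lambda>i. s (r i))"
proof -
  obtain L where L: "is_layout m n c s L"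
    "\<And>i p d. i < c \<Longrightarrow> (p, d) \<in> entries m n \<Longrightarrow> succeeds m n c s L i p d"
    using assms unfolding has_perfect_layout_def perfect_layout_def by blast
  let ?L = "\<lambda>p. map_option (\<lambda>(i, d). (r i, d)) (L p)"
  have blank: "blank m n c (\<lambda>i. s (r i)) = blank m n c s"
    using r unfolding blank_def is_sink_def fun_eq_iff by metis
  have turn: "turn ?L i = turn L (r i)" for i
    using r(1) by (auto simp: turn_def fun_eq_iff split: option.splits)
  have "reaches m n c (\<lambda>i. s (r i)) ?L i {} p d" if "reaches m n c s L (r i) {} p d" for i p d
    using that
  proof (induction rule: reaches.induct)
    case (sink d)
    then show ?case using reaches.sink[of "\<lambda>i. s (r i)" i] by simp
  next
    case (step p d e)
    show ?case
    proof (rule reaches.step)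
      show "e = turn ?L i p d" using step.hyps(3) turn by metis
      show "blank m n c (\<lambda>i. s (r i)) p" using step.hyps(2) blank by simp
    qed (use step in simp_all)
  qed
  then have "succeeds m n c (\<lambda>i. s (r i)) ?L i p d" if "i < c" "(p, d) \<in> entries m n" for i p d
    using L(2)[OF r(2)[OF that(1)] that(2)] by (simp add: succeeds_iff_reaches)
  moreover have "is_layout m n c (\<lambda>i. s (r i)) ?L"
    unfolding is_layout_def blank
  proof (intro allI impI)
    fix p a assume "map_option (\<lambda>(i, d). (r i, d)) (L p) = Some a"
    then obtain i d where "L p = Some (i, d)" "a = (r i, d)" by auto
    then show "blank m n c s p \<and> fst a < c" using L(1) r(2) unfolding is_layout_def by fastforce
  qed
  ultimately show ?thesis unfolding has_perfect_layout_def perfect_layout_def by blast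
qed

section \<open>Checking small boards by evaluation\<close>

datatype tile = Free | Sink nat | Arrow nat dir

text \<open>The view of one colour: foreign arrows look empty and foreign sinks are failures. The
  board is translated once per colour, so \<open>run\<close> never compares colours.\<close>

datatype action = Stop | Fail | Go | Turn dir

fun view :: "nat \<Rightarrow> tile \<Rightarrow> action" where
  "view i Free = Go"
| "view i (Sink k) = (if k = i then Stop else Fail)"
| "view i (Arrow k d) = (if k = i then Turn d else Go)"

text \<open>The default value takes the place of a bounds test: \<open>run\<close> reads
  \<open>Fail\<close> beyond the south and east sides. Leaving to the north or west is caught in
  \<open>move\<close>, since coordinates are natural numbers.\<close>

fun nth_or :: "'a \<Rightarrow> 'a list \<Rightarrow> nat \<Rightarrow> 'a" where
  "nth_or x [] k = x"
| "nth_or x (y # ys) 0 = y"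
| "nth_or x (y # ys) (Suc k) = nth_or x ys k"

lemma nth_or_conv: "nth_or x ys k = (if k < length ys then ys ! k else x)"
  by (induction x ys k rule: nth_or.induct) auto

fun move :: "(dir \<Rightarrow> nat \<Rightarrow> nat \<Rightarrow> bool) \<Rightarrow> dir \<Rightarrow> nat \<Rightarrow> nat \<Rightarrow> bool" where
  "move f N x y \<longleftrightarrow> (case x of 0 \<Rightarrow> False | Suc x' \<Rightarrow> f N x' y)"
| "move f W x y \<longleftrightarrow> (case y of 0 \<Rightarrow> False | Suc y' \<Rightarrow> f W x y')"
| "move f S x y \<longleftrightarrow> f S (Suc x) y"
| "move f E x y \<longleftrightarrow> f E x (Suc y)"

text \<open>The first argument is fuel; running out of it counts as failure, so a positive answer is
  always sound. \<open>A\<close> lists the states to be avoided.\<close>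

primrec run :: "nat \<Rightarrow> action list list \<Rightarrow> (dir \<times> nat \<times> nat) list \<Rightarrow> dir \<Rightarrow> nat \<Rightarrow> nat \<Rightarrow> bool" where
  "run 0 V A d x y \<longleftrightarrow> False"
| "run (Suc t) V A d x y \<longleftrightarrow>
    (if List.member A (d, x, y) then False
     else case nth_or Fail (nth_or [] V x) y of
       Stop \<Rightarrow> True | Fail \<Rightarrow> False | Go \<Rightarrow> move (run t V A) d x y | Turn e \<Rightarrow> move (run t V A) e x y)"

text \<open>Boards are written as pictures: digits are sinks, and the arrows of the three colours are
  written as \<open>nsew\<close>, \<open>NSEW\<close> and \<open>udrl\<close> (up, down, right, left).\<close>

definition tile_of :: "char \<Rightarrow> tile" where
  "tile_of x = (case map_of
     (zip ''nsewNSEWudrl012'' (map (Arrow 0) [N, S, E, W] @ map (Arrow 1) [N, S, E, W] @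
        map (Arrow 2) [N, S, E, W] @ map Sink [0, 1, 2])) x of Some t \<Rightarrow> t | None \<Rightarrow> Free)"

definition board :: "string list \<Rightarrow> tile list list" where
  "board = map (map tile_of)"

text \<open>In a cut \<open>(g, xs)\<close>, packets of colour \<open>i\<close> cross the edge between lines \<open>g - 1\<close> and \<open>g\<close> at
  position \<open>fst (xs ! i)\<close> only in the direction \<open>snd (xs ! i)\<close>.\<close>

type_synonym cut = "nat \<times> (nat \<times> dir) list"

definition row_state :: "nat \<Rightarrow> nat \<times> dir \<Rightarrow> dir \<times> nat \<times> nat" where
  "row_state g = (\<lambda>(y, d). (d, if d = S then g else g - 1, y))"

definition col_state :: "nat \<Rightarrow> nat \<times> dir \<Rightarrow> dir \<times> nat \<times> nat" where
  "col_state g = (\<lambda>(x, d). (d, x, if d = E then g else g - 1))"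

text \<open>With \<open>f = id\<close> these are the one-way states of the cuts, with
  \<open>f = opp\<close> their reversals.\<close>

definition cut_states :: "(dir \<Rightarrow> dir) \<Rightarrow> nat \<Rightarrow> cut list \<Rightarrow> cut list \<Rightarrow> (dir \<times> nat \<times> nat) list" where
  "cut_states f i R C =
     map (\<lambda>(g, xs). row_state g (map_prod id f (xs ! i))) R @
     map (\<lambda>(g, xs). col_state g (map_prod id f (xs ! i))) C"

definition entry_states :: "nat \<Rightarrow> nat \<Rightarrow> (dir \<times> nat \<times> nat) list" where
  "entry_states m n = concat (map (\<lambda>y. [(S, 0, y), (N, m - 1, y)]) [0..<n]) @
     concat (map (\<lambda>x. [(E, x, 0), (W, x, n - 1)]) [0..<m])"

text \<open>The constant 64 only has to be large enough for all runs on the boards below, which have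
  at most 56 cells. Reversals of entries are missing from \<open>A\<close> because they lie off the
  grid.\<close>

definition check_colour :: "tile list list \<Rightarrow> cut list \<Rightarrow> cut list \<Rightarrow> nat \<Rightarrow> bool" where
  "check_colour B R C i \<longleftrightarrow>
     (let V = map (map (view i)) B; A = cut_states opp i R C
      in list_all (\<lambda>(d, x, y). run 64 V A d x y) (cut_states id i R C @ entry_states (length B) (length (hd B))))"

definition tile :: "tile list list \<Rightarrow> nat \<Rightarrow> nat \<Rightarrow> tile" where
  "tile B x y = nth_or Free (nth_or [] B x) y"

definition check_tiles :: "tile list list \<Rightarrow> (nat \<times> nat) list \<Rightarrow> bool" where
  "check_tiles B ss \<longleftrightarrow> list_all (\<lambda>row. length row = length (hd B)) B \<and>
     list_all (\<lambda>x. list_all (\<lambda>y. case tile B x y of Free \<Rightarrow> True | Sink i \<Rightarrow> i < 3 \<and> ss ! i = (x, y)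
        | Arrow i d \<Rightarrow> i < 3) [0..<length (hd B)]) [0..<length B] \<and>
     list_all (\<lambda>i. case ss ! i of (x, y) \<Rightarrow> x < length B \<and> y < length (hd B) \<and> tile B x y = Sink i) [0, 1, 2]"

definition check_cuts :: "nat \<Rightarrow> dir \<Rightarrow> dir \<Rightarrow> nat list \<Rightarrow> cut list \<Rightarrow> bool" where
  "check_cuts n d e zs R \<longleftrightarrow>
     list_all (\<lambda>(g, xs). 0 < g \<and> length xs = 3 \<and> distinct (map fst xs) \<and>
       list_all (\<lambda>(y, d'). y < n \<and> (d' = d \<or> d' = e)) xs) R \<and>
     list_all (\<lambda>a. list_all (\<lambda>b. a < b \<longrightarrow> list_ex (\<lambda>(g, xs). a < g \<and> g \<le> b) R) zs) zs"

definition check_board :: "tile list list \<Rightarrow> (nat \<times> nat) list \<Rightarrow> cut list \<Rightarrow> cut list \<Rightarrow> bool" where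
  "check_board B ss R C \<longleftrightarrow> length ss = 3 \<and> check_tiles B ss \<and>
     check_cuts (length (hd B)) N S (map fst ss) R \<and> check_cuts (length B) E W (map snd ss) C \<and>
     check_colour B R C 0 \<and> check_colour B R C 1 \<and> check_colour B R C 2"

definition sinks :: "(nat \<times> nat) list \<Rightarrow> nat \<Rightarrow> cell" where
  "sinks ss i = map_prod int int (ss ! i)"

definition layout_of :: "tile list list \<Rightarrow> layout" where
  "layout_of B = (\<lambda>(x, y). if 0 \<le> x \<and> 0 \<le> y
     then (case tile B (nat x) (nat y) of Arrow i d \<Rightarrow> Some (i, d) | _ \<Rightarrow> None) else None)"

abbreviation state_of :: "dir \<times> nat \<times> nat \<Rightarrow> cell \<times> dir" where
  "state_of \<equiv> \<lambda>(d, x, y). ((int x, int y), d)"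

section \<open>Soundness of the evaluated check\<close>

lemma less_3: "(i::nat) < 3 \<longleftrightarrow> i = 0 \<or> i = 1 \<or> i = 2"
  by auto

context
  fixes B :: "tile list list" and ss :: "(nat \<times> nat) list" and m n :: nat and s :: "nat \<Rightarrow> cell"
  assumes tiles: "check_tiles B ss"
  defines "m \<equiv> length B" and "n \<equiv> length (hd B)" and "s \<equiv> sinks ss"
begin

lemma tile_eq: "x < m \<Longrightarrow> y < n \<Longrightarrow> tile B x y = B ! x ! y"
  and length_row: "x < m \<Longrightarrow> length (B ! x) = n"
  and tile_outside: "\<not> (x < m \<and> y < n) \<Longrightarrow> tile B x y = Free"
  using tiles unfolding check_tiles_def tile_def m_def n_def
  by (auto simp: nth_or_conv list_all_length)

lemma tile_Sink: "i < 3 \<Longrightarrow> s i = (int x, int y) \<Longrightarrow> x < m \<and> y < n \<and> tile B x y = Sink i"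
  using tiles unfolding check_tiles_def s_def sinks_def m_def n_def less_3
  by (cases "ss ! i") auto

lemma sink_in_grid: "i < 3 \<Longrightarrow> in_grid m n (s i)"
  using tile_Sink[of i "fst (ss ! i)" "snd (ss ! i)"]
  by (simp add: s_def sinks_def in_grid_def prod_eq_iff)

lemma check_tile: "x < m \<Longrightarrow> y < n \<Longrightarrow> case tile B x y of Free \<Rightarrow> True
    | Sink i \<Rightarrow> i < 3 \<and> ss ! i = (x, y) | Arrow i d \<Rightarrow> i < 3"
  using tiles unfolding check_tiles_def m_def n_def by (simp add: list_all_iff)

lemma Sink_tile: "tile B x y = Sink i \<Longrightarrow> i < 3 \<and> s i = (int x, int y)"
proof -
  assume *: "tile B x y = Sink i"
  have "x < m \<and> y < n" using tile_outside[of x y] * by fastforce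
  then have "i < 3 \<and> ss ! i = (x, y)" using check_tile[of x y] * by simp
  then show ?thesis by (simp add: s_def sinks_def)
qed

lemma Arrow_tile: "tile B x y = Arrow i d \<Longrightarrow> x < m \<and> y < n \<and> i < 3"
proof -
  assume *: "tile B x y = Arrow i d"
  have "x < m \<and> y < n" using tile_outside[of x y] * by fastforce
  then show ?thesis using check_tile[of x y] * by simp
qed

lemma blank_tile: "x < m \<Longrightarrow> y < n \<Longrightarrow> (\<And>i. tile B x y \<noteq> Sink i) \<Longrightarrow> blank m n 3 s (int x, int y)"
  using tile_Sink unfolding blank_def is_sink_def in_grid_def by auto

lemma view_at:
  "nth_or Fail (nth_or [] (map (map (view i)) B) x) y =
    (if x < m \<and> y < n then view i (tile B x y) else Fail)"
  using length_row[of x] tile_eq[of x y] by (auto simp: nth_or_conv m_def)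

lemma turn_layout_of: "turn (layout_of B) i (int x, int y) d =
    (case tile B x y of Arrow k e \<Rightarrow> if k = i then e else d | _ \<Rightarrow> d)"
  by (auto simp: turn_def layout_of_def split: tile.splits)

lemma is_layout_of: "is_layout m n 3 s (layout_of B)"
  unfolding is_layout_def
proof (intro allI impI)
  fix p a assume a: "layout_of B p = Some a"
  then obtain x y where p: "p = (int x, int y)" and t: "tile B x y = Arrow (fst a) (snd a)"
    by (cases p) (auto simp: layout_of_def split: if_splits tile.splits intro: that[of "nat (fst p)" "nat (snd p)"])
  show "blank m n 3 s p \<and> fst a < 3"
    using Arrow_tile[OF t] blank_tile[of x y] t p by auto
qed

text \<open>A successful \<open>run\<close> never leaves the grid, so it also avoids every set
  \<open>X\<close> of states off the grid; \<open>X\<close> will be the set of reversed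
  entries.\<close>

lemma run_imp_reaches:
  assumes "i < 3" and X: "\<And>p d. (p, d) \<in> X \<Longrightarrow> \<not> in_grid m n p"
  shows "run t (map (map (view i)) B) A d x y \<Longrightarrow>
    reaches m n 3 s (layout_of B) i (state_of ` set A \<union> X) (int x, int y) d"
proof (induction t arbitrary: d x y)
  case (Suc t)
  let ?r = "\<lambda>p d. reaches m n 3 s (layout_of B) i (state_of ` set A \<union> X) p d"
  let ?V = "map (map (view i)) B"
  have xy: "x < m" "y < n"
    using Suc.prems unfolding run.simps view_at by (auto split: if_splits)
  have notin: "((int x, int y), d) \<notin> state_of ` set A \<union> X"
    using Suc.prems X[of "(int x, int y)" d] xy
    by (auto simp: in_grid_def split: if_splits)
  have step: "?r (shift (int x, int y) e 1) e" if "move (run t ?V A) e x y" for e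
    using that Suc.IH[of S "Suc x" y] Suc.IH[of E x "Suc y"] Suc.IH
    by (cases e) (auto simp: shift_def add.commute split: nat.splits)
  show ?case
  proof (cases "tile B x y")
    case (Sink k)
    then have "k = i" "s k = (int x, int y)"
      using Suc.prems xy Sink_tile unfolding run.simps view_at by (auto split: if_splits)
    then show ?thesis using reaches.sink[of s i d] notin by metis
  next
    case Free
    then have "move (run t ?V A) d x y"
      using Suc.prems xy unfolding run.simps view_at by (auto split: if_splits)
    then show ?thesis using Free
      by (intro reaches.step[OF notin blank_tile[OF xy] _ step]) (auto simp: turn_layout_of)
  next
    case (Arrow k e)
    then have "move (run t ?V A) (if k = i then e else d) x y"
      using Suc.prems xy unfolding run.simps view_at by (auto split: if_splits)
    then show ?thesis using Arrow
      by (intro reaches.step[OF notin blank_tile[OF xy] _ step]) (auto simp: turn_layout_of)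
  qed
qed simp

end

lemma entry_states: "0 < m \<Longrightarrow> 0 < n \<Longrightarrow> entries m n \<subseteq> state_of ` set (entry_states m n)"
proof
  fix st assume pos: "0 < m" "0 < n" and "st \<in> entries m n"
  then consider y where "y < n" "st = state_of (S, 0, y)" | y where "y < n" "st = state_of (N, m - 1, y)"
    | x where "x < m" "st = state_of (E, x, 0)" | x where "x < m" "st = state_of (W, x, n - 1)"
    unfolding entries_def by (auto simp: of_nat_diff)
  then show "st \<in> state_of ` set (entry_states m n)"
  proof cases
    case 1 then show ?thesis unfolding entry_states_def by (intro image_eqI[of _ _ "(S, 0, y)"]) auto
  next
    case 2 then show ?thesis unfolding entry_states_def by (intro image_eqI[of _ _ "(N, m - 1, y)"]) auto
  next
    case 3 then show ?thesis unfolding entry_states_def by (intro image_eqI[of _ _ "(E, x, 0)"]) auto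
  next
    case 4 then show ?thesis unfolding entry_states_def by (intro image_eqI[of _ _ "(W, x, n - 1)"]) auto
  qed
qed

lemma reversal_row_state: "0 < g \<Longrightarrow> d = N \<or> d = S \<Longrightarrow>
    reversal (state_of (row_state g (y, d))) = state_of (row_state g (y, opp d))"
  by (auto simp: reversal_def row_state_def shift_def)

lemma reversal_col_state: "0 < g \<Longrightarrow> d = E \<or> d = W \<Longrightarrow>
    reversal (state_of (col_state g (x, d))) = state_of (col_state g (x, opp d))"
  by (auto simp: reversal_def col_state_def shift_def)

lemma check_cutsD:
  assumes "check_cuts n d e zs R" "(g, xs) \<in> set R"
  shows "0 < g" "length xs = 3" "distinct (map fst xs)"
    and "i < 3 \<Longrightarrow> fst (xs ! i) < n \<and> (snd (xs ! i) = d \<or> snd (xs ! i) = e)"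
proof -
  have *: "0 < g \<and> length xs = 3 \<and> distinct (map fst xs) \<and>
      (\<forall>z \<in> set xs. fst z < n \<and> (snd z = d \<or> snd z = e))"
    using bspec[OF conjunct1[OF assms(1)[unfolded check_cuts_def list_all_iff]] assms(2)]
    by (simp add: split_beta)
  then show "0 < g" "length xs = 3" "distinct (map fst xs)" by blast+
  show "i < 3 \<Longrightarrow> fst (xs ! i) < n \<and> (snd (xs ! i) = d \<or> snd (xs ! i) = e)"
    using * nth_mem[of i xs] by simp
qed

lemma check_cuts_cover:
  assumes "check_cuts n d e zs R" "a \<in> set zs" "b \<in> set zs" "a < b"
  obtains g xs where "(g, xs) \<in> set R" "a < g" "g \<le> b"
proof -
  have "\<exists>(g, xs) \<in> set R. a < g \<and> g \<le> b"
    using bspec[OF bspec[OF conjunct2[OF assms(1)[unfolded check_cuts_def list_all_iff list_ex_iff]]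
          assms(2)] assms(3)] assms(4) by simp
  then show thesis using that by blast
qed

lemma inj_on_cut:
  assumes "length xs = 3" "distinct (map fst xs)"
  shows "inj_on (\<lambda>i. int (fst (xs ! i))) {..<3}"
  using assms unfolding inj_on_def distinct_conv_nth by (metis length_map lessThan_iff nth_map of_nat_eq_iff)

lemma reversal_cut_states:
  assumes "check_cuts n N S zs R" "check_cuts m E W zs' C" "i < 3"
  shows "reversal ` state_of ` set (cut_states id i R C) \<subseteq> state_of ` set (cut_states opp i R C)"
proof -
  have "reversal (state_of (case z of (g, xs) \<Rightarrow> row_state g (map_prod id id (xs ! i)))) =
      state_of (case z of (g, xs) \<Rightarrow> row_state g (map_prod id opp (xs ! i)))" if "z \<in> set R" for z
  proof -
    obtain g xs where z: "z = (g, xs)" by (cases z)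
    show ?thesis
      using reversal_row_state[of g "snd (xs ! i)" "fst (xs ! i)"] that
        check_cutsD(1)[OF assms(1)] check_cutsD(4)[OF assms(1) _ assms(3)]
      unfolding z by (cases "xs ! i") fastforce
  qed
  moreover have "reversal (state_of (case z of (g, xs) \<Rightarrow> col_state g (map_prod id id (xs ! i)))) =
      state_of (case z of (g, xs) \<Rightarrow> col_state g (map_prod id opp (xs ! i)))" if "z \<in> set C" for z
  proof -
    obtain g xs where z: "z = (g, xs)" by (cases z)
    show ?thesis
      using reversal_col_state[of g "snd (xs ! i)" "fst (xs ! i)"] that
        check_cutsD(1)[OF assms(2)] check_cutsD(4)[OF assms(2) _ assms(3)]
      unfolding z by (cases "xs ! i") fastforce
  qed
  ultimately show ?thesis
    unfolding cut_states_def set_append set_map image_Un image_image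
    by (intro Un_mono image_mono equalityD1[OF image_cong] refl)
qed

theorem check_board_sound:
  assumes "check_board B ss R C"
  shows "extensible (length B) (length (hd B)) 3 (sinks ss)"
proof -
  define m n where "m = length B" and "n = length (hd B)"
  have tiles: "check_tiles B ss" and cuts: "check_cuts n N S (map fst ss) R" "check_cuts m E W (map snd ss) C"
    and len: "length ss = 3" and col: "\<And>i. i < 3 \<Longrightarrow> check_colour B R C i"
    using assms unfolding check_board_def m_def n_def less_3 by auto
  have "in_grid m n (sinks ss 0)" using sink_in_grid[OF tiles, of 0] by (simp add: m_def n_def)
  then have pos: "0 < m" "0 < n" by (auto simp: in_grid_def)
  \<comment> \<open>The one-way edges are those of the listed cuts together with all boundary
    edges.\<close>
  let ?F = "\<lambda>i. state_of ` set (cut_states id i R C) \<union> entries m n"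
  have row_mem: "((int g, int (fst (xs ! i))), S) \<in> ?F i \<or> ((int g - 1, int (fst (xs ! i))), N) \<in> ?F i"
    if "(g, xs) \<in> set R" "i < 3" for g xs i
  proof -
    have "state_of (row_state g (map_prod id id (xs ! i))) \<in> ?F i"
      using that(1) unfolding cut_states_def by force
    moreover have "state_of (row_state g (map_prod id id (xs ! i))) =
        (if snd (xs ! i) = S then ((int g, int (fst (xs ! i))), S) else ((int g - 1, int (fst (xs ! i))), N))"
      using check_cutsD(1)[OF cuts(1) that(1)] check_cutsD(4)[OF cuts(1) that]
      by (cases "xs ! i") (auto simp: row_state_def of_nat_diff)
    ultimately show ?thesis by (metis (no_types, lifting))
  qed
  have col_mem: "((int (fst (xs ! i)), int g), E) \<in> ?F i \<or> ((int (fst (xs ! i)), int g - 1), W) \<in> ?F i"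
    if "(g, xs) \<in> set C" "i < 3" for g xs i
  proof -
    have "state_of (col_state g (map_prod id id (xs ! i))) \<in> ?F i"
      using that(1) unfolding cut_states_def by force
    moreover have "state_of (col_state g (map_prod id id (xs ! i))) =
        (if snd (xs ! i) = E then ((int (fst (xs ! i)), int g), E) else ((int (fst (xs ! i)), int g - 1), W))"
      using check_cutsD(1)[OF cuts(2) that(1)] check_cutsD(4)[OF cuts(2) that]
      by (cases "xs ! i") (auto simp: col_state_def of_nat_diff)
    ultimately show ?thesis by (metis (no_types, lifting))
  qed
  have "one_way m n 3 (sinks ss) (layout_of B) ?F"
    unfolding one_way_def
  proof (intro conjI allI impI ballI)
    show "is_layout m n 3 (sinks ss) (layout_of B)"
      unfolding m_def n_def by (rule is_layout_of[OF tiles])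
  next
    fix i :: nat assume "i < 3"
    then show "in_grid m n (sinks ss i)" unfolding m_def n_def by (rule sink_in_grid[OF tiles])
  next
    fix i show "entries m n \<subseteq> ?F i" by blast
  next
    fix i st assume i: "i < (3::nat)" and "st \<in> ?F i"
    then obtain d x y where dxy: "st = ((int x, int y), d)"
      "(d, x, y) \<in> set (cut_states id i R C @ entry_states m n)"
      using entry_states[OF pos] by fastforce
    then have "run 64 (map (map (view i)) B) (cut_states opp i R C) d x y"
      using col[OF i] unfolding check_colour_def Let_def list_all_iff m_def n_def
      by (metis (no_types, lifting) case_prod_conv)
    then have "reaches m n 3 (sinks ss) (layout_of B) i
        (state_of ` set (cut_states opp i R C) \<union> reversal ` entries m n) (int x, int y) d"
      using run_imp_reaches[OF tiles i, of "reversal ` entries m n"] reversal_off_grid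
      unfolding m_def n_def by blast
    moreover have "reversal ` ?F i \<subseteq> state_of ` set (cut_states opp i R C) \<union> reversal ` entries m n"
      unfolding image_Un by (intro Un_mono reversal_cut_states[OF cuts i] subset_refl)
    ultimately show "case st of (p, d) \<Rightarrow> reaches m n 3 (sinks ss) (layout_of B) i (reversal ` ?F i) p d"
      using reaches_antimono dxy(1) by auto
  qed
  moreover have "\<exists>g. fst (sinks ss i) < g \<and> g \<le> fst (sinks ss j) \<and> row_cut n 3 ?F g"
    if "i < 3" "j < 3" "fst (sinks ss i) < fst (sinks ss j)" for i j
  proof -
    have "fst (ss ! i) < fst (ss ! j)" using that(3) by (simp add: sinks_def)
    moreover have "fst (ss ! i) \<in> set (map fst ss)" "fst (ss ! j) \<in> set (map fst ss)"
      using nth_mem[of i "map fst ss"] nth_mem[of j "map fst ss"] that(1,2) len by simp_all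
    ultimately obtain g xs where g: "(g, xs) \<in> set R" "fst (ss ! i) < g" "g \<le> fst (ss ! j)"
      using check_cuts_cover[OF cuts(1)] by metis
    have "row_cut n 3 ?F (int g)"
      unfolding row_cut_def using inj_on_cut check_cutsD[OF cuts(1) g(1)] row_mem[OF g(1)]
      by (intro exI[of _ "\<lambda>i. int (fst (xs ! i))"]) simp
    then show ?thesis using g by (intro exI[of _ "int g"]) (auto simp: sinks_def)
  qed
  moreover have "\<exists>g. snd (sinks ss i) < g \<and> g \<le> snd (sinks ss j) \<and> col_cut m 3 ?F g"
    if "i < 3" "j < 3" "snd (sinks ss i) < snd (sinks ss j)" for i j
  proof -
    have "snd (ss ! i) < snd (ss ! j)" using that(3) by (simp add: sinks_def)
    moreover have "snd (ss ! i) \<in> set (map snd ss)" "snd (ss ! j) \<in> set (map snd ss)"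
      using nth_mem[of i "map snd ss"] nth_mem[of j "map snd ss"] that(1,2) len by simp_all
    ultimately obtain g xs where g: "(g, xs) \<in> set C" "snd (ss ! i) < g" "g \<le> snd (ss ! j)"
      using check_cuts_cover[OF cuts(2)] by metis
    have "col_cut m 3 ?F (int g)"
      unfolding col_cut_def using inj_on_cut check_cutsD[OF cuts(2) g(1)] col_mem[OF g(1)]
      by (intro exI[of _ "\<lambda>i. int (fst (xs ! i))"]) simp
    then show ?thesis using g by (intro exI[of _ "int g"]) (auto simp: sinks_def)
  qed
  ultimately show ?thesis unfolding extensible_def rows_separated_def cols_separated_def m_def[symmetric] n_def[symmetric]
    by (intro exI[of _ "layout_of B"] exI[of _ ?F]) simp
qed

section \<open>Necessity\<close>

text \<open>This is the means of proving failure: an invariant of moves out of blank cells would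
  have to hold at the sink.\<close>

lemma reaches_invariant:
  assumes "reaches m n c s L i A p d" "P p d"
    and "\<And>p d. P p d \<Longrightarrow> blank m n c s p \<Longrightarrow> P (shift p (turn L i p d) 1) (turn L i p d)"
  shows "\<exists>d. P (s i) d"
  using assms(1,2)
proof (induction rule: reaches.induct)
  case (step p d e)
  then show ?case using assms(3) by simp
qed blast

section \<open>Packets confined to a row or column\<close>

lemma shift_0 [simp]: "shift p d 0 = p"
  by (simp add: shift_def)

lemma shift_shift: "shift (shift p d a) d b = shift p d (a + b)"
  by (simp add: shift_def algebra_simps)

lemma shift_opp_diff: "b \<le> a \<Longrightarrow> shift (shift p d a) (opp d) b = shift p d (a - b)"
  by (cases d) (auto simp: shift_def of_nat_diff)

lemma shift_eq_iff [simp]: "shift p d a = shift p d b \<longleftrightarrow> a = b"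
  by (cases d) (auto simp: shift_def)

lemma perp_opp [simp]: "perp (opp d) e \<longleftrightarrow> perp d e"
  by (cases d; cases e) (auto simp: perp_def)

lemma entries_iff_in_grid: "(p, d) \<in> entries m n \<longleftrightarrow> in_grid m n p \<and> \<not> in_grid m n (shift p (opp d) 1)"
  if "0 < m" "0 < n"
  using that by (cases p; cases d) (auto simp: entries_iff in_grid_def shift_def)

text \<open>Without an own perpendicular arrow among the first \<open>h\<close> cells the packet can
  only move to and fro on them. It ends outside the grid or in the non-blank cell at distance
  \<open>h\<close>, neither of which is its sink.\<close>

lemma reaches_line:
  assumes "reaches m n c s L i A p d" and "in_grid m n (s i)"
    and free: "\<And>k. k \<le> h \<Longrightarrow> shift p d k \<noteq> s i"
    and ends: "\<not> in_grid m n (shift p (opp d) 1)" "\<not> blank m n c s (shift p d h)"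
  shows "\<exists>k<h. \<exists>e. L (shift p d k) = Some (i, e) \<and> perp d e"
proof (rule ccontr)
  assume no: "\<not> ?thesis"
  \<comment> \<open>The two end positions may be in the invariant without any condition on the
    direction: they are not blank, so no move starts there.\<close>
  define P where "P q e \<longleftrightarrow> (\<exists>k<h. q = shift p d k \<and> (e = d \<or> e = opp d)) \<or>
      q = shift p d h \<or> q = shift p (opp d) 1" for q e
  have "\<exists>e. P (s i) e"
  proof (rule reaches_invariant[OF assms(1)])
    show "P p d" by (cases "h = 0") (auto simp: P_def intro!: exI[of _ 0])
  next
    fix q e assume "P q e" and blank: "blank m n c s q"
    then obtain k where k: "k < h" "q = shift p d k" "e = d \<or> e = opp d"
      using ends unfolding P_def blank_def by blast
    have "turn L i q e = d \<or> turn L i q e = opp d"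
    proof (cases "\<exists>e'. L q = Some (i, e')")
      case True
      then obtain e' where e': "L q = Some (i, e')" by blast
      then have "\<not> perp d e'" using no k by blast
      then show ?thesis using e' by (auto simp: turn_def perp_def)
    next
      case False
      then show ?thesis using k(3) by (auto simp: turn_def split: option.splits)
    qed
    then show "P (shift q (turn L i q e) 1) (turn L i q e)"
    proof
      assume *: "turn L i q e = d"
      have "shift q d 1 = shift p d (Suc k)" using k(2) by (simp add: shift_shift)
      then show ?thesis using * k(1) unfolding P_def by (cases "Suc k = h") auto
    next
      assume *: "turn L i q e = opp d"
      show ?thesis
      proof (cases "k = 0")
        case True
        then show ?thesis using * k(2) unfolding P_def by simp
      next
        case False
        then have "shift q (opp d) 1 = shift p d (k - 1)" using k(2) shift_opp_diff[of 1 k p d] by simp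
        then show ?thesis using * k(1) unfolding P_def by (auto intro!: exI[of _ "k - 1"])
      qed
    qed
  qed
  then consider k where "k < h" "s i = shift p d k" | "s i = shift p d h" | "s i = shift p (opp d) 1"
    unfolding P_def by blast
  then show False using free[of h] free[OF less_imp_le] assms(2) ends(1) by cases auto
qed

text \<open>A full row or column read from one of its ends, \<open>p\<close> being the first cell
  and \<open>l\<close> the length; rows and columns in both directions are thus treated
  alike.\<close>

definition is_line :: "nat \<Rightarrow> nat \<Rightarrow> cell \<Rightarrow> dir \<Rightarrow> nat \<Rightarrow> bool" where
  "is_line m n p d l \<longleftrightarrow> 0 < l \<and> in_grid m n p \<and> in_grid m n (shift p d (l - 1)) \<and>
     \<not> in_grid m n (shift p (opp d) 1) \<and> \<not> in_grid m n (shift p d l)"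

lemma line_in_grid: "is_line m n p d l \<Longrightarrow> in_grid m n (shift p d k) \<longleftrightarrow> k < l"
proof -
  assume l: "is_line m n p d l"
  then obtain l' where "l = Suc l'" by (cases l) (auto simp: is_line_def)
  then show ?thesis using l by (cases d) (auto simp: is_line_def in_grid_def shift_def)
qed

lemma is_line_opp: "is_line m n p d l \<Longrightarrow> is_line m n (shift p d (l - 1)) (opp d) l"
proof -
  assume l: "is_line m n p d l"
  then have "shift (shift p d (l - 1)) (opp d) (l - 1) = p"
    "shift (shift p d (l - 1)) (opp d) l = shift p (opp d) 1"
    "shift (shift p d (l - 1)) (opp (opp d)) 1 = shift p d l"
    unfolding is_line_def by (cases d; simp add: shift_def of_nat_diff)+
  then show ?thesis using l unfolding is_line_def by simp
qed

lemma column_is_line: "y < n \<Longrightarrow> 0 < m \<Longrightarrow> is_line m n (0, int y) S m"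
  and row_is_line: "x < m \<Longrightarrow> 0 < n \<Longrightarrow> is_line m n (int x, 0) E n"
  by (simp_all add: is_line_def shift_def in_grid_def of_nat_diff)

lemma in_grid_nat:
  assumes "in_grid m n q"
  obtains x y where "q = (int x, int y)" "x < m" "y < n"
  using assms that[of "nat (fst q)" "nat (snd q)"] by (auto simp: in_grid_def)

section \<open>Consequences of a perfect layout: turning arrows and margins\<close>

locale perfect =
  fixes m n :: nat and s :: "nat \<Rightarrow> cell" and L :: layout
  assumes board: "is_board m n 3 s" and perfect: "perfect_layout m n 3 s L"
begin

abbreviation "bl \<equiv> blank m n 3 s"

lemma grid: "i < 3 \<Longrightarrow> in_grid m n (s i)"
  using board unfolding is_board_def by blast

lemma s_inj: "i < 3 \<Longrightarrow> j < 3 \<Longrightarrow> s i = s j \<longleftrightarrow> i = j"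
  using board unfolding is_board_def by (auto dest: inj_onD)

lemma pos: "0 < m" "0 < n"
  using grid[of 0] by (auto simp: in_grid_def)

lemma entry_reaches: "i < 3 \<Longrightarrow> in_grid m n p \<Longrightarrow> \<not> in_grid m n (shift p (opp d) 1) \<Longrightarrow>
    reaches m n 3 s L i {} p d"
proof -
  assume "i < 3" "in_grid m n p" "\<not> in_grid m n (shift p (opp d) 1)"
  then have "\<forall>(p, d) \<in> entries m n. succeeds m n 3 s L i p d" "(p, d) \<in> entries m n"
    using perfect entries_iff_in_grid[OF pos, of p d] unfolding perfect_layout_def by simp_all
  then show ?thesis using succeeds_imp_reaches by fast
qed

lemma not_blank_sink: "i < 3 \<Longrightarrow> \<not> bl (s i)"
  by (auto simp: blank_def is_sink_def)

definition crossing :: "cell \<Rightarrow> dir \<Rightarrow> nat \<Rightarrow> bool" where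
  "crossing p d k \<longleftrightarrow> (\<exists>i e. L (shift p d k) = Some (i, e) \<and> perp d e)"

text \<open>Each colour in \<open>I\<close> needs a turning arrow before position \<open>h\<close>,
  and since a cell holds one arrow these lie in different cells. \<open>h\<close> will be the first
  sink of the line or the position past its end.\<close>

lemma card_crossings:
  assumes line: "is_line m n p d l" and I: "I \<subseteq> {..<3}"
    and free: "\<And>k i. k < h \<Longrightarrow> i < 3 \<Longrightarrow> shift p d k \<noteq> s i"
    and "end": "\<not> bl (shift p d h)" "\<And>i. i \<in> I \<Longrightarrow> shift p d h \<noteq> s i"
  shows "card I \<le> card {k. k < h \<and> crossing p d k}"
proof -
  have "\<exists>k<h. \<exists>e. L (shift p d k) = Some (i, e) \<and> perp d e" if i: "i \<in> I" for i
  proof (rule reaches_line)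
    have i3: "i < 3" using i I by blast
    show "reaches m n 3 s L i {} p d"
      using entry_reaches[OF i3, of p d] line unfolding is_line_def by simp
    show "in_grid m n (s i)" using grid[OF i3] .
    show "shift p d k \<noteq> s i" if "k \<le> h" for k
      using that free[of k i] "end"(2)[OF i] i3 by (cases "k = h") auto
    show "\<not> in_grid m n (shift p (opp d) 1)" using line unfolding is_line_def by blast
  qed (rule "end"(1))
  then obtain f where f: "\<And>i. i \<in> I \<Longrightarrow> f i < h \<and> (\<exists>e. L (shift p d (f i)) = Some (i, e) \<and> perp d e)"
    by metis
  have "inj_on f I"
  proof (rule inj_onI)
    fix i j assume "i \<in> I" "j \<in> I" "f i = f j"
    then obtain e e' where "L (shift p d (f j)) = Some (i, e)" "L (shift p d (f j)) = Some (j, e')"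
      using f[of i] f[of j] by metis
    then show "i = j" by simp
  qed
  moreover have "f ` I \<subseteq> {k. k < h \<and> crossing p d k}" using f unfolding crossing_def by blast
  ultimately show ?thesis by (intro card_inj_on_le) auto
qed

lemma first_sink:
  assumes line: "is_line m n p d l" and "i < 3" "s i = shift p d k"
  shows "\<exists>h a. h \<le> k \<and> a < 3 \<and> s a = shift p d h \<and>
    (\<forall>k i. k < h \<longrightarrow> i < 3 \<longrightarrow> shift p d k \<noteq> s i) \<and> 2 \<le> card {k. k < h \<and> crossing p d k}"
    (is "\<exists>h a. ?P h a")
proof -
  define h where "h = (LEAST k. \<exists>a<3. s a = shift p d k)"
  have ex: "\<exists>a<3. s a = shift p d k" using assms by blast
  then have "\<exists>a<3. s a = shift p d h" unfolding h_def by (rule LeastI)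
  then obtain a where a: "a < 3" "s a = shift p d h" by blast
  have free: "shift p d k \<noteq> s i" if "k < h" "i < 3" for k i
    using not_less_Least[of k "\<lambda>k. \<exists>a<3. s a = shift p d k"] that unfolding h_def by metis
  have "card ({..<3} - {a}) \<le> card {k. k < h \<and> crossing p d k}"
  proof (rule card_crossings[OF line])
    show "\<not> bl (shift p d h)" using not_blank_sink a by metis
    show "shift p d h \<noteq> s i" if "i \<in> {..<3} - {a}" for i using that a s_inj[of a i] by auto
  qed (use free in auto)
  moreover have "card ({..<3::nat} - {a}) = 2" using a(1) by simp
  moreover have "h \<le> k" unfolding h_def by (rule Least_le[of "\<lambda>k. \<exists>a<3. s a = shift p d k", OF ex])
  ultimately have "?P h a" using a free by simp
  then show ?thesis by blast
qed

lemma line_crossings: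
  assumes line: "is_line m n p d l"
  shows "3 + of_bool (\<exists>i<3. \<exists>k<l. s i = shift p d k) \<le> card {k. k < l \<and> crossing p d k}"
proof (cases "\<exists>i<3. \<exists>k<l. s i = shift p d k")
  case False
  have "card {..<3::nat} \<le> card {k. k < l \<and> crossing p d k}"
  proof (rule card_crossings[OF line])
    show "\<not> bl (shift p d l)" using line unfolding is_line_def blank_def by simp
    show "shift p d l \<noteq> s i" if "i \<in> {..<3}" for i
      using line that grid[of i] unfolding is_line_def by auto
    show "shift p d k \<noteq> s i" if "k < l" "i < 3" for k i using False that by metis
  qed simp
  moreover have "(\<exists>i<3. \<exists>k<l. s i = shift p d k) = False" using False by blast
  ultimately show ?thesis by (simp only: of_bool_eq card_lessThan)
next
  case True
  then obtain i k where ik: "i < 3" "k < l" "s i = shift p d k" by blast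
  obtain h a where h: "h \<le> k" "a < 3" "s a = shift p d h"
    "\<And>k i. k < h \<Longrightarrow> i < 3 \<Longrightarrow> shift p d k \<noteq> s i" "2 \<le> card {k. k < h \<and> crossing p d k}"
    using first_sink[OF line ik(1,3)] by blast
  let ?p = "shift p d (l - 1)" and ?d = "opp d"
  have line': "is_line m n ?p ?d l" using is_line_opp[OF line] .
  have rev: "shift ?p ?d j = shift p d (l - 1 - j)" if "j < l" for j
    using shift_opp_diff[of j "l - 1" p d] that by simp
  have "s a = shift ?p ?d (l - 1 - h)" using h(3) h(1) ik(2) rev[of "l - 1 - h"] by simp
  then obtain h' where h': "h' \<le> l - 1 - h" "2 \<le> card {k. k < h' \<and> crossing ?p ?d k}"
    using first_sink[OF line' h(2)] by blast
  \<comment> \<open>\<open>?B\<close> comes from reading the line from its other end, translated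
    back to positions counted from \<open>p\<close>. It lies beyond position \<open>h\<close>, hence
    is disjoint from \<open>?A\<close>.\<close>
  let ?A = "{k. k < h \<and> crossing p d k}" and ?B = "(\<lambda>k. l - 1 - k) ` {k. k < h' \<and> crossing ?p ?d k}"
  have "card ?B = card {k. k < h' \<and> crossing ?p ?d k}"
    using h'(1) by (intro card_image) (auto simp: inj_on_def)
  moreover have "?A \<inter> ?B = {}" using h'(1) by auto
  moreover have "?A \<union> ?B \<subseteq> {k. k < l \<and> crossing p d k}"
    using h(1) h'(1) ik(2) rev unfolding crossing_def by auto
  ultimately have "card ?A + card {k. k < h' \<and> crossing ?p ?d k} \<le> card {k. k < l \<and> crossing p d k}"
    using card_Un_disjoint[of ?A ?B] card_mono[of "{k. k < l \<and> crossing p d k}" "?A \<union> ?B"] by simp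
  moreover have "(\<exists>i<3. \<exists>k<l. s i = shift p d k) = True" using True by blast
  ultimately show ?thesis using h(5) h'(2) by (simp only: of_bool_eq)
qed

text \<open>The two crossings before the first sink occupy two different cells, so this sink, and
  every later one, is preceded by two blank cells.\<close>

lemma margin:
  assumes "is_line m n p d l" "i < 3" "s i = shift p d k"
  shows "2 \<le> k" "bl p" "bl (shift p d 1)"
proof -
  obtain h a where h: "h \<le> k" "a < 3" "s a = shift p d h"
    "\<And>k i. k < h \<Longrightarrow> i < 3 \<Longrightarrow> shift p d k \<noteq> s i" "2 \<le> card {k. k < h \<and> crossing p d k}"
    using first_sink[OF assms] by blast
  have "card {k. k < h \<and> crossing p d k} \<le> card {..<h}" by (intro card_mono) auto
  then have "2 \<le> h" using h(5) by simp
  then show "2 \<le> k" using h(1) by simp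
  have "h < l" using line_in_grid[OF assms(1), of h] h(3) grid[OF h(2)] by simp
  have "bl (shift p d j)" if "j < 2" for j
  proof -
    have "j < l" "j < h" using that \<open>2 \<le> h\<close> \<open>h < l\<close> by simp_all
    then show ?thesis using line_in_grid[OF assms(1), of j] h(4)[of j]
      unfolding blank_def is_sink_def by metis
  qed
  from this[of 0] this[of 1] show "bl p" "bl (shift p d 1)" by simp_all
qed

lemma sink_position:
  assumes "i < 3"
  shows "2 \<le> fst (s i)" "fst (s i) \<le> int m - 3" "2 \<le> snd (s i)" "snd (s i) \<le> int n - 3"
proof -
  obtain x y where s: "s i = (int x, int y)" "x < m" "y < n"
    by (rule in_grid_nat[OF grid[OF assms]])
  note col = column_is_line[OF s(3) pos(1)] and row = row_is_line[OF s(2) pos(2)]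
  show "2 \<le> fst (s i)" using margin(1)[OF col assms, of x] s by (simp add: shift_def)
  show "2 \<le> snd (s i)" using margin(1)[OF row assms, of y] s by (simp add: shift_def)
  show "fst (s i) \<le> int m - 3"
    using margin(1)[OF is_line_opp[OF col] assms, of "m - 1 - x"] s by (simp add: shift_def of_nat_diff)
  show "snd (s i) \<le> int n - 3"
    using margin(1)[OF is_line_opp[OF row] assms, of "n - 1 - y"] s by (simp add: shift_def of_nat_diff)
qed

lemma line_through:
  assumes "in_grid m n q"
  obtains p l k where "is_line m n p d l" "q = shift p d k"
proof -
  obtain x y where q: "q = (int x, int y)" "x < m" "y < n"
    by (rule in_grid_nat[OF assms])
  note col = column_is_line[OF q(3) pos(1)] and row = row_is_line[OF q(2) pos(2)]
  show thesis
  proof (cases d)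
    case S
    then show ?thesis using that[OF col[folded S], of x] q by (simp add: shift_def)
  next
    case E
    then show ?thesis using that[OF row[folded E], of y] q by (simp add: shift_def)
  next
    case N
    then show ?thesis using that[of _ m "m - 1 - x"] is_line_opp[OF col] q by (simp add: shift_def of_nat_diff)
  next
    case W
    then show ?thesis using that[of _ n "n - 1 - y"] is_line_opp[OF row] q by (simp add: shift_def of_nat_diff)
  qed
qed

lemma cond1: "cond1 m n 3 s"
  unfolding cond1_def
proof (intro allI impI)
  fix i d assume i: "i < (3::nat)"
  obtain p l k where line: "is_line m n p (opp d) l" and k: "s i = shift p (opp d) k"
    using line_through[OF grid[OF i], of "opp d"] .
  note mg = margin[OF line i k]
  have bk: "shift (s i) d j = shift p (opp d) (k - j)" if "j \<le> k" for j
    using shift_opp_diff[OF that, of p "opp d"] k by simp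
  let ?X = "{j. 1 \<le> j \<and> bl (shift (s i) d j)}"
  have "?X \<subseteq> {..m + n}"
  proof
    fix j assume "j \<in> ?X"
    then have "in_grid m n (shift (s i) d j)" "in_grid m n (s i)" using grid[OF i] by (auto simp: blank_def)
    then show "j \<in> {..m + n}" by (cases d) (auto simp: in_grid_def shift_def)
  qed
  then have "finite ?X" by (rule finite_subset) simp
  \<comment> \<open>The two blank cells are the outermost ones of the line, at distances
    \<open>k\<close> and \<open>k - 1\<close> from the sink.\<close>
  moreover have "{k, k - 1} \<subseteq> ?X" using mg bk[of k] bk[of "k - 1"] by auto
  ultimately have "card {k, k - 1} \<le> card ?X" by (rule card_mono)
  then show "2 \<le> blanks_towards m n 3 s (s i) d" using mg(1) by (simp add: blanks_towards_def)
qed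

section \<open>Impossible configurations\<close>

lemma no_own_arrow_if_two_away:
  assumes i: "i < 3" and two: "two_away m n 3 s (s i) d" and k: "k = 1 \<or> k = 2"
  shows "L (shift (s i) d k) \<noteq> Some (i, e)"
proof
  assume e: "L (shift (s i) d k) = Some (i, e)"
  let ?p = "shift (s i) d 2"
  have p: "?p = shift (s i) (opp (opp d)) 2" by simp
  have bk: "shift ?p (opp d) j = shift (s i) d (2 - j)" if "j \<le> 2" for j
    using shift_opp_diff[OF that, of "s i" d] .
  \<comment> \<open>With one of the two cells taken by colour \<open>i\<close>, each of the other
    two colours would need an arrow in the same remaining cell, at distance
    \<open>3 - k\<close>.\<close>
  have "\<exists>e. L (shift (s i) d (3 - k)) = Some (j, e)" if j: "j < 3" "j \<noteq> i" for j
  proof -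
    have "\<exists>k<2. \<exists>e. L (shift ?p (opp d) k) = Some (j, e) \<and> perp (opp d) e"
    proof (rule reaches_line)
      have "shift ?p (opp (opp d)) 1 = shift (s i) d 3" by (simp add: shift_shift)
      then show out: "\<not> in_grid m n (shift ?p (opp (opp d)) 1)" using two unfolding two_away_def by simp
      show "reaches m n 3 s L j {} ?p (opp d)"
        using entry_reaches[OF j(1) _ out] two unfolding two_away_def blank_def by blast
      show "in_grid m n (s j)" using grid j by blast
      show "shift ?p (opp d) q \<noteq> s j" if "q \<le> 2" for q
      proof -
        have "2 - q = 0 \<or> 2 - q = 1 \<or> 2 - q = 2" by linarith
        then show ?thesis
          using two not_blank_sink[OF j(1)] s_inj[OF i j(1)] j(2) bk[OF that]
          unfolding two_away_def by (metis shift_0)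
      qed
      show "\<not> bl (shift ?p (opp d) 2)" using not_blank_sink[OF i] bk[of 2] by simp
    qed
    then obtain q e' where q: "q < 2" "L (shift (s i) d (2 - q)) = Some (j, e')" using bk by auto
    have "2 - q \<noteq> k" using q(2) e j(2) by auto
    then have "2 - q = 3 - k" using q(1) k by auto
    then show ?thesis using q by auto
  qed
  moreover have "\<exists>j j'. j < (3::nat) \<and> j' < 3 \<and> j \<noteq> i \<and> j' \<noteq> i \<and> j \<noteq> j'"
    using i by (intro exI[of _ "if i = 0 then 1 else 0"] exI[of _ "if i = 2 then 1 else 2"]) auto
  ultimately show False by (metis option.inject prod.inject)
qed

text \<open>On such a side the sink can only be entered by packets moving straight in from the boundary.\<close>

definition dead_side :: "nat \<Rightarrow> dir \<Rightarrow> bool" where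
  "dead_side i d \<longleftrightarrow> (\<exists>K\<ge>1. \<not> bl (shift (s i) d K) \<and>
     (\<forall>k. 1 \<le> k \<and> k < K \<longrightarrow> (\<forall>e. L (shift (s i) d k) \<noteq> Some (i, e))))"

text \<open>Followed backwards from the sink, a run can never leave the ray on which it arrives,
  because no cell of a dead side turns the packet before the ray is blocked. \<open>T\<close> is the
  set of states on these rays; an entry into a column without this sink is not among them.\<close>

lemma not_all_dead:
  assumes i: "i < 3" and dead: "\<And>d. dead_side i d"
  shows False
proof -
  define T where "T q e \<longleftrightarrow> (\<exists>d k. e = opp d \<and> q = shift (s i) d k \<and>
      (\<forall>j. 1 \<le> j \<and> j \<le> k \<longrightarrow> bl (shift (s i) d j)))" for q e
  have T: "T p d" if "reaches m n 3 s L i {} p d" for p d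
    using that
  proof (induction rule: reaches.induct)
    case (sink d)
    show ?case unfolding T_def by (intro exI[of _ "opp d"] exI[of _ 0]) simp
  next
    case (step p d e)
    then obtain d' k where e: "e = opp d'" and k: "shift p e 1 = shift (s i) d' k"
      and bl: "\<And>j. 1 \<le> j \<Longrightarrow> j \<le> k \<Longrightarrow> bl (shift (s i) d' j)" unfolding T_def by blast
    have "shift (shift p e 1) d' 1 = p" by (simp only: e shift_opp)
    then have p: "p = shift (s i) d' (Suc k)" unfolding k by (simp add: shift_shift)
    have bl': "bl (shift (s i) d' j)" if "1 \<le> j" "j \<le> Suc k" for j
      using that bl[of j] step.hyps(2) p by (cases "j = Suc k") auto
    obtain K where K: "1 \<le> K" "\<not> bl (shift (s i) d' K)"
      "\<And>k e. 1 \<le> k \<Longrightarrow> k < K \<Longrightarrow> L (shift (s i) d' k) \<noteq> Some (i, e)"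
      using dead[of d'] unfolding dead_side_def by blast
    have "Suc k < K" using bl'[of K] K(1,2) by (meson not_le)
    then have "L p \<noteq> Some (i, f)" for f using K(3)[of "Suc k"] p by simp
    then have "turn L i p d = d" by (auto simp: turn_def split: option.splits)
    then have "d = opp d'" using e step.hyps(3) by simp
    then show ?case unfolding T_def using p bl' by blast
  qed
  \<comment> \<open>Column 0 is possible: the sink keeps a margin of two.\<close>
  obtain y :: int where y: "0 \<le> y" "y < int n" "y \<noteq> snd (s i)"
    using sink_position[OF i] by (intro that[of 0]) auto
  have "T (0, y) S"
    using entry_reaches[OF i, of "(0, y)" S] y pos by (intro T) (auto simp: in_grid_def shift_def)
  then obtain d k where "S = opp d" "(0, y) = shift (s i) d k" unfolding T_def by blast
  then show False using y(3) by (cases d) (auto simp: shift_def)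
qed

lemma dead_side_if_sink: "j < 3 \<Longrightarrow> shift (s i) d 1 = s j \<Longrightarrow> dead_side i d"
  using not_blank_sink[of j] unfolding dead_side_def by (intro exI[of _ 1]) auto

lemma dead_side_if_two_away: "i < 3 \<Longrightarrow> two_away m n 3 s (s i) d \<Longrightarrow> dead_side i d"
  unfolding dead_side_def
proof (intro exI[of _ 3] conjI allI impI)
  fix k e assume "i < 3" "two_away m n 3 s (s i) d" and k: "1 \<le> k \<and> k < (3::nat)"
  moreover have "k = 1 \<or> k = 2" using k by auto
  ultimately show "L (shift (s i) d k) \<noteq> Some (i, e)" using no_own_arrow_if_two_away by blast
qed (auto simp: two_away_def blank_def)

lemma two_away_not_sink: "two_away m n 3 s (s i) d \<Longrightarrow> j < 3 \<Longrightarrow> s j \<noteq> shift (s i) d 1"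
  using not_blank_sink[of j] unfolding two_away_def by auto

lemma no_config_a: "\<not> config_a m n 3 s"
proof
  assume "config_a m n 3 s"
  then obtain i d j where i: "i < 3" "\<And>e. e \<noteq> d \<Longrightarrow> two_away m n 3 s (s i) e"
    and j: "j < 3" "adjacent (s i) (s j)" unfolding config_a_def by blast
  then obtain f where f: "s j = shift (s i) f 1" unfolding adjacent_def by blast
  then have "f = d" using i(2)[of f] two_away_not_sink j(1) by blast
  then have "dead_side i e" for e
    using i dead_side_if_two_away[OF i(1), of e] dead_side_if_sink[OF j(1), of i e] f by metis
  then show False using not_all_dead i(1) by blast
qed

text \<open>Two sides are dead because they are two away from the boundary and the two others
  because a sink blocks them. Whether the former are perpendicular or opposite is irrelevant, so
  this refutes (b) and (c) alike.\<close>

lemma two_sides_two_adjacent: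
  assumes i: "i < 3" and "two_away m n 3 s (s i) d" "two_away m n 3 s (s i) e" "d \<noteq> e"
    and adj: "\<And>t. t < 3 \<Longrightarrow> t \<noteq> i \<Longrightarrow> adjacent (s i) (s t)"
  shows False
proof -
  obtain j j' where j: "j < (3::nat)" "j' < 3" "j \<noteq> i" "j' \<noteq> i" "j \<noteq> j'"
    using i that[of "if i = 0 then 1 else 0" "if i = 2 then 1 else 2"] by auto
  obtain f f' where f: "s j = shift (s i) f 1" "s j' = shift (s i) f' 1"
    using adj[of j] adj[of j'] j unfolding adjacent_def by blast
  have "f \<noteq> f'" using f s_inj j by metis
  moreover have "f \<noteq> d" "f \<noteq> e" "f' \<noteq> d" "f' \<noteq> e" using two_away_not_sink assms(2,3) f j(1,2) by metis+
  ultimately have "g = d \<or> g = e \<or> g = f \<or> g = f'" for g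
    using \<open>d \<noteq> e\<close> by (cases d; cases e; cases f; cases f'; cases g) auto
  then have "dead_side i g" for g
    using dead_side_if_two_away[OF i] dead_side_if_sink[OF j(1)] dead_side_if_sink[OF j(2)] assms(2,3) f by metis
  then show False using not_all_dead i by blast
qed

lemma no_config_b: "\<not> config_b m n 3 s"
proof
  assume "config_b m n 3 s"
  then obtain i d e where "i < 3" "perp d e" "two_away m n 3 s (s i) d" "two_away m n 3 s (s i) e"
    "\<forall>t<3. t \<noteq> i \<longrightarrow> adjacent (s i) (s t)" unfolding config_b_def by (elim exE conjE) (rule that)
  then show False by (intro two_sides_two_adjacent[of i d e]) (simp_all add: perp_def)
qed

lemma no_config_c: "\<not> config_c m n 3 s"
proof
  assume "config_c m n 3 s"
  then obtain i d where "i < 3" "two_away m n 3 s (s i) d" "two_away m n 3 s (s i) (opp d)"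
    "\<forall>t<3. t \<noteq> i \<longrightarrow> adjacent (s i) (s t)" unfolding config_c_def by (elim exE conjE) (rule that)
  moreover have "d \<noteq> opp d" by (cases d) auto
  ultimately show False by (intro two_sides_two_adjacent[of i d "opp d"]) simp_all
qed

text \<open>The only side of sink \<open>i\<close> that is not dead is \<open>d\<close>, so the
  middle cell must hold an arrow of colour \<open>i\<close>. Then it holds none of colour
  \<open>t\<close>, and the side of \<open>t\<close> towards \<open>i\<close> is dead. The opposite
  side is blocked by \<open>u\<close>, and the two remaining sides are two away from the boundary,
  as they are for \<open>i\<close>. So all sides of \<open>t\<close> are dead.\<close>

lemma no_config_d: "\<not> config_d m n 3 s"
proof
  assume "config_d m n 3 s"
  then obtain i d t u where i: "i < 3" and two: "\<forall>e. e \<noteq> d \<longrightarrow> two_away m n 3 s (s i) e"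
    and mid: "bl (shift (s i) d 1)" and t: "t < 3" "s t = shift (s i) d 2"
    and u: "u < 3" "u \<noteq> i" "u \<noteq> t" "adjacent (s t) (s u)" and "t \<noteq> i"
    unfolding config_d_def by (elim exE conjE) (rule that)
  let ?q = "shift (s i) d 1"
  obtain f where f: "s u = shift (s t) f 1" using u(4) unfolding adjacent_def by blast
  have bk: "shift (s t) (opp d) 1 = ?q" "shift (s t) (opp d) 2 = s i"
    using shift_opp_diff[of 1 2 "s i" d] shift_opp_diff[of 2 2 "s i" d] t(2) by simp_all
  have outside: "\<not> in_grid m n (shift (s t) e 3)" if "e \<noteq> d" "e \<noteq> opp d" for e
    using two[rule_format, OF that(1)] grid[OF i] that t(2) unfolding two_away_def
    by (cases d; cases e) (auto simp: in_grid_def shift_def)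
  have "f \<noteq> opp d" using f bk(1) mid not_blank_sink[OF u(1)] by metis
  moreover have "f = d" if "f \<noteq> opp d"
  proof (rule ccontr)
    assume "f \<noteq> d"
    \<comment> \<open>In a perpendicular direction there are only two cells between \<open>t\<close>
      and the boundary, so \<open>u\<close> next to \<open>t\<close> would violate the
      margin.\<close>
    then show False using outside[of f] that sink_position[OF u(1)] f
      by (cases f) (auto simp: shift_def in_grid_def)
  qed
  ultimately have fd: "f = d" by blast
  have own: "\<exists>e. L ?q = Some (i, e)"
  proof (rule ccontr)
    assume "\<nexists>e. L ?q = Some (i, e)"
    then have "dead_side i d"
      unfolding dead_side_def using not_blank_sink[OF t(1)] t(2)
      by (intro exI[of _ 2]) (auto simp: less_2_cases_iff)
    then have "dead_side i e" for e using two dead_side_if_two_away[OF i] by metis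
    then show False using not_all_dead i by blast
  qed
  have "dead_side t e" for e
  proof -
    consider "e = d" | "e = opp d" | "e \<noteq> d" "e \<noteq> opp d" by blast
    then show ?thesis
    proof cases
      case 1
      then show ?thesis using dead_side_if_sink[OF u(1), of t d] f fd by simp
    next
      case 2
      then show ?thesis using own bk not_blank_sink[OF i] \<open>t \<noteq> i\<close>
        unfolding dead_side_def by (intro exI[of _ 2]) (auto simp: less_2_cases_iff)
    next
      case 3
      have "bl (shift (s t) e k)" if k: "k = 1 \<or> k = 2" for k
      proof -
        have "shift (s t) e k \<noteq> s w" if "w < 3" for w
        proof -
          have "w = i \<or> w = t \<or> w = u" using that i t(1) u \<open>t \<noteq> i\<close> by auto
          then show ?thesis using 3 k t(2) f fd by (cases "s i"; cases d; cases e) (auto simp: shift_def)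
        qed
        moreover have "in_grid m n (shift (s t) e k)"
          using sink_position[OF t(1)] k by (cases e) (auto simp: in_grid_def shift_def)
        ultimately show ?thesis unfolding blank_def is_sink_def by metis
      qed
      then have "two_away m n 3 s (s t) e" using outside[OF 3] unfolding two_away_def by simp
      then show ?thesis using dead_side_if_two_away[OF t(1)] by blast
    qed
  qed
  then show False using not_all_dead t(1) by blast
qed

section \<open>Counting arrows and the size condition\<close>

definition turning :: "dir \<Rightarrow> cell set" where
  "turning d = {q. in_grid m n q \<and> (\<exists>i e. L q = Some (i, e) \<and> perp d e)}"

text \<open>By \<open>inj\<close> and \<open>cover\<close> the lines \<open>p y\<close> partition
  the grid, so their bounds from \<open>line_crossings\<close> add up; this serves both the rows and
  the columns.\<close>

lemma card_turning:
  assumes lines: "\<And>y. y < l \<Longrightarrow> is_line m n (p y) d k"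
    and inj: "\<And>y x y' x'. shift (p y) d x = shift (p y') d x' \<Longrightarrow> y = y' \<and> x = x'"
    and cover: "\<And>q. in_grid m n q \<Longrightarrow> \<exists>y<l. \<exists>x<k. q = shift (p y) d x"
  shows "3 * l + card ({..<l} \<inter> {y. \<exists>i<3. \<exists>x<k. s i = shift (p y) d x}) \<le> card (turning d)"
proof -
  let ?K = "\<lambda>y. {x. x < k \<and> crossing (p y) d x}"
  let ?P = "\<lambda>y. \<exists>i<3. \<exists>x<k. s i = shift (p y) d x"
  have "turning d = (\<lambda>(y, x). shift (p y) d x) ` (SIGMA y:{..<l}. ?K y)"
  proof (intro set_eqI iffI)
    fix q assume "q \<in> turning d"
    then show "q \<in> (\<lambda>(y, x). shift (p y) d x) ` (SIGMA y:{..<l}. ?K y)"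
      using cover[of q] unfolding turning_def crossing_def by force
  next
    fix q assume "q \<in> (\<lambda>(y, x). shift (p y) d x) ` (SIGMA y:{..<l}. ?K y)"
    then show "q \<in> turning d"
      using line_in_grid[OF lines] unfolding turning_def crossing_def by force
  qed
  moreover have "inj_on (\<lambda>(y, x). shift (p y) d x) (SIGMA y:{..<l}. ?K y)"
    using inj by (auto simp: inj_on_def)
  ultimately have "card (turning d) = (\<Sum>y<l. card (?K y))" by (simp add: card_image)
  moreover have "3 + of_bool (?P y) \<le> card (?K y)" if "y \<in> {..<l}" for y
    using line_crossings[OF lines] that by simp
  ultimately have "(\<Sum>y<l. 3 + of_bool (?P y)) \<le> card (turning d)" by (simp only: sum_mono)
  then show ?thesis by (simp add: sum.distrib sum_of_bool_eq)
qed

lemma card_int_image: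
  assumes "\<And>i. i < 3 \<Longrightarrow> 0 \<le> f i \<and> f i < int l" "\<And>y. P y \<longleftrightarrow> (\<exists>i<3. f i = int y)"
  shows "card (f ` {..<3 :: nat}) = card ({..<l} \<inter> {y. P y})"
proof -
  have "f ` {..<3} = int ` ({..<l} \<inter> {y. P y})"
  proof (intro set_eqI iffI)
    fix y assume "y \<in> f ` {..<3}"
    then obtain i where i: "i < 3" "y = f i" by auto
    then show "y \<in> int ` ({..<l} \<inter> {y. P y})"
      using assms(1)[OF i(1)] assms(2)[of "nat y"] by (intro image_eqI[of _ _ "nat y"]) auto
  qed (use assms(2) in force)
  then show ?thesis by (simp add: card_image)
qed

lemma card_turning_S: "3 * n + sink_cols 3 s \<le> card (turning S)"
proof -
  have at: "shift (0, int y) S x = (int x, int y)" for x y by (simp add: shift_def)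
  have ex: "\<exists>y<n. \<exists>x<m. q = (int x, int y)" if "in_grid m n q" for q
    using in_grid_nat[OF that] by metis
  have "sink_cols 3 s = card ({..<n} \<inter> {y. \<exists>i<3. \<exists>x<m. s i = shift (0, int y) S x})"
    unfolding sink_cols_def at
  proof (rule card_int_image)
    show "0 \<le> snd (s i) \<and> snd (s i) < int n" if "i < 3" for i using grid[OF that] by (simp add: in_grid_def)
    show "(\<exists>i<3. \<exists>x<m. s i = (int x, int y)) \<longleftrightarrow> (\<exists>i<3. snd (s i) = int y)" for y
      using ex[OF grid] by (metis of_nat_eq_iff snd_conv)
  qed
  then show ?thesis
    using card_turning[OF column_is_line[OF _ pos(1)], of n] ex unfolding at by simp
qed

lemma card_turning_E: "3 * m + sink_rows 3 s \<le> card (turning E)"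
proof -
  have at: "shift (int x, 0) E y = (int x, int y)" for x y by (simp add: shift_def)
  have ex: "\<exists>x<m. \<exists>y<n. q = (int x, int y)" if "in_grid m n q" for q
    using in_grid_nat[OF that] by metis
  have "sink_rows 3 s = card ({..<m} \<inter> {x. \<exists>i<3. \<exists>y<n. s i = shift (int x, 0) E y})"
    unfolding sink_rows_def at
  proof (rule card_int_image)
    show "0 \<le> fst (s i) \<and> fst (s i) < int m" if "i < 3" for i using grid[OF that] by (simp add: in_grid_def)
    show "(\<exists>i<3. \<exists>y<n. s i = (int x, int y)) \<longleftrightarrow> (\<exists>i<3. fst (s i) = int x)" for x
      using ex[OF grid] by (metis of_nat_eq_iff fst_conv)
  qed
  then show ?thesis
    using card_turning[OF row_is_line[OF _ pos(2)], of m] ex unfolding at by simp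
qed

lemma arrow_count: "3 * (m + n) + sink_rows 3 s + sink_cols 3 s + 3 \<le> m * n"
proof -
  let ?G = "{q. in_grid m n q}" and ?S = "s ` {..<3}"
  have G: "?G = (\<lambda>(x, y). (int x, int y)) ` ({..<m} \<times> {..<n})"
  proof (intro set_eqI iffI)
    fix q assume "q \<in> ?G"
    then obtain x y where "q = (int x, int y)" "x < m" "y < n" using in_grid_nat by blast
    then show "q \<in> (\<lambda>(x, y). (int x, int y)) ` ({..<m} \<times> {..<n})" by force
  qed (auto simp: in_grid_def)
  then have fin: "finite ?G" by simp
  have "card ?G = m * n" unfolding G by (subst card_image) (auto simp: inj_on_def)
  moreover have "card ?S = 3" using board unfolding is_board_def by (simp add: card_image)
  \<comment> \<open>No arrow is perpendicular to both families of lines, so none is counted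
    twice.\<close>
  moreover have "\<not> (perp S e \<and> perp E e)" for e by (cases e) (auto simp: perp_def)
  then have "turning S \<inter> turning E = {}" by (fastforce simp: turning_def)
  moreover have "(turning S \<union> turning E) \<inter> ?S = {}"
  proof -
    have "q \<notin> ?S" if "L q = Some a" for q a
      using that perfect unfolding perfect_layout_def is_layout_def blank_def is_sink_def by fastforce
    then show ?thesis unfolding turning_def by blast
  qed
  moreover have sub: "turning S \<union> turning E \<union> ?S \<subseteq> ?G" using grid by (auto simp: turning_def)
  moreover have "finite (turning S)" "finite (turning E)" using sub fin finite_subset by blast+
  ultimately have "card (turning S) + card (turning E) + 3 \<le> m * n"
    using card_mono[OF fin sub] by (simp add: card_Un_disjoint)
  then show ?thesis using card_turning_S card_turning_E unfolding distrib_left by simp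
qed

lemma size_bounds: "4 + sink_rows 3 s \<le> m" "4 + sink_cols 3 s \<le> n"
proof -
  have "(\<lambda>i. fst (s i)) ` {..<3} \<subseteq> {2..int m - 3}" "(\<lambda>i. snd (s i)) ` {..<3} \<subseteq> {2..int n - 3}"
    using sink_position by auto
  then have "sink_rows 3 s \<le> card {2..int m - 3}" "sink_cols 3 s \<le> card {2..int n - 3}"
    unfolding sink_rows_def sink_cols_def by (intro card_mono; simp)+
  moreover have "5 \<le> m" "5 \<le> n" using sink_position[of 0] by auto
  ultimately show "4 + sink_rows 3 s \<le> m" "4 + sink_cols 3 s \<le> n" by auto
qed

lemma cond3: "cond3 m n 3 s"
proof -
  define p q where "p = sink_rows 3 s" and "q = sink_cols 3 s"
  have c: "3 * (m + n) + p + q + 3 \<le> m * n" and b: "4 + p \<le> m" "4 + q \<le> n"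
    using arrow_count size_bounds by (simp_all add: p_def q_def)
  \<comment> \<open>The counting bound for short sides. With \<open>p + q = 4\<close> five rows need
    \<open>n \<ge> 11\<close>; six rows need \<open>n \<ge> 9\<close> for \<open>p + q\<close> equal
    to 4 or 5; and a board of size 7 by 7 allows at most \<open>p + q = 4\<close>.\<close>
  have m5: "m = 5 \<Longrightarrow> 22 + p + q \<le> 2 * n + 4" and m6: "m = 6 \<Longrightarrow> 21 + p + q \<le> 3 * n"
    and n5: "n = 5 \<Longrightarrow> 22 + p + q \<le> 2 * m + 4" and n6: "n = 6 \<Longrightarrow> 21 + p + q \<le> 3 * m"
    and mn7: "p + q \<le> 4 \<or> m < 7 \<or> n < 7 \<or> 7 < m \<or> 7 < n" using c by (auto simp: not_less)
  have small: "k = 5 \<or> k = 6 \<or> 7 \<le> k" if "5 \<le> k" for k :: nat using that by linarith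
  have "size_at_least m n 7 8" if "p = 3" "q = 3"
    using that b mn7 unfolding size_at_least_def by linarith
  moreover have "size_at_least m n 7 8 \<or> size_at_least m n 6 9" if "p = 2 \<and> q = 3 \<or> p = 3 \<and> q = 2"
    using that
  proof
    assume "p = 2 \<and> q = 3"
    then show ?thesis using b mn7 m6 small[of m] unfolding size_at_least_def by auto
  next
    assume "p = 3 \<and> q = 2"
    then show ?thesis using b mn7 n6 small[of n] unfolding size_at_least_def by auto
  qed
  moreover have "size_at_least m n 7 7 \<or> size_at_least m n 6 9" if "p = 2" "q = 2"
    using that b m6 n6 small[of m] small[of n] unfolding size_at_least_def by auto
  moreover have "size_at_least m n 7 7 \<or> size_at_least m n 6 9 \<or> size_at_least m n 5 11"
    if "p = 1 \<and> q = 3 \<or> p = 3 \<and> q = 1"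
    using that
  proof
    assume "p = 1 \<and> q = 3"
    then show ?thesis using b m5 m6 small[of m] unfolding size_at_least_def by auto
  next
    assume "p = 3 \<and> q = 1"
    then show ?thesis using b n5 n6 small[of n] unfolding size_at_least_def by auto
  qed
  ultimately show ?thesis
    unfolding cond3_def Let_def p_def[symmetric] q_def[symmetric] by (auto simp: doubleton_eq_iff)
qed

end

lemma has_perfect_layout_cong:
  assumes "has_perfect_layout m n c s" and eq: "\<And>i. i < c \<Longrightarrow> s i = t i"
  shows "has_perfect_layout m n c t"
  using assms(1) blank_cong[of c s t m n] eq
  unfolding has_perfect_layout_def perfect_layout_def is_layout_def succeeds_def by auto

section \<open>Boards described by gaps\<close>

text \<open>If the lines (rows or columns) that contain sinks are separated from each other and from the
  boundary by the numbers \<open>xs\<close> of other lines, then \<open>line xs k\<close> is the index of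
  the \<open>k\<close>-th of them and \<open>extent xs\<close> the number of all lines.\<close>

definition line :: "nat list \<Rightarrow> nat \<Rightarrow> nat" where
  "line xs k = sum_list (take (Suc k) xs) + k"

definition extent :: "nat list \<Rightarrow> nat" where
  "extent xs = sum_list xs + length xs - 1"

text \<open>The lists \<open>r\<close> and \<open>c\<close> are the pattern: sink \<open>i\<close>
  lies in the sink row with number \<open>r ! i\<close> and the sink column with number
  \<open>c ! i\<close>.\<close>

definition arrangement :: "nat list \<Rightarrow> nat list \<Rightarrow> nat list \<Rightarrow> nat list \<Rightarrow> nat \<Rightarrow> cell" where
  "arrangement r c xs ys i = (int (line xs (r ! i)), int (line ys (c ! i)))"

definition good :: "nat list \<Rightarrow> nat list \<Rightarrow> nat list \<Rightarrow> nat list \<Rightarrow> bool" where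
  "good r c xs ys \<longleftrightarrow> has_perfect_layout (extent xs) (extent ys) 3 (arrangement r c xs ys)"

definition ext :: "nat list \<Rightarrow> nat list \<Rightarrow> nat list \<Rightarrow> nat list \<Rightarrow> bool" where
  "ext r c xs ys \<longleftrightarrow> extensible (extent xs) (extent ys) 3 (arrangement r c xs ys)"

definition check_ext ::
  "nat list \<Rightarrow> nat list \<Rightarrow> nat list \<Rightarrow> nat list \<Rightarrow> tile list list \<Rightarrow> cut list \<Rightarrow> cut list \<Rightarrow> bool" where
  "check_ext r c u v B R C \<longleftrightarrow>
     check_board B (map (\<lambda>i. (line u (r ! i), line v (c ! i))) [0, 1, 2]) R C \<and>
     length B = extent u \<and> length (hd B) = extent v"

lemma ext_if_checks:
  assumes "list_all2 (\<lambda>(u, v) (rows, R, C). check_ext r c u v (board rows) R C) uvs boards"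
  shows "\<forall>(u, v) \<in> set uvs. ext r c u v"
proof safe
  fix u v assume "(u, v) \<in> set uvs"
  then obtain rows R C where
    "check_ext r c u v (board rows) R C"
    using assms by (fastforce simp: list_all2_conv_all_nth in_set_conv_nth)
  then have "extensible (extent u) (extent v) 3 (sinks (map (\<lambda>i. (line u (r ! i), line v (c ! i))) [0, 1, 2]))"
    using check_board_sound unfolding check_ext_def by metis
  then show "ext r c u v" unfolding ext_def
    by (rule extensible_cong) (auto simp: sinks_def arrangement_def less_3)
qed

lemma ext_if_product_checks:
  assumes "list_all2 (\<lambda>(u, v) (rows, R, C). check_ext r c u v (board rows) R C) (List.product us vs) boards"
  shows "\<forall>u \<in> set us. \<forall>v \<in> set vs. ext r c u v"
  using ext_if_checks[OF assms] by auto

text \<open>The block of entries between \<open>j\<close> and \<open>k\<close> has the larger sum in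
  \<open>ys\<close>; written additively to avoid truncated subtraction.\<close>

lemma sum_list_take_mono:
  assumes "list_all2 (\<le>) xs (ys :: nat list)" "j \<le> k"
  shows "sum_list (take j ys) + sum_list (take k xs) \<le> sum_list (take k ys) + sum_list (take j xs)"
  using assms
proof (induction arbitrary: j k rule: list_all2_induct)
  case (Cons x xs y ys)
  show ?case
  proof (cases k)
    case (Suc k')
    show ?thesis
    proof (cases j)
      case 0
      then show ?thesis using Cons.IH[of 0 k'] Cons.hyps Suc by simp
    next
      case j: (Suc j')
      then show ?thesis using Cons.IH[of j' k'] Cons.prems Cons.hyps Suc by simp
    qed
  qed (use Cons.prems in simp)
qed simp

lemma sum_list_take_le: "j \<le> k \<Longrightarrow> sum_list (take j xs) \<le> sum_list (take k (xs :: nat list))"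
  using sum_list_take_mono[of "replicate (length xs) 0" xs j k]
  by (simp add: list_all2_conv_all_nth sum_list_replicate)

lemma line_strict_mono: "j < k \<Longrightarrow> line xs j < line xs k"
  using sum_list_take_le[of "Suc j" "Suc k" xs] by (simp add: line_def)

text \<open>Larger gaps mean inserted lines: a sink line moves by the total increase of the gaps
  before it, which grows along the vector.\<close>

lemma displaced_lines:
  assumes le: "list_all2 (\<le>) xs ys" and r: "\<And>i. i < 3 \<Longrightarrow> Suc (r i) < length xs"
  shows "displaced 3 (extent ys - extent xs) (\<lambda>i. int (line xs (r i))) (\<lambda>i. int (line ys (r i)))"
  unfolding displaced_def
proof (intro conjI allI impI)
  fix i :: nat assume i: "i < 3"
  have "length xs = length ys" using le by (rule list_all2_lengthD)
  then have "line xs (r i) \<le> line ys (r i) \<and> line ys (r i) + extent xs \<le> line xs (r i) + extent ys"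
    using sum_list_take_mono[OF le, of 0 "Suc (r i)"] sum_list_take_mono[OF le, of "Suc (r i)" "length xs"] r[OF i]
    by (simp add: line_def extent_def)
  then show "int (line xs (r i)) \<le> int (line ys (r i))"
    "int (line ys (r i)) \<le> int (line xs (r i)) + int (extent ys - extent xs)" by linarith+
next
  fix i j :: nat assume "i < 3" "j < 3" "int (line xs (r i)) \<le> int (line xs (r j))"
  then have "r i \<le> r j" using line_strict_mono[of "r j" "r i" xs] by (meson not_le of_nat_less_iff)
  then have "line ys (r i) + line xs (r j) \<le> line ys (r j) + line xs (r i)"
    using sum_list_take_mono[OF le, of "Suc (r i)" "Suc (r j)"] by (simp add: line_def)
  then show "int (line ys (r i)) - int (line xs (r i)) \<le> int (line ys (r j)) - int (line xs (r j))" by linarith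
qed

lemma extent_mono: "list_all2 (\<le>) xs ys \<Longrightarrow> extent xs \<le> extent ys"
  using sum_list_take_mono[of xs ys 0 "length xs"] list_all2_lengthD[of "(\<le>)" xs ys] by (simp add: extent_def)

text \<open>The reason why minimal gap vectors suffice: extensibility for one pair of vectors gives
  perfect layouts for all pairs above it.\<close>

lemma good_if_ext:
  assumes "ext r c xs ys" "list_all2 (\<le>) xs xs'" "list_all2 (\<le>) ys ys'"
    and "3 \<le> extent xs" "3 \<le> extent ys"
    and "\<forall>i<3. Suc (r ! i) < length xs \<and> Suc (c ! i) < length ys"
  shows "good r c xs' ys'"
proof -
  have "has_perfect_layout (extent xs + (extent xs' - extent xs)) (extent ys + (extent ys' - extent ys)) 3
      (arrangement r c xs' ys')"
    by (rule perfect_if_displaced[OF assms(1)[unfolded ext_def] assms(4,5)];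
        unfold arrangement_def fst_conv snd_conv; rule displaced_lines)
      (use assms in auto)
  then show ?thesis using extent_mono[OF assms(2)] extent_mono[OF assms(3)] by (simp add: good_def)
qed

lemma line_less_extent: "Suc k < length xs \<Longrightarrow> line xs k < extent xs"
  using sum_list_take_le[of "Suc k" "length xs" xs] by (simp add: line_def extent_def)

text \<open>A flip reverses the gap vector. There are \<open>length xs - 1\<close> sink lines, so
  number \<open>k\<close> becomes number \<open>length xs - 2 - k\<close>.\<close>

lemma line_rev:
  assumes "Suc k < length xs"
  shows "line (rev xs) (length xs - 2 - k) = extent xs - 1 - line xs k"
proof -
  have "take (Suc (length xs - 2 - k)) (rev xs) = rev (drop (Suc k) xs)"
    using assms by (simp add: take_rev Suc_diff_Suc numeral_2_eq_2)
  moreover have "sum_list (take (Suc k) xs) + sum_list (drop (Suc k) xs) = sum_list xs"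
    by (metis append_take_drop_id sum_list_append)
  ultimately show ?thesis using assms by (simp add: line_def extent_def sum_list_rev)
qed

lemma good_transpose: "good c r ys xs \<Longrightarrow> good r c xs ys"
  unfolding good_def
  by (erule has_perfect_layout_cong[OF transposition.perfect_f]) (simp add: arrangement_def)

lemma good_flip_rows:
  assumes "good r' c (rev xs) ys" and r: "\<forall>i<3. Suc (r ! i) < length xs \<and> r' ! i = length xs - 2 - r ! i"
  shows "good r c xs ys"
proof -
  have "extent (rev xs) = extent xs" by (simp add: extent_def sum_list_rev)
  moreover have "int (extent xs) - 1 - int (line (rev xs) (r' ! i)) = int (line xs (r ! i))" if "i < 3" for i
    using line_rev[of "r ! i" xs] line_less_extent[of "r ! i" xs] r that by auto
  ultimately show ?thesis using assms(1) unfolding good_def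
    by (auto elim!: has_perfect_layout_cong[OF row_flip.perfect_f] simp: arrangement_def)
qed

lemma good_flip_cols:
  assumes "good r c' xs (rev ys)" and "\<forall>i<3. Suc (c ! i) < length ys \<and> c' ! i = length ys - 2 - c ! i"
  shows "good r c xs ys"
  by (rule good_transpose, rule good_flip_rows[OF _ assms(2)], rule good_transpose, rule assms(1))

lemma good_recolour:
  assumes "good r' c' xs ys" and p: "\<And>i. p (p i) = i" "\<And>i. i < 3 \<Longrightarrow> p i < (3::nat)"
    and "\<forall>i<3. r ! i = r' ! p i \<and> c ! i = c' ! p i"
  shows "good r c xs ys"
  using perfect_recolour[OF assms(1)[unfolded good_def] p] unfolding good_def
  by (rule has_perfect_layout_cong) (use assms(4) in \<open>simp_all add: arrangement_def\<close>)

lemma all_less_3: "(\<forall>i<3::nat. P i) \<longleftrightarrow> P 0 \<and> P 1 \<and> P 2"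
  by (auto simp: less_3)

lemma good_swap01: "good [r1, r0, r2] [c1, c0, c2] xs ys \<Longrightarrow> good [r0, r1, r2] [c0, c1, c2] xs ys"
  by (erule good_recolour[where p = "\<lambda>i. if i = 0 then 1 else if i = 1 then 0 else i"])
     (auto simp: all_less_3 split: if_splits)

lemma good_swap12: "good [r0, r2, r1] [c0, c2, c1] xs ys \<Longrightarrow> good [r0, r1, r2] [c0, c1, c2] xs ys"
  by (erule good_recolour[where p = "\<lambda>i. if i = 1 then 2 else if i = 2 then 1 else i"])
     (auto simp: all_less_3 split: if_splits)

lemma good_swap02: "good [r2, r1, r0] [c2, c1, c0] xs ys \<Longrightarrow> good [r0, r1, r2] [c0, c1, c2] xs ys"
  by (erule good_recolour[where p = "\<lambda>i. if i = 0 then 2 else if i = 2 then 0 else i"])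
     (auto simp: all_less_3 split: if_splits)

section \<open>Layouts of the minimal boards\<close>

text \<open>In the names, digits give the row pattern for column pattern \<open>[0, 1, 2]\<close>,
  and the numbers the size of the board. Every triple holds a picture, its row cuts and its column
  cuts, in the order of \<open>List.product\<close>. Listed are, up to reversal, the column gaps
  with sum 8 that avoid configurations (a), (c) and (d).\<close>

lemma ext_000_5_11:
  "\<forall>u \<in> set [[2,2]].
   \<forall>v \<in> set [[2,1,1,4], [2,1,2,3], [2,1,3,2], [2,2,0,4], [2,2,1,3], [2,2,2,2], [2,3,0,3], [3,0,1,4],
     [3,0,2,3], [3,1,0,4], [3,1,1,3]].
    ext [0, 0, 0] [0, 1, 2] u v"
  by (rule ext_if_product_checks[where boards = "[
    ([''erEErSersrd'',''rErswrEwdSw'',''Su0w1W2SWsl'',''SsWrrwwWwWu'',''EernwNWulwW''],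
      [], [(3,[(0,E),(1,E),(3,E)]),(5,[(0,E),(1,E),(3,E)])]),
    ([''eEErresEEdS'',''rdlswSwwwWW'',''Sd0w1WW2lsN'',''SerWrdlWnll'',''ErEnwrNwuww''],
      [], [(3,[(0,E),(1,E),(3,E)]),(5,[(0,E),(1,E),(3,E)])]),
    ([''eersrEdSWWw'',''ndEEwwElwNW'',''Sd0w1rrW2sN'',''EErnruwwwwN'',''rrEreuNnWll''],
      [], [(3,[(0,E),(1,E),(3,E)]),(5,[(0,W),(1,E),(3,E)])]),
    ([''dlESswwlwWw'',''rsrSdlWWllW'',''uS0Ew12enNl'',''EEEerrEnSwu'',''eerrEeenEuN''],
      [], [(3,[(0,E),(1,E),(3,E)]),(6,[(0,W),(1,W),(3,E)])]),
    ([''edlEEeSWWls'',''EEErrrSersd'',''Nd0ww1W2sSl'',''delNnwwwwwW'',''rrENullWnWw''],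
      [], [(3,[(0,E),(1,E),(3,W)]),(6,[(0,E),(1,E),(3,W)])]),
    ([''rEESdlleesw'',''ulllswSWWll'',''uN0ww1Wr2sS'',''eerEErsNWwu'',''ENWnrwwuwWW''],
      [], [(3,[(0,E),(1,E),(3,E)]),(6,[(0,E),(1,E),(3,E)])]),
    ([''EEEsrSrwwWd'',''reresSwWrdw'',''Nd0EwE12nlS'',''enrNWwwWuwl'',''NrWrnrrwWuW''],
      [], [(3,[(0,E),(1,E),(3,E)]),(7,[(0,W),(1,W),(3,E)])]),
    ([''srdEwSWlwWW'',''rsrrrwwwEdN'',''ueS01W2nNlw'',''EEeErrEunwN'',''euElenwElNl''],
      [], [(4,[(0,W),(1,E),(3,E)]),(5,[(0,W),(1,E),(3,E)])]),
    ([''srSWrdwwWlw'',''eSrresdWwwW'',''dSe01rW2nSl'',''renrrwrwNWu'',''EEEEeENWrnu''],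
      [], [(4,[(0,W),(1,W),(3,E)]),(5,[(0,W),(1,W),(3,E)])]),
    ([''EErEerEdSsl'',''dNsllwwWlww'',''Nde0E12lSWn'',''rrErnrwuwNW'',''eenENwWwWru''],
      [], [(4,[(0,E),(1,W),(3,E)]),(6,[(0,E),(1,W),(3,E)])]),
    ([''eEdlEleElsS'',''rdeEswlwSWw'',''uNl0w1W2Sln'',''ueElnwNwwwW'',''ErNWrrnWWul''],
      [], [(4,[(0,E),(1,E),(3,W)]),(6,[(0,E),(1,E),(3,W)])])]"]) code_simp

lemma ext_000_6_9:
  "\<forall>u \<in> set [[2,3]].
   \<forall>v \<in> set [[2,0,0,4], [2,0,1,3], [2,0,2,2], [2,1,0,3], [2,1,1,2], [3,0,0,3]].
    ext [0, 0, 0] [0, 1, 2] u v"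
  by (rule ext_if_product_checks[where boards = "[
    ([''EsrwwdESW'',''swErEwNdw'',''Nd012nlSl'',''rnErSWulN'',''eEnwwNwwu'',''ullNWlnWu''],
      [], [(3,[(0,W),(1,E),(3,E)]),(4,[(0,W),(1,E),(3,E)])]),
    ([''eereSWWsd'',''rrErswwSd'',''uS01W2Nes'',''eSnwru.lW'',''EEErNWnul'',''nNruwwlWw''],
      [], [(3,[(0,E),(1,E),(3,E)]),(4,[(0,E),(1,E),(3,E)])]),
    ([''sdEwElEES'',''sdrrNuwww'',''dS01rW2nS'',''eenwuNwlW'',''rrrnwruNl'',''EEErNeWun''],
      [], [(3,[(0,W),(1,E),(3,E)]),(4,[(0,W),(1,E),(3,E)])]),
    ([''dsESeWlsl'',''rrrdleeSs'',''Su0w12SsW'',''EulEeESls'',''sEErruwEN'',''eeunNwWww''],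
      [], [(3,[(1,E),(0,E),(3,W)]),(5,[(0,E),(1,E),(3,W)])]),
    ([''edlSlWWes'',''dSWswweWs'',''dS0E1r2nS'',''renwNuwlw'',''ErEreNunW'',''rErnrNWul''],
      [], [(3,[(0,E),(1,W),(3,E)]),(5,[(0,E),(1,W),(3,E)])]),
    ([''sSrrrWWdW'',''SreWeeswd'',''.uS012Nnl'',''renEwwNru'',''EuElrSrnu'',''eEunNWwWw''],
      [], [(4,[(0,W),(1,W),(3,E)]),(5,[(0,W),(1,W),(3,E)])])]"]) code_simp

lemma ext_000_7_7:
  "\<forall>u \<in> set [[2,4], [3,3]].
   \<forall>v \<in> set [[2,0,0,2]].
    ext [0, 0, 0] [0, 1, 2] u v"
  by (rule ext_if_product_checks[where boards = "[
    ([''SWWrWsd'',''dslwwlS'',''dN012sS'',''rsENuWw'',''eendSwW'',''ErnwENd'',''unllwNl''],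
      [], [(3,[(0,E),(1,E),(3,E)]),(4,[(0,E),(1,E),(3,E)])]),
    ([''reSrdls'',''SnruWWW'',''uEEeeNs'',''uN012sN'',''sNrrwuw'',''erEeusN'',''EunNWwl''],
      [], [(3,[(0,E),(1,W),(2,W)]),(4,[(0,E),(1,W),(2,W)])])]"]) code_simp

text \<open>No flip preserves this pattern, even after recolouring, so all vectors with one surplus
  line on each side are listed.\<close>

lemma ext_001_7_8:
  "\<forall>u \<in> set [[2,0,3], [2,1,2], [3,0,2]].
   \<forall>v \<in> set [[2,0,0,3], [2,0,1,2], [2,1,0,2], [3,0,0,2]].
    ext [0, 0, 1] [0, 1, 2] u v"
  by (rule ext_if_product_checks[where boards = "[
    ([''dSWlsrdW'',''ESreesdl'',''Nd01WWsu'',''Nenw2NWs'',''rSrnWuww'',''eEnNwwdu'',''nrErullN''],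
      [(3,[(0,S),(1,S),(4,S)])], [(3,[(0,E),(1,W),(3,E)]),(4,[(0,E),(1,W),(3,E)])]),
    ([''srEwSWdS'',''sulllwES'',''Su01Wdls'',''EenwN2sS'',''dElnwSww'',''ednrNwuW'',''rrEuNWnl''],
      [(3,[(0,S),(1,S),(4,N)])], [(3,[(0,W),(1,E),(3,E)]),(4,[(0,W),(1,E),(3,E)])]),
    ([''sdEElwlS'',''dslNwWdd'',''dS0w1dsw'',''rrSnw2sS'',''swEdNwlW'',''eulNnWWl'',''EENrrnwu''],
      [(3,[(0,S),(1,S),(3,S)])], [(3,[(0,W),(1,E),(3,E)]),(5,[(0,W),(1,W),(3,E)])]),
    ([''rdSllWss'',''uslEwwwS'',''ueS01dnW'',''ereSs2Ss'',''uswSlWlw'',''EESWeend'',''nwErNuWl''],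
      [(3,[(0,S),(1,S),(2,N)])], [(4,[(0,E),(1,E),(3,E)]),(5,[(0,E),(1,E),(3,E)])]),
    ([''SdWeWees'',''SWrrdlls'',''dN01suSw'',''ernNwuWW'',''EsEN2EnN'',''errreNun'',''reNeWnul''],
      [(3,[(0,S),(1,N),(4,S)])], [(3,[(0,E),(1,W),(3,E)]),(4,[(0,E),(1,W),(3,E)])]),
    ([''dSllllsd'',''dEEesESl'',''dN01WsWu'',''eendNwww'',''rnrwN2Nn'',''ulenNwlW'',''ENWreWun''],
      [(3,[(0,S),(1,N),(4,N)])], [(3,[(0,E),(1,E),(3,E)]),(4,[(0,E),(1,E),(3,W)])]),
    ([''rdlslSlW'',''uEEswESl'',''uN0E1sWu'',''ueENswww'',''erNes2nN'',''EunlwENu'',''Nnrrrwru''],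
      [(3,[(0,S),(1,N),(3,S)])], [(3,[(0,E),(1,E),(3,W)]),(5,[(0,W),(1,E),(3,W)])]),
    ([''dslElSsw'',''sdSlwesl'',''dSe01nru'',''rEnEdESW'',''ErnNw2sN'',''eeEnNWWu'',''Nnulrwwu''],
      [(3,[(0,S),(1,S),(2,N)])], [(4,[(1,W),(0,E),(3,E)]),(5,[(3,W),(0,E),(1,W)])]),
    ([''rrswwESd'',''EeErdsSl'',''eErSdsWw'',''uN01Wesu'',''sSWw2nNW'',''eEnNw.wu'',''nNrrWrru''],
      [(4,[(1,N),(0,N),(4,S)])], [(3,[(0,W),(1,E),(2,E)]),(4,[(0,W),(1,E),(2,E)])]),
    ([''swdlSwww'',''dlEeEnES'',''ESrnrWdW'',''dS01sdll'',''rEnNw2nN'',''NnrrueWn'',''eNWenENu''],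
      [(4,[(0,S),(1,S),(4,N)])], [(3,[(0,W),(1,E),(2,E)]),(4,[(0,W),(1,E),(2,E)])]),
    ([''sdlSwWWl'',''EdElSels'',''rEuSl.sw'',''uN0w1nuW'',''NrnWw2Nn'',''eNWunwwl'',''uelNlWNn''],
      [(4,[(0,S),(1,N),(3,N)])], [(3,[(0,W),(1,E),(2,W)]),(5,[(0,W),(1,W),(2,W)])]),
    ([''ErsrrSdw'',''rEEsSWwd'',''sdNWwwWW'',''uNe01dnl'',''Nernw2sN'',''erNWnwwu'',''EnNrrWru''],
      [(4,[(0,S),(1,N),(2,S)])], [(4,[(0,W),(1,E),(2,W)]),(5,[(0,W),(1,W),(2,W)])])]"]) code_simp

lemma ext_001_6_9:
  "\<forall>u \<in> set [[2,0,2]].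
   \<forall>v \<in> set [[2,0,0,4], [2,0,1,3], [2,0,2,2], [2,1,0,3], [2,1,1,2], [2,2,0,2], [3,0,0,3], [3,0,1,2],
     [3,1,0,2], [4,0,0,2]].
    ext [0, 0, 1] [0, 1, 2] u v"
  by (rule ext_if_product_checks[where boards = "[
    ([''ErErdSsll'',''eEreEdESs'',''Nu01esdWw'',''rsEN2ENsW'',''uslwellsN'',''NenrWwwwu''],
      [(3,[(0,N),(1,N),(4,S)])], [(3,[(0,E),(1,E),(3,E)]),(4,[(0,E),(1,E),(3,E)])]),
    ([''EsEwEdlwS'',''dsllNWWWl'',''Nd01eesdW'',''rersN2sNw'',''NWnrrEwdN'',''erEenwulN''],
      [(3,[(0,S),(1,S),(4,S)])], [(3,[(0,W),(1,E),(3,E)]),(4,[(0,W),(1,E),(3,E)])]),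
    ([''EsrwSdWwl'',''eeErESsWu'',''Nd01dswlW'',''rrrNsr2Ns'',''nEEwrEwdN'',''NunlwwWlw''],
      [(3,[(0,N),(1,S),(4,S)])], [(3,[(0,W),(1,E),(3,E)]),(4,[(0,W),(1,E),(3,E)])]),
    ([''ErE.edESs'',''rErrrEsSd'',''uN0w1esrd'',''Nernw2NsW'',''eNunlWwwl'',''nuEENwlWw''],
      [(3,[(0,S),(1,N),(3,N)])], [(3,[(0,E),(1,E),(3,E)]),(5,[(0,E),(1,E),(3,E)])]),
    ([''esESrrdlw'',''ErrdeeesS'',''Nu0w1nWuW'',''reenwS2sN'',''nEErNWwWd'',''unlElNWwl''],
      [(3,[(0,N),(1,S),(3,S)])], [(3,[(0,W),(1,E),(3,E)]),(5,[(0,W),(1,E),(3,E)])]),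
    ([''esESdwWes'',''rErdslwSW'',''uN0Ew1nrd'',''Serrnw2Ss'',''ENWeWnwuw'',''ulnNllWWl''],
      [(3,[(0,N),(1,N),(3,S)])], [(3,[(0,W),(1,E),(3,E)]),(6,[(1,W),(0,W),(3,E)])]),
    ([''dllEesllS'',''SeulrWusw'',''euS01eWsd'',''rnSrw2NWn'',''EEeENWusl'',''NuWnlwwwW''],
      [(3,[(0,N),(1,S),(2,N)])], [(4,[(0,E),(1,W),(3,E)]),(5,[(0,E),(1,W),(3,E)])]),
    ([''esSrwrdWw'',''nSrWruWNW'',''Seu01Wedn'',''rrenrN2sN'',''SWnWwwwrd'',''EuElnNWwl''],
      [(3,[(0,N),(1,S),(2,N)])], [(4,[(0,W),(1,W),(3,E)]),(5,[(0,W),(1,W),(3,E)])]),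
    ([''desEEwSWW'',''enSrdlWlw'',''dSe0w1eun'',''nESrrr2Nn'',''rrrEnNwul'',''EuENnwWwu''],
      [(3,[(0,N),(1,S),(2,S)])], [(4,[(0,W),(1,W),(3,E)]),(6,[(0,W),(1,W),(3,E)])]),
    ([''ESWsrwWrd'',''swNdWlwwW'',''rSde01dnw'',''sSrrrw2Sn'',''uleEENeln'',''eEuNnlWWl''],
      [(3,[(0,S),(1,S),(2,S)])], [(5,[(0,W),(1,W),(3,E)]),(6,[(0,W),(1,W),(3,E)])])]"]) code_simp

lemma ext_001_8_7:
  "\<forall>u \<in> set [[2,0,4], [2,1,3], [2,2,2], [3,0,3], [3,1,2], [4,0,2]].
   \<forall>v \<in> set [[2,0,0,2]].
    ext [0, 0, 1] [0, 1, 2] u v"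
  by (rule ext_if_product_checks[where boards = "[
    ([''SsWrdwl'',''dslwenS'',''dS01Wnu'',''renN2nS'',''edsNwlW'',''unwwEEN'',''ErErNnu'',
      ''NWrunWw''],
      [(3,[(0,S),(1,S),(4,S)])], [(3,[(0,W),(1,E),(3,E)]),(4,[(0,W),(1,E),(3,E)])]),
    ([''dsEwesS'',''dSllWsW'',''dS01dWs'',''EenNdww'',''Nrrs2sS'',''rnENWrd'',''eSnruwl'',
      ''NWueenW''],
      [(3,[(0,S),(1,S),(4,S)])], [(3,[(0,W),(1,W),(3,E)]),(4,[(1,E),(0,E),(3,E)])]),
    ([''dsllwES'',''dSEeSls'',''Sd01dsl'',''EsENdww'',''erSeWun'',''nEEN2nS'',''renNWdW'',
      ''Nnrrwru''],
      [(3,[(0,S),(1,S),(4,S)])], [(3,[(0,W),(1,E),(3,E)]),(4,[(0,W),(1,E),(3,E)])]),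
    ([''Ssrrwwd'',''dlEsSlw'',''dSswWWl'',''dS01dWn'',''rSrs2nS'',''eenNuwW'',''EEnwENu'',
      ''ulEleNn''],
      [(4,[(0,S),(1,S),(4,S)])], [(3,[(0,W),(1,E),(2,W)]),(4,[(0,W),(1,E),(2,W)])]),
    ([''SrWrsrd'',''dslwESl'',''EEsSdWW'',''Nu01esu'',''NenrWwu'',''rNnW2nN'',''eulNenu'',
      ''nuEwENw''],
      [(4,[(0,S),(1,N),(4,S)])], [(3,[(0,E),(1,E),(2,E)]),(4,[(0,E),(1,E),(2,E)])]),
    ([''rrrrSds'',''uSswdwl'',''EEu.Snw'',''esESwru'',''dN01Wnu'',''nNWw2nS'',''rNrnwWu'',
      ''NeulWnW''],
      [(5,[(0,N),(1,N),(4,S)])], [(3,[(0,E),(1,W),(2,W)]),(4,[(0,E),(1,W),(2,W)])])]"]) code_simp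

text \<open>Reversing the columns preserves this pattern up to recolouring, so two of the four
  column vectors represent all.\<close>

lemma ext_010_7_8:
  "\<forall>u \<in> set [[2,0,3], [2,1,2], [3,0,2]].
   \<forall>v \<in> set [[2,0,0,3], [2,0,1,2]].
    ext [0, 1, 0] [0, 1, 2] u v"
  by (rule ext_if_product_checks[where boards = "[
    ([''SdWleles'',''dSrsWwdW'',''dS0w2Snl'',''dsE1WnWu'',''rrrreSnu'',''eEnwNWdw'',''EeNnulru''],
      [(3,[(0,S),(1,S),(4,N)])], [(3,[(0,E),(1,W),(4,E)]),(4,[(0,E),(1,W),(4,E)])]),
    ([''SersdWww'',''SnWrWwdW'',''Sd0ww2nN'',''dln1nWWd'',''eedelslN'',''EullnwNd'',''rEEnNull''],
      [(3,[(0,S),(1,S),(4,S)])], [(3,[(0,E),(1,W),(4,W)]),(4,[(0,W),(1,W),(4,W)])]),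
    ([''SdlleWWs'',''deESWsNd'',''dS0w2Nsw'',''rEEnuwNl'',''unl1Wnwu'',''ErswNrru'',''enwrwuNW''],
      [(3,[(0,S),(1,S),(4,N)])], [(3,[(0,E),(1,E),(3,E)]),(4,[(0,E),(1,W),(3,E)])]),
    ([''SsrrdwWl'',''rsEwdENW'',''Sd0rw2sN'',''ESWulesw'',''ues1nWwu'',''uEeeENnu'',''errrunlN''],
      [(3,[(0,S),(1,S),(3,N)])], [(3,[(0,W),(1,E),(3,E)]),(4,[(0,W),(1,E),(2,E)])]),
    ([''SWrsdWww'',''.NEredSn'',''ErNuWenW'',''dN0w2lSn'',''run1enWd'',''eNWrWnrd'',''ueleuNnl''],
      [(4,[(0,S),(1,N),(4,N)])], [(3,[(0,E),(1,E),(2,E)]),(4,[(0,W),(1,E),(2,W)])]),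
    ([''eErrEdSs'',''reEusESw'',''ErsSwwrd'',''uN0wr2sS'',''nul1nwud'',''u.ElnSWl'',''NunwlWwW''],
      [(4,[(0,N),(1,N),(5,N)])], [(3,[(0,E),(1,E),(2,E)]),(4,[(0,E),(1,E),(2,E)])])]"]) code_simp

lemma ext_010_6_9:
  "\<forall>u \<in> set [[2,0,2]].
   \<forall>v \<in> set [[2,0,0,4], [2,0,1,3], [2,0,2,2], [2,1,0,3], [2,1,1,2], [3,0,0,3]].
    ext [0, 1, 0] [0, 1, 2] u v"
  by (rule ext_if_product_checks[where boards = "[
    ([''ErrrEdsSl'',''rEEswwSwu'',''uN0w2ESls'',''usE1Wreus'',''ueNlenWWw'',''enrwuNllW''],
      [(3,[(0,S),(1,N),(4,N)])], [(3,[(0,E),(1,E),(4,W)]),(4,[(0,E),(1,E),(4,W)])]),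
    ([''SWrswwrrd'',''rrEeSWues'',''uN0rr2SnW'',''usE1uWenl'',''EenruNWWw'',''euleEeuNn''],
      [(3,[(0,S),(1,N),(4,N)])], [(3,[(0,E),(1,E),(4,E)]),(4,[(0,W),(1,E),(2,E)])]),
    ([''rdleSlWsw'',''EEESsuwwW'',''Nd0rrw2Sn'',''sdE1WWend'',''NedeenWWl'',''errrrNuln''],
      [(3,[(0,S),(1,N),(5,N)])], [(3,[(0,E),(1,E),(4,W)]),(4,[(0,E),(1,W),(2,E)])]),
    ([''SWWdeWesW'',''dllsSwlww'',''Su0rr2nlN'',''Eunw1Wend'',''rNruesWWl'',''eeEEreuNn''],
      [(3,[(0,S),(1,N),(3,N)])], [(3,[(0,E),(1,E),(4,E)]),(5,[(0,E),(1,W),(2,E)])]),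
    ([''rrEdlEEsS'',''EErsSdwlw'',''Nu0rwr2Sn'',''eenu1eWsd'',''nNWWruwwl'',''NnrwenuWW''],
      [(3,[(0,S),(1,N),(3,N)])], [(3,[(0,E),(1,E),(3,E)]),(5,[(0,E),(1,W),(2,E)])]),
    ([''swrrSwWdw'',''dnSWwWwWl'',''edS0r2Nen'',''nEwd1enru'',''EdEEeElnS'',''rrnrruN.W''],
      [(3,[(0,N),(1,S),(2,N)])], [(4,[(0,W),(1,W),(4,W)]),(5,[(0,W),(1,W),(2,E)])])]"]) code_simp

lemma ext_010_8_7:
  "\<forall>u \<in> set [[2,0,4], [2,1,3], [2,2,2], [3,0,3], [3,1,2], [4,0,2]].
   \<forall>v \<in> set [[2,0,0,2]].
    ext [0, 1, 0] [0, 1, 2] u v"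
  by (rule ext_if_product_checks[where boards = "[
    ([''dsElEES'',''rdlSesw'',''dS0w2sS'',''rdn1Wsd'',''uEnwNlW'',''errNusw'',''ueEnwNl'',
      ''ENulnwu''],
      [(3,[(0,S),(1,S),(4,N)])], [(3,[(0,W),(1,E),(4,W)]),(4,[(0,W),(1,W),(4,W)])]),
    ([''eErSWsd'',''SsWdww.'',''dN0r2nS'',''rrSeunw'',''uen1dnW'',''uSnlwll'',''nEENrWu'',
      ''ENreWnu''],
      [(3,[(0,N),(3,S),(1,S)])], [(3,[(0,E),(1,W),(3,E)]),(4,[(0,E),(1,W),(2,E)])]),
    ([''sdESWES'',''rsrSwrd'',''Sd0r2Ns'',''SWnwwwd'',''swESu.W'',''unl1und'',''ErNrunl'',
      ''eNnwWuw''],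
      [(3,[(0,S),(1,S),(4,N)])], [(3,[(0,W),(1,E),(3,E)]),(4,[(0,W),(1,W),(2,E)])]),
    ([''SsWrWWd'',''swrwdSl'',''EruSees'',''Nu0w2Ss'',''rnd1Wnu'',''ulEeNnW'',''eEnNwWu'',
      ''Nnrrulw''],
      [(4,[(0,S),(1,S),(4,N)])], [(3,[(0,W),(1,E),(2,W)]),(4,[(0,W),(1,E),(2,W)])]),
    ([''esrrdSl'',''dEESesu'',''reusESw'',''uN0w2sS'',''ENdnwwS'',''uNn1nWu'',''uNWeWnW'',
      ''Nrrrnru''],
      [(4,[(0,N),(1,N),(4,N)])], [(3,[(0,W),(1,E),(2,W)]),(4,[(0,W),(1,W),(2,W)])]),
    ([''rSsrdWw'',''sEESWdl'',''ulsSwlW'',''EersNNu'',''uN0w2sN'',''unE1swu'',''Nuleeen'',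
      ''eNulWln''],
      [(5,[(0,S),(1,N),(4,N)])], [(3,[(0,W),(1,E),(2,W)]),(4,[(0,W),(1,W),(2,W)])])]"]) code_simp

text \<open>The diagonal is preserved by transposition and by the half turn; the surplus line may
  therefore be a column in the first half.\<close>

lemma ext_012_7_8:
  "\<forall>u \<in> set [[2,0,0,2]].
   \<forall>v \<in> set [[2,0,0,3], [2,0,1,2]].
    ext [0, 1, 2] [0, 1, 2] u v"
  by (rule ext_if_product_checks[where boards = "[
    ([''rErrdESs'',''s.EwENdw'',''Sd0uwwwS'',''esd1ndWW'',''Senr2Nnl'',''uNleWlnu'',''ErEnwNru''],
      [(3,[(0,S),(1,N),(4,S)]),(4,[(0,N),(1,N),(2,S)])], [(3,[(0,E),(1,E),(4,E)]),(4,[(0,E),(1,E),(2,W)])]),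
    ([''rsESWdwl'',''SdleNeWs'',''Sd0rdSlw'',''sEd1rWsu'',''EenwN2Nn'',''errnNwwu'',''nNWrwWuW''],
      [(3,[(0,S),(1,S),(4,S)]),(4,[(0,S),(1,N),(2,S)])], [(3,[(0,W),(3,E),(1,W)]),(4,[(0,W),(3,W),(1,W)])])]"]) code_simp

text \<open>This permutation is its own inverse, so transposition preserves the pattern and the
  surplus line may be taken to be a column.\<close>

lemma ext_021_7_8:
  "\<forall>u \<in> set [[2,0,0,2]].
   \<forall>v \<in> set [[2,0,0,3], [2,0,1,2], [2,1,0,2], [3,0,0,2]].
    ext [0, 2, 1] [0, 1, 2] u v"
  by (rule ext_if_product_checks[where boards = "[
    ([''SWrrWesd'',''sdESslww'',''Sd0wwESd'',''EenS2Snl'',''rdn1WunW'',''srEwNWru'',''eullenEN''],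
      [(3,[(0,S),(1,N),(4,S)]),(4,[(0,S),(1,N),(4,N)])], [(3,[(0,E),(1,E),(3,E)]),(4,[(0,E),(1,W),(3,E)])]),
    ([''rsrdESld'',''srEwrEuS'',''uS0dNwww'',''uEnrN2Sn'',''usl1sWuW'',''eeueeenN'',''EnEruNWl''],
      [(3,[(0,S),(1,S),(3,S)]),(4,[(0,S),(1,N),(4,N)])], [(3,[(0,W),(1,E),(5,W)]),(4,[(0,W),(1,E),(2,W)])]),
    ([''eEErrdSs'',''nwruwESl'',''Sd0ESwdw'',''rdlNn2sS'',''srEu1uen'',''EunwlEES'',''eunNwwlW''],
      [(3,[(1,N),(0,S),(3,N)]),(4,[(1,N),(0,S),(2,N)])], [(3,[(0,E),(1,E),(4,E)]),(5,[(0,E),(1,E),(5,W)])]),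
    ([''rsSrdWWW'',''SedWswlw'',''uES0rdN.'',''eNenw2sN'',''unEE1eun'',''ulllenwN'',''EnNulWWl''],
      [(3,[(0,S),(1,N),(2,S)]),(4,[(0,N),(1,N),(2,S)])], [(4,[(0,W),(1,W),(3,E)]),(5,[(0,W),(1,W),(2,E)])])]"]) code_simp

text \<open>Three corners of a rectangle, with the bend at sink 0. Of the column vectors with sum 7
  only \<open>[2, 0, 5]\<close> is missing; with rows \<open>[2, 0, 2]\<close> it would give
  configuration (b).\<close>

lemma ext_L_6_9:
  "\<forall>u \<in> set [[2,0,2]].
   \<forall>v \<in> set [[2,1,4], [2,2,3], [2,3,2], [3,0,4], [3,1,3], [3,2,2], [4,0,3], [4,1,2],
     [5,0,2]].
    ext [0, 0, 1] [0, 1, 0] u v"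
  by (rule ext_if_product_checks[where boards = "[
    ([''esrdllllS'',''rEEswSeus'',''Sd0w1uWsw'',''nN2nwwNWl'',''SeernENwu'',''ErEErnuNW''],
      [(3,[(0,N),(1,N),(3,S)])], [(3,[(0,W),(1,E),(3,W)])]),
    ([''rEESdeswW'',''eerEdlsSl'',''uN0ww1dsw'',''Sn2llNlWn'',''ulEnEwwwN'',''EueNelWln''],
      [(3,[(0,N),(1,N),(3,S)])], [(3,[(0,E),(1,E),(3,W)])]),
    ([''eSWrrsrrd'',''reruESesW'',''uS0wwE1sd'',''Sn2nNwwWl'',''ulErNrnwu'',''EEeEnNruw''],
      [(3,[(0,N),(1,S),(4,N)])], [(3,[(0,E),(1,E),(3,W)])]),
    ([''rsrErdlES'',''eEsrwdeNs'',''Sde01rWds'',''Sen2NenlW'',''EdSernuwl'',''nrEEwENuw''],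
      [(3,[(0,N),(1,N),(2,N)])], [(4,[(0,W),(1,E),(3,W)])]),
    ([''SsrrdlWlW'',''reEEswNul'',''Sru0w1dsw'',''SWs2leswN'',''enuEENwWu'',''EeeeNrrun''],
      [(3,[(0,S),(1,S),(2,N)])], [(4,[(0,W),(1,E),(3,W)])]),
    ([''e.dESWees'',''rSersrrWd'',''uES0ww1nd'',''Srn2lNenl'',''uelEEnNlw'',''EnEeNnruW''],
      [(3,[(0,N),(1,N),(2,S)])], [(4,[(0,E),(1,W),(3,W)])]),
    ([''Se.eWrrds'',''rEsErwwdS'',''Srde01uWs'',''eNrn2sSww'',''EnErEruNW'',''nuwNwwWll''],
      [(3,[(0,S),(1,N),(2,S)])], [(5,[(0,E),(1,E),(3,W)])]),
    ([''swEEESeds'',''dENelllWs'',''dl.N0w1sd'',''rNrn2nwNw'',''eNedWnlwW'',''EnulwENll''],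
      [(3,[(0,S),(1,N),(2,S)])], [(5,[(1,E),(0,E),(3,W)])]),
    ([''EESdsWwwl'',''NdeWsllWw'',''eeSed01dn'',''rnSrW2enS'',''unEulErdS'',''ullnwwNlW''],
      [(3,[(0,N),(1,N),(2,S)])], [(6,[(0,W),(1,W),(3,W)])])]"]) code_simp

text \<open>Of the nine pairs with one surplus line on each side, \<open>[2, 0, 3]\<close> with
  itself is configuration (b); transposition identifies the other eight to these five. Pairs are
  listed because this is not a product.\<close>

lemma ext_L_7_7:
  "\<forall>(u, v) \<in> set [([2, 0, 3], [2, 1, 2]), ([2, 0, 3], [3, 0, 2]), ([2, 1, 2], [2, 1, 2]), ([2, 1, 2], [3, 0, 2]), ([3, 0, 2], [3, 0, 2])].
    ext [0, 0, 1] [0, 1, 0] u v"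
  by (rule ext_if_checks[where boards = "[
    ([''esrdwlS'',''SWWsrul'',''Sd0w1su'',''Ss2lsSw'',''rsSulWW'',''EeEENun'',''Nrenwwu''],
      [(3,[(0,N),(1,N),(3,S)])], [(3,[(0,W),(1,W),(3,W)])]),
    ([''SsdWwlW'',''esSrruw'',''Sed01un'',''ESs2lSn'',''NnrWwwd'',''rEeeNun'',''nrENuWl''],
      [(3,[(0,N),(1,S),(2,S)])], [(4,[(0,W),(1,W),(3,W)])]),
    ([''EsrSrrd'',''rrEswuS'',''Nu0w1us'',''eEdEsSl'',''nN2nwSW'',''nNWdlww'',''nwwrNWu''],
      [(3,[(0,S),(1,S),(3,S)])], [(3,[(0,W),(1,E),(3,W)])]),
    ([''SsdWwwl'',''deEllSs'',''dSl01nu'',''SdenlWW'',''rnN2slN'',''eENeenu'',''ErnENuw''],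
      [(3,[(0,S),(1,S),(2,N)])], [(4,[(0,W),(1,E),(3,W)])]),
    ([''swwrSWd'',''rrdElNs'',''EEEswNd'',''eNd01sd'',''Nnr2sNw'',''unNwllW'',''NunWwwl''],
      [(4,[(0,N),(1,N),(2,S)])], [(4,[(0,W),(1,E),(2,E)])])]"]) code_simp

section \<open>Every admissible gap vector dominates a minimal one\<close>

abbreviation dominates :: "nat list \<Rightarrow> nat list list \<Rightarrow> bool" where
  "dominates xs vs \<equiv> \<exists>v \<in> set vs. list_all2 (\<le>) v xs"

lemma good_if_ext_some:
  assumes ext: "\<forall>u \<in> set us. \<forall>v \<in> set vs. ext r c u v"
    and "dominates xs us" "dominates ys vs"
    and "\<forall>u \<in> set us. 3 \<le> extent u \<and> (\<forall>i<3. Suc (r ! i) < length u)"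
    and "\<forall>v \<in> set vs. 3 \<le> extent v \<and> (\<forall>i<3. Suc (c ! i) < length v)"
  shows "good r c xs ys"
proof -
  obtain u v where u: "u \<in> set us" "list_all2 (\<le>) u xs" and v: "v \<in> set vs" "list_all2 (\<le>) v ys"
    using assms(2,3) by blast
  show ?thesis
    by (rule good_if_ext[OF _ u(2) v(2)]) (use assms(1,4,5) u(1) v(1) in simp_all)
qed

text \<open>Here and in the next three lemmas the vector lies above \<open>[2, 0, 2]\<close> or
  \<open>[2, 0, 0, 2]\<close>, and the list contains all ways to distribute the required one or two
  surplus lines.\<close>

lemma gaps3_5:
  "2 \<le> a \<Longrightarrow> 2 \<le> b \<Longrightarrow> 5 \<le> a + g + b \<Longrightarrow>
   dominates [a, g, b] [[2, 0, 3], [2, 1, 2], [3, 0, 2]]"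
  by simp arith

lemma gaps3_6:
  "2 \<le> a \<Longrightarrow> 2 \<le> b \<Longrightarrow> 6 \<le> a + g + b \<Longrightarrow>
   dominates [a, g, b] [[2, 0, 4], [2, 1, 3], [2, 2, 2], [3, 0, 3], [3, 1, 2], [4, 0, 2]]"
  by simp arith

lemma gaps4_5:
  "2 \<le> c \<Longrightarrow> 2 \<le> d \<Longrightarrow> 5 \<le> c + g + h + d \<Longrightarrow>
   dominates [c, g, h, d] [[2, 0, 0, 3], [2, 0, 1, 2], [2, 1, 0, 2], [3, 0, 0, 2]]"
  by simp arith

lemma gaps4_6:
  "2 \<le> c \<Longrightarrow> 2 \<le> d \<Longrightarrow> 6 \<le> c + g + h + d \<Longrightarrow>
   dominates [c, g, h, d] [[2, 0, 0, 4], [2, 0, 1, 3], [2, 0, 2, 2], [2, 1, 0, 3], [2, 1, 1, 2], [2, 2, 0, 2],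
     [3, 0, 0, 3], [3, 0, 1, 2], [3, 1, 0, 2], [4, 0, 0, 2]]"
  by simp arith

lemma good_000_rev: "good [0, 0, 0] [0, 1, 2] xs [d, h, g, c] \<Longrightarrow> good [0, 0, 0] [0, 1, 2] xs [c, g, h, d]"
  by (rule good_swap02, rule good_flip_cols[where c' = "[0, 1, 2]"]) (simp_all add: all_less_3)

lemma good_010_rev: "good [0, 1, 0] [0, 1, 2] xs [d, h, g, c] \<Longrightarrow> good [0, 1, 0] [0, 1, 2] xs [c, g, h, d]"
  by (rule good_swap02, rule good_flip_cols[where c' = "[0, 1, 2]"]) (simp_all add: all_less_3)

text \<open>Reversing only the columns would turn the diagonal into the other one; the half turn
  preserves it, so both vectors are reversed together.\<close>

lemma good_012_rev:
  "good [0, 1, 2] [0, 1, 2] [a', h', g', a] [d, h, g, c] \<Longrightarrow> good [0, 1, 2] [0, 1, 2] [a, g', h', a'] [c, g, h, d]"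
  by (rule good_swap02, rule good_flip_cols[where c' = "[0, 1, 2]"], rule good_flip_rows[where r' = "[0, 1, 2]"])
    (simp_all add: all_less_3)

abbreviation "vs_5_11 \<equiv> [[2,1,1,4], [2,1,2,3], [2,1,3,2], [2,2,0,4], [2,2,1,3], [2,2,2,2], [2,3,0,3],
  [3,0,1,4], [3,0,2,3], [3,1,0,4], [3,1,1,3]]"

abbreviation "vs_6_9 \<equiv> [[2,0,0,4], [2,0,1,3], [2,0,2,2], [2,1,0,3], [2,1,1,2], [3,0,0,3]]"

text \<open>The excluded cases are, in order, configuration (c), then (a) at either end, then (d) at
  either end.\<close>

lemma gaps_5_11:
  assumes "2 \<le> c" "2 \<le> d" "8 \<le> c + g + h + d"
    and "\<not> (g = 0 \<and> h = 0)" "\<not> (c = 2 \<and> g = 0)" "\<not> (d = 2 \<and> h = 0)"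
    and "\<not> (c = 2 \<and> g = 1 \<and> h = 0)" "\<not> (d = 2 \<and> h = 1 \<and> g = 0)"
  shows "dominates [c, g, h, d] vs_5_11 \<or> dominates [d, h, g, c] vs_5_11"
proof -
  \<comment> \<open>The thresholds 4 and 3 are the largest outer and inner entries of the list;
    larger gaps need not be distinguished.\<close>
  have "c = 2 \<or> c = 3 \<or> 4 \<le> c" "d = 2 \<or> d = 3 \<or> 4 \<le> d"
    "g = 0 \<or> g = 1 \<or> g = 2 \<or> 3 \<le> g" "h = 0 \<or> h = 1 \<or> h = 2 \<or> 3 \<le> h" using assms(1,2) by auto
  then show ?thesis by (elim disjE; insert assms; simp)
qed

lemma good_row_5:
  assumes "2 \<le> a" "2 \<le> b" "dominates [c, g, h, d] vs_5_11 \<or> dominates [d, h, g, c] vs_5_11"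
  shows "good [0, 0, 0] [0, 1, 2] [a, b] [c, g, h, d]"
proof -
  have *: "good [0, 0, 0] [0, 1, 2] [a, b] ys" if "dominates ys vs_5_11" for ys
    by (rule good_if_ext_some[OF ext_000_5_11 _ that]) (use assms in \<open>simp_all add: extent_def all_less_3\<close>)
  show ?thesis using assms(3) *[of "[c, g, h, d]"] good_000_rev[OF *[of "[d, h, g, c]"]] by blast
qed

lemma good_row_6:
  assumes "2 \<le> a" "3 \<le> b" "2 \<le> c" "2 \<le> d" "6 \<le> c + g + h + d"
  shows "good [0, 0, 0] [0, 1, 2] [a, b] [c, g, h, d]"
proof -
  have *: "good [0, 0, 0] [0, 1, 2] [a, b] ys" if "dominates ys vs_6_9" for ys
    by (rule good_if_ext_some[OF ext_000_6_9 _ that]) (use assms in \<open>simp_all add: extent_def all_less_3\<close>)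
  have "dominates [c, g, h, d] vs_6_9 \<or>
      dominates [d, h, g, c] vs_6_9"
    using gaps4_6[OF assms(3,4,5)] by simp argo
  then show ?thesis using *[of "[c, g, h, d]"] good_000_rev[OF *[of "[d, h, g, c]"]] by blast
qed

lemma good_row_7:
  assumes "2 \<le> a" "6 \<le> a + b" "a \<le> b" "2 \<le> c" "2 \<le> d"
  shows "good [0, 0, 0] [0, 1, 2] [a, b] [c, g, h, d]"
  by (rule good_if_ext_some[OF ext_000_7_7]) (use assms in \<open>auto simp: extent_def all_less_3\<close>)

text \<open>There are \<open>a + b + 1\<close> rows and \<open>c + g + h + d + 3\<close> columns, so
  the size alternatives read: 7 rows, or 6 rows and 9 columns, or 11 columns. The last hypothesis
  concerns exactly the boards with five rows.\<close>

lemma good_row: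
  assumes "2 \<le> a" "2 \<le> b" "2 \<le> c" "2 \<le> d"
    and "6 \<le> a + b \<or> 5 \<le> a + b \<and> 6 \<le> c + g + h + d \<or> 8 \<le> c + g + h + d"
    and "a = 2 \<Longrightarrow> b = 2 \<Longrightarrow> \<not> (g = 0 \<and> h = 0) \<and> \<not> (c = 2 \<and> g = 0) \<and> \<not> (d = 2 \<and> h = 0) \<and>
      \<not> (c = 2 \<and> g = 1 \<and> h = 0) \<and> \<not> (d = 2 \<and> h = 1 \<and> g = 0)"
  shows "good [0, 0, 0] [0, 1, 2] [a, b] [c, g, h, d]"
proof -
  have flip: "good [0, 0, 0] [0, 1, 2] [a, b] [c, g, h, d]" if "good [0, 0, 0] [0, 1, 2] [b, a] [c, g, h, d]"
    by (rule good_flip_rows[where r' = "[0, 0, 0]"]) (use that in \<open>simp_all add: all_less_3\<close>)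
  consider "a = 2" "b = 2" | "a + b = 5" | "6 \<le> a + b" using assms(1,2) by linarith
  then show ?thesis
  proof cases
    case 1
    then show ?thesis using assms by (intro good_row_5 gaps_5_11) auto
  next
    case 2
    then have "6 \<le> c + g + h + d" "a = 2 \<and> 3 \<le> b \<or> b = 2 \<and> 3 \<le> a" using assms by auto
    then show ?thesis using good_row_6[of a b c d g h] good_row_6[of b a c d g h] flip assms by auto
  next
    case 3
    show ?thesis
    proof (cases "a \<le> b")
      case True
      then show ?thesis using 3 assms by (intro good_row_7) auto
    next
      case False
      then show ?thesis using 3 assms by (intro flip good_row_7) auto
    qed
  qed
qed

text \<open>There are \<open>a + g + b + 2\<close> rows and \<open>c + h + i + d + 3\<close>
  columns: the three cases are 7 rows with 8 columns, 9 columns, and 8 rows.\<close>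

lemma good_001:
  assumes "2 \<le> a" "2 \<le> b" "2 \<le> c" "2 \<le> d"
    and "5 \<le> a + g + b \<and> 5 \<le> c + h + i + d \<or> 6 \<le> c + h + i + d \<or> 6 \<le> a + g + b"
  shows "good [0, 0, 1] [0, 1, 2] [a, g, b] [c, h, i, d]"
proof -
  consider "5 \<le> a + g + b" "5 \<le> c + h + i + d" | "6 \<le> c + h + i + d" | "6 \<le> a + g + b" using assms by blast
  then show ?thesis
  proof cases
    case 1
    show ?thesis
      by (rule good_if_ext_some[OF ext_001_7_8 gaps3_5[OF assms(1,2) 1(1)] gaps4_5[OF assms(3,4) 1(2)]])
        (simp_all add: extent_def all_less_3)
  next
    case 2
    show ?thesis
      by (rule good_if_ext_some[OF ext_001_6_9 _ gaps4_6[OF assms(3,4) 2]])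
        (use assms in \<open>simp_all add: extent_def all_less_3\<close>)
  next
    case 3
    show ?thesis
      by (rule good_if_ext_some[OF ext_001_8_7 gaps3_6[OF assms(1,2) 3]])
        (use assms in \<open>simp_all add: extent_def all_less_3\<close>)
  qed
qed

lemma good_010:
  assumes "2 \<le> a" "2 \<le> b" "2 \<le> c" "2 \<le> d"
    and "5 \<le> a + g + b \<and> 5 \<le> c + h + i + d \<or> 6 \<le> c + h + i + d \<or> 6 \<le> a + g + b"
  shows "good [0, 1, 0] [0, 1, 2] [a, g, b] [c, h, i, d]"
proof -
  consider "5 \<le> a + g + b" "5 \<le> c + h + i + d" | "6 \<le> c + h + i + d" | "6 \<le> a + g + b" using assms by blast
  then show ?thesis
  proof cases
    case 1
    let ?vs = "[[2, 0, 0, 3], [2, 0, 1, 2]]"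
    have *: "good [0, 1, 0] [0, 1, 2] [a, g, b] ys" if "dominates ys ?vs" for ys
      by (rule good_if_ext_some[OF ext_010_7_8 gaps3_5[OF assms(1,2) 1(1)] that])
        (simp_all add: extent_def all_less_3)
    have "dominates [c, h, i, d] ?vs \<or> dominates [d, i, h, c] ?vs"
      using gaps4_5[OF assms(3,4) 1(2)] by simp argo
    then show ?thesis using *[of "[c, h, i, d]"] good_010_rev[OF *[of "[d, i, h, c]"]] by blast
  next
    case 2
    let ?vs = vs_6_9
    have *: "good [0, 1, 0] [0, 1, 2] [a, g, b] ys" if "dominates ys ?vs" for ys
      by (rule good_if_ext_some[OF ext_010_6_9 _ that])
        (use assms in \<open>simp_all add: extent_def all_less_3\<close>)
    have "dominates [c, h, i, d] ?vs \<or> dominates [d, i, h, c] ?vs"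
      using gaps4_6[OF assms(3,4) 2] by simp argo
    then show ?thesis using *[of "[c, h, i, d]"] good_010_rev[OF *[of "[d, i, h, c]"]] by blast
  next
    case 3
    show ?thesis
      by (rule good_if_ext_some[OF ext_010_8_7 gaps3_6[OF assms(1,2) 3]])
        (use assms in \<open>simp_all add: extent_def all_less_3\<close>)
  qed
qed

lemma good_012:
  assumes "2 \<le> a" "2 \<le> b" "2 \<le> c" "2 \<le> d" "5 \<le> a + g + g' + b \<or> 5 \<le> c + h + i + d"
  shows "good [0, 1, 2] [0, 1, 2] [a, g, g', b] [c, h, i, d]"
proof -
  let ?vs = "[[2, 0, 0, 3], [2, 0, 1, 2]]"
  have *: "good [0, 1, 2] [0, 1, 2] [a, g, g', b] [c, h, i, d]"
    if "2 \<le> a" "2 \<le> b" "dominates [c, h, i, d] ?vs" for a g g' b c h i d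
    by (rule good_if_ext_some[OF ext_012_7_8 _ that(3)]) (use that in \<open>simp_all add: extent_def all_less_3\<close>)
  have **: "good [0, 1, 2] [0, 1, 2] [a, g, g', b] [c, h, i, d]"
    if "2 \<le> a" "2 \<le> b" "2 \<le> c" "2 \<le> d" "5 \<le> c + h + i + d" for a g g' b c h i d
  proof -
    have "dominates [c, h, i, d] ?vs \<or> dominates [d, i, h, c] ?vs"
      using gaps4_5[OF that(3-5)] by simp argo
    then show ?thesis using *[of a b c h i d] good_012_rev[OF *[of b a d i h c]] that by blast
  qed
  show ?thesis using assms(5) **[OF assms(1-4)] good_transpose[OF **[OF assms(3,4,1,2)]] by blast
qed

text \<open>A surplus column is covered directly. A surplus row is treated by transposing, which
  after exchanging sinks 1 and 2 gives the same pattern.\<close>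

lemma good_021:
  assumes "2 \<le> a" "2 \<le> b" "2 \<le> c" "2 \<le> d" "5 \<le> a + g + g' + b \<or> 5 \<le> c + h + i + d"
  shows "good [0, 2, 1] [0, 1, 2] [a, g, g', b] [c, h, i, d]"
proof -
  have *: "good [0, 2, 1] [0, 1, 2] [a, g, g', b] [c, h, i, d]"
    if "2 \<le> a" "2 \<le> b" "2 \<le> c" "2 \<le> d" "5 \<le> c + h + i + d" for a g g' b c h i d
    by (rule good_if_ext_some[OF ext_021_7_8 _ gaps4_5[OF that(3-5)]])
      (use that in \<open>simp_all add: extent_def all_less_3\<close>)
  show ?thesis
    using assms(5) *[OF assms(1-4)] good_transpose[OF good_swap12[OF *[OF assms(3,4,1,2)]]] by blast
qed

lemma good_L_transpose: "good [0, 0, 1] [0, 1, 0] ys xs \<Longrightarrow> good [0, 0, 1] [0, 1, 0] xs ys"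
  by (rule good_transpose, rule good_swap12)

text \<open>On each side the surplus line lies before, between or after the two sink lines. If it is
  only after them on both sides, the bend is in the excluded corner.\<close>

lemma good_L_7:
  assumes "2 \<le> a" "2 \<le> b" "2 \<le> c" "2 \<le> d" "5 \<le> a + g + b" "5 \<le> c + h + d"
    and "\<not> (a = 2 \<and> g = 0 \<and> c = 2 \<and> h = 0)"
  shows "good [0, 0, 1] [0, 1, 0] [a, g, b] [c, h, d]"
proof -
  have ext: "ext [0, 0, 1] [0, 1, 0] [2, 0, 3] [2, 1, 2]" "ext [0, 0, 1] [0, 1, 0] [2, 0, 3] [3, 0, 2]"
    "ext [0, 0, 1] [0, 1, 0] [2, 1, 2] [2, 1, 2]" "ext [0, 0, 1] [0, 1, 0] [2, 1, 2] [3, 0, 2]"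
    "ext [0, 0, 1] [0, 1, 0] [3, 0, 2] [3, 0, 2]"
    using ext_L_7_7 by simp_all
  have *: "good [0, 0, 1] [0, 1, 0] [a, g, b] [c, h, d]"
    if "2 \<le> a" "2 \<le> b" "2 \<le> c" "2 \<le> d"
      and "3 \<le> b \<and> 1 \<le> h \<or> 3 \<le> b \<and> 3 \<le> c \<or> 1 \<le> g \<and> 1 \<le> h \<or> 1 \<le> g \<and> 3 \<le> c \<or> 3 \<le> a \<and> 3 \<le> c"
    for a g b c h d
    using that(5)
  proof (elim disjE conjE)
    assume "3 \<le> b" "1 \<le> h"
    then show ?thesis
      by (intro good_if_ext[OF ext(1)]) (use that in \<open>simp_all add: extent_def all_less_3\<close>)
  next
    assume "3 \<le> b" "3 \<le> c"
    then show ?thesis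
      by (intro good_if_ext[OF ext(2)]) (use that in \<open>simp_all add: extent_def all_less_3\<close>)
  next
    assume "1 \<le> g" "1 \<le> h"
    then show ?thesis
      by (intro good_if_ext[OF ext(3)]) (use that in \<open>simp_all add: extent_def all_less_3\<close>)
  next
    assume "1 \<le> g" "3 \<le> c"
    then show ?thesis
      by (intro good_if_ext[OF ext(4)]) (use that in \<open>simp_all add: extent_def all_less_3\<close>)
  next
    assume "3 \<le> a" "3 \<le> c"
    then show ?thesis
      by (intro good_if_ext[OF ext(5)]) (use that in \<open>simp_all add: extent_def all_less_3\<close>)
  qed
  have "3 \<le> a \<or> 1 \<le> g \<or> 3 \<le> b" "3 \<le> c \<or> 1 \<le> h \<or> 3 \<le> d" using assms by auto
  \<comment> \<open>The five certified combinations together with their transposes exhaust the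
    remaining places of the surplus lines.\<close>
  then have "(3 \<le> b \<and> 1 \<le> h \<or> 3 \<le> b \<and> 3 \<le> c \<or> 1 \<le> g \<and> 1 \<le> h \<or> 1 \<le> g \<and> 3 \<le> c \<or> 3 \<le> a \<and> 3 \<le> c) \<or>
      (3 \<le> d \<and> 1 \<le> g \<or> 3 \<le> d \<and> 3 \<le> a \<or> 1 \<le> h \<and> 1 \<le> g \<or> 1 \<le> h \<and> 3 \<le> a \<or> 3 \<le> c \<and> 3 \<le> a)"
    using assms by auto
  then show ?thesis
    using *[OF assms(1-4)] good_L_transpose[OF *[OF assms(3,4,1,2)]] by blast
qed

lemma good_L:
  assumes "2 \<le> a" "2 \<le> b" "2 \<le> c" "2 \<le> d"
    and "5 \<le> a + g + b \<and> 5 \<le> c + h + d \<or> 7 \<le> c + h + d \<or> 7 \<le> a + g + b"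
    and "\<not> (a = 2 \<and> g = 0 \<and> c = 2 \<and> h = 0)"
  shows "good [0, 0, 1] [0, 1, 0] [a, g, b] [c, h, d]"
proof -
  have *: "good [0, 0, 1] [0, 1, 0] [a, g, b] [c, h, d]"
    if "a = 2" "g = 0" "b = 2" "2 \<le> c" "2 \<le> d" "7 \<le> c + h + d" "\<not> (c = 2 \<and> h = 0)" for a g b c h d
  proof (rule good_if_ext_some[OF ext_L_6_9])
    show "dominates [c, h, d] [[2, 1, 4], [2, 2, 3], [2, 3, 2], [3, 0, 4], [3, 1, 3], [3, 2, 2], [4, 0, 3], [4, 1, 2], [5, 0, 2]]"
      using that by simp arith
  qed (use that in \<open>simp_all add: extent_def all_less_3\<close>)
  consider "5 \<le> a + g + b" "5 \<le> c + h + d" | "a = 2" "g = 0" "b = 2" "7 \<le> c + h + d"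
    | "c = 2" "h = 0" "d = 2" "7 \<le> a + g + b" using assms by linarith
  then show ?thesis
  proof cases
    case 1
    then show ?thesis using assms by (intro good_L_7) auto
  next
    case 2
    then show ?thesis using assms by (intro *) auto
  next
    case 3
    then show ?thesis using assms by (intro good_L_transpose[OF *]) auto
  qed
qed

section \<open>Reduction to sorted patterns\<close>

lemma three_values:
  assumes "{x, y, z} = {0, 1, 2 :: nat}"
  shows "x = 0 \<and> y = 1 \<and> z = 2 \<or> x = 0 \<and> y = 2 \<and> z = 1 \<or> x = 1 \<and> y = 0 \<and> z = 2 \<or>
    x = 1 \<and> y = 2 \<and> z = 0 \<or> x = 2 \<and> y = 0 \<and> z = 1 \<or> x = 2 \<and> y = 1 \<and> z = 0"
proof -
  have "0 \<in> {x, y, z}" "1 \<in> {x, y, z}" "2 \<in> {x, y, z}" unfolding assms by simp_all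
  then show ?thesis by (elim insertE emptyE) simp_all
qed

lemma two_values:
  assumes "{x, y, z} = {0, 1 :: nat}"
  shows "x = 0 \<and> y = 0 \<and> z = 1 \<or> x = 0 \<and> y = 1 \<and> z = 0 \<or> x = 1 \<and> y = 0 \<and> z = 0 \<or>
    x = 1 \<and> y = 1 \<and> z = 0 \<or> x = 1 \<and> y = 0 \<and> z = 1 \<or> x = 0 \<and> y = 1 \<and> z = 1"
proof -
  have "x \<in> {0, 1}" "y \<in> {0, 1}" "z \<in> {0, 1}" unfolding assms[symmetric] by simp_all
  moreover have "0 \<in> {x, y, z}" "1 \<in> {x, y, z}" unfolding assms by simp_all
  ultimately show ?thesis by (elim insertE emptyE) simp_all
qed

text \<open>Recolouring numbers the sinks from left to right. It permutes the row pattern, of which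
  the hypothesis remembers only the set of values.\<close>

lemma good_sort:
  assumes c: "{c0, c1, c2} = {0, 1, 2 :: nat}"
    and good: "\<And>p0 p1 p2. {p0, p1, p2} = {r0, r1, r2} \<Longrightarrow> good [p0, p1, p2] [0, 1, 2] xs ys"
  shows "good [r0, r1, r2] [c0, c1, c2] xs ys"
proof -
  consider "c0 = 0" "c1 = 1" "c2 = 2" | "c0 = 0" "c1 = 2" "c2 = 1" | "c0 = 1" "c1 = 0" "c2 = 2"
    | "c0 = 1" "c1 = 2" "c2 = 0" | "c0 = 2" "c1 = 0" "c2 = 1" | "c0 = 2" "c1 = 1" "c2 = 0"
    using three_values[OF c] by blast
  then show ?thesis
  proof cases
    case 1
    show ?thesis unfolding 1 by (rule good) blast
  next
    case 2
    show ?thesis unfolding 2 by (rule good_swap12, rule good) blast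
  next
    case 3
    show ?thesis unfolding 3 by (rule good_swap01, rule good) blast
  next
    case 4
    show ?thesis unfolding 4 by (rule good_swap01, rule good_swap02, rule good) blast
  next
    case 5
    show ?thesis unfolding 5 by (rule good_swap01, rule good_swap12, rule good) blast
  next
    case 6
    show ?thesis unfolding 6 by (rule good_swap02, rule good) blast
  qed
qed

text \<open>If the odd sink is in the middle column, a row flip leads to \<open>[0, 1, 0]\<close>;
  otherwise flips of rows and columns lead to \<open>[0, 0, 1]\<close>.\<close>

lemma good_two_rows:
  assumes bounds: "2 \<le> a" "2 \<le> b" "2 \<le> c" "2 \<le> d"
    and size: "5 \<le> a + g + b \<and> 5 \<le> c + h + i + d \<or> 6 \<le> c + h + i + d \<or> 6 \<le> a + g + b"
    and p: "{p0, p1, p2} = {0, 1 :: nat}"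
  shows "good [p0, p1, p2] [0, 1, 2] [a, g, b] [c, h, i, d]"
proof -
  have b: "5 \<le> b + g + a \<and> 5 \<le> c + h + i + d \<or> 6 \<le> c + h + i + d \<or> 6 \<le> b + g + a"
    and d: "5 \<le> a + g + b \<and> 5 \<le> d + i + h + c \<or> 6 \<le> d + i + h + c \<or> 6 \<le> a + g + b"
    and bd: "5 \<le> b + g + a \<and> 5 \<le> d + i + h + c \<or> 6 \<le> d + i + h + c \<or> 6 \<le> b + g + a"
    using size by linarith+
  consider "p0 = 0" "p1 = 0" "p2 = 1" | "p0 = 0" "p1 = 1" "p2 = 0" | "p0 = 1" "p1 = 0" "p2 = 0"
    | "p0 = 1" "p1 = 1" "p2 = 0" | "p0 = 1" "p1 = 0" "p2 = 1" | "p0 = 0" "p1 = 1" "p2 = 1"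
    using two_values[OF p] by blast
  then show ?thesis
  proof cases
    case 1
    show ?thesis unfolding 1 by (rule good_001[OF bounds size])
  next
    case 2
    show ?thesis unfolding 2 by (rule good_010[OF bounds size])
  next
    case 3
    show ?thesis unfolding 3
      by (rule good_swap02, rule good_flip_cols[where c' = "[0, 1, 2]"])
        (use good_001[OF bounds(1,2,4,3) d] in \<open>simp_all add: all_less_3\<close>)
  next
    case 4
    show ?thesis unfolding 4
      by (rule good_flip_rows[where r' = "[0, 0, 1]"])
        (use good_001[OF bounds(2,1,3,4) b] in \<open>simp_all add: all_less_3\<close>)
  next
    case 5
    show ?thesis unfolding 5
      by (rule good_flip_rows[where r' = "[0, 1, 0]"])
        (use good_010[OF bounds(2,1,3,4) b] in \<open>simp_all add: all_less_3\<close>)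
  next
    case 6
    show ?thesis unfolding 6
      by (rule good_swap02, rule good_flip_cols[where c' = "[0, 1, 2]"],
          rule good_flip_rows[where r' = "[0, 0, 1]"])
        (use good_001[OF bounds(2,1,4,3) bd] in \<open>simp_all add: all_less_3\<close>)
  qed
qed

text \<open>Under flips the six permutations fall into two classes, the two diagonals and the other
  four, represented by \<open>[0, 1, 2]\<close> and \<open>[0, 2, 1]\<close>.\<close>

lemma good_three_rows:
  assumes bounds: "2 \<le> a" "2 \<le> b" "2 \<le> c" "2 \<le> d"
    and size: "5 \<le> a + g + g' + b \<or> 5 \<le> c + h + i + d"
    and p: "{p0, p1, p2} = {0, 1, 2 :: nat}"
  shows "good [p0, p1, p2] [0, 1, 2] [a, g, g', b] [c, h, i, d]"
proof -
  have b: "5 \<le> b + g' + g + a \<or> 5 \<le> c + h + i + d"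
    and d: "5 \<le> a + g + g' + b \<or> 5 \<le> d + i + h + c"
    and bd: "5 \<le> b + g' + g + a \<or> 5 \<le> d + i + h + c"
    using size by linarith+
  consider "p0 = 0" "p1 = 1" "p2 = 2" | "p0 = 0" "p1 = 2" "p2 = 1" | "p0 = 1" "p1 = 0" "p2 = 2"
    | "p0 = 1" "p1 = 2" "p2 = 0" | "p0 = 2" "p1 = 0" "p2 = 1" | "p0 = 2" "p1 = 1" "p2 = 0"
    using three_values[OF p] by blast
  then show ?thesis
  proof cases
    case 1
    show ?thesis unfolding 1 by (rule good_012[OF bounds size])
  next
    case 2
    show ?thesis unfolding 2 by (rule good_021[OF bounds size])
  next
    case 3
    show ?thesis unfolding 3
      by (rule good_swap02, rule good_flip_cols[where c' = "[0, 1, 2]"],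
          rule good_flip_rows[where r' = "[0, 2, 1]"])
        (use good_021[OF bounds(2,1,4,3) bd] in \<open>simp_all add: all_less_3\<close>)
  next
    case 4
    show ?thesis unfolding 4
      by (rule good_swap02, rule good_flip_cols[where c' = "[0, 1, 2]"])
        (use good_021[OF bounds(1,2,4,3) d] in \<open>simp_all add: all_less_3\<close>)
  next
    case 5
    show ?thesis unfolding 5
      by (rule good_flip_rows[where r' = "[0, 2, 1]"])
        (use good_021[OF bounds(2,1,3,4) b] in \<open>simp_all add: all_less_3\<close>)
  next
    case 6
    show ?thesis unfolding 6
      by (rule good_flip_rows[where r' = "[0, 1, 2]"])
        (use good_012[OF bounds(2,1,3,4) b] in \<open>simp_all add: all_less_3\<close>)
  qed
qed

text \<open>Three sinks occupy three of four crossings, and the free one determines the pattern up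
  to recolouring; it is the index in \<open>L11\<close>, \<open>L10\<close>, \<open>L01\<close>,
  \<open>L00\<close>. Flips move the bend, which is opposite to it, into the first row and column.
  The \<open>corner\<close> hypotheses exclude configuration (b).\<close>

lemma good_two_rows_two_cols:
  assumes bounds: "2 \<le> a" "2 \<le> b" "2 \<le> c" "2 \<le> d"
    and size: "5 \<le> a + g + b \<and> 5 \<le> c + h + d \<or> 7 \<le> c + h + d \<or> 7 \<le> a + g + b"
    and r: "r0 \<in> {0, 1}" "r1 \<in> {0, 1}" "r2 \<in> {0, 1 :: nat}"
    and c: "c0 \<in> {0, 1}" "c1 \<in> {0, 1}" "c2 \<in> {0, 1 :: nat}"
    and distinct: "distinct [(r0, c0), (r1, c1), (r2, c2)]"
    and corner: "(1, 1) \<notin> {(r0, c0), (r1, c1), (r2, c2)} \<Longrightarrow> \<not> (a = 2 \<and> g = 0 \<and> c = 2 \<and> h = 0)"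
      "(1, 0) \<notin> {(r0, c0), (r1, c1), (r2, c2)} \<Longrightarrow> \<not> (a = 2 \<and> g = 0 \<and> d = 2 \<and> h = 0)"
      "(0, 1) \<notin> {(r0, c0), (r1, c1), (r2, c2)} \<Longrightarrow> \<not> (b = 2 \<and> g = 0 \<and> c = 2 \<and> h = 0)"
      "(0, 0) \<notin> {(r0, c0), (r1, c1), (r2, c2)} \<Longrightarrow> \<not> (b = 2 \<and> g = 0 \<and> d = 2 \<and> h = 0)"
  shows "good [r0, r1, r2] [c0, c1, c2] [a, g, b] [c, h, d]"
proof -
  have L11: "good [0, 0, 1] [0, 1, 0] [a, g, b] [c, h, d]" if "\<not> (a = 2 \<and> g = 0 \<and> c = 2 \<and> h = 0)"
    by (rule good_L) (use that bounds size in linarith)+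
  have L10: "good [0, 0, 1] [1, 0, 1] [a, g, b] [c, h, d]" if "\<not> (a = 2 \<and> g = 0 \<and> d = 2 \<and> h = 0)"
  proof (rule good_flip_cols[where c' = "[0, 1, 0]"])
    show "good [0, 0, 1] [0, 1, 0] [a, g, b] (rev [c, h, d])"
      unfolding rev.simps append.simps by (rule good_L) (use that bounds size in linarith)+
  qed (simp add: all_less_3)
  have L01: "good [1, 1, 0] [0, 1, 0] [a, g, b] [c, h, d]" if "\<not> (b = 2 \<and> g = 0 \<and> c = 2 \<and> h = 0)"
  proof (rule good_flip_rows[where r' = "[0, 0, 1]"])
    show "good [0, 0, 1] [0, 1, 0] (rev [a, g, b]) [c, h, d]"
      unfolding rev.simps append.simps by (rule good_L) (use that bounds size in linarith)+
  qed (simp add: all_less_3)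
  have L00: "good [1, 1, 0] [1, 0, 1] [a, g, b] [c, h, d]" if "\<not> (b = 2 \<and> g = 0 \<and> d = 2 \<and> h = 0)"
  proof (rule good_flip_rows[where r' = "[0, 0, 1]"], rule good_flip_cols[where c' = "[0, 1, 0]"])
    show "good [0, 0, 1] [0, 1, 0] (rev [a, g, b]) (rev [c, h, d])"
      unfolding rev.simps append.simps by (rule good_L) (use that bounds size in linarith)+
  qed (simp_all add: all_less_3)
  have perms: "good [r0, r1, r2] [c0, c1, c2] xs ys"
    if g: "good [q0, q1, q2] [e0, e1, e2] xs ys" and "distinct [(r0, c0), (r1, c1), (r2, c2)]"
      "(r0, c0) \<in> {(q0, e0), (q1, e1), (q2, e2)}" "(r1, c1) \<in> {(q0, e0), (q1, e1), (q2, e2)}"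
      "(r2, c2) \<in> {(q0, e0), (q1, e1), (q2, e2)}" for q0 q1 q2 e0 e1 e2 xs ys
  proof -
    note * = g good_swap01[OF g] good_swap12[OF g] good_swap02[OF g]
      good_swap01[OF good_swap12[OF g]] good_swap12[OF good_swap01[OF g]]
    show ?thesis using that(2-5) * by auto
  qed
  let ?Z = "{(r0, c0), (r1, c1), (r2, c2)}" and ?U = "{(0, 0), (0, 1), (1, 0), (1, 1)} :: (nat \<times> nat) set"
  have "card ?Z = 3" using distinct by simp
  moreover have "card ?U = 4" by simp
  ultimately have "?Z \<noteq> ?U" by force
  moreover have "?Z \<subseteq> ?U" using r c by auto
  ultimately consider "(1, 1) \<notin> ?Z" | "(1, 0) \<notin> ?Z" | "(0, 1) \<notin> ?Z" | "(0, 0) \<notin> ?Z" by blast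
  then show ?thesis
  proof cases
    case 1
    show ?thesis by (rule perms[OF L11[OF corner(1)[OF 1]] distinct]) (use r c 1 in auto)
  next
    case 2
    show ?thesis by (rule perms[OF L10[OF corner(2)[OF 2]] distinct]) (use r c 2 in auto)
  next
    case 3
    show ?thesis by (rule perms[OF L01[OF corner(3)[OF 3]] distinct]) (use r c 3 in auto)
  next
    case 4
    show ?thesis by (rule perms[OF L00[OF corner(4)[OF 4]] distinct]) (use r c 4 in auto)
  qed
qed

section \<open>Gap vectors of a board\<close>

lemma line_simps [simp]:
  "line (x # xs) 0 = x" "line (x # xs) (Suc k) = x + Suc (line xs k)"
  by (simp_all add: line_def)

lemma extent_simps [simp]: "extent [x] = x" "extent (x # y # xs) = x + Suc (extent (y # xs))"
  by (simp_all add: extent_def)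

lemma gaps_1:
  assumes bounds: "\<And>i. i < 3 \<Longrightarrow> f i \<in> {2..int m - 3}" and card: "card (f ` {..<3 :: nat}) = 1"
  obtains a b where "2 \<le> a" "2 \<le> b" "extent [a, b] = m" "\<And>i. i < 3 \<Longrightarrow> f i = int (line [a, b] 0)"
proof -
  obtain x where x: "f ` {..<3} = {x}" using card by (auto simp: card_1_singleton_iff)
  then have eq: "f i = x" if "i < 3" for i using that by blast
  show thesis
    by (rule that[of "nat x" "nat (int m - 1 - x)"]) (use bounds[of 0] eq[of 0] eq in auto)
qed

lemma gaps_2:
  assumes bounds: "\<And>i. i < 3 \<Longrightarrow> f i \<in> {2..int m - 3}" and card: "card (f ` {..<3 :: nat}) = 2"
  obtains a g b r where "2 \<le> a" "2 \<le> b" "extent [a, g, b] = m" "{r 0, r 1, r 2} = {0, 1 :: nat}"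
    "\<And>i. i < 3 \<Longrightarrow> f i = int (line [a, g, b] (r i))"
proof -
  obtain x y where xy: "f ` {..<3} = {x, y}" "x < y"
    using card unfolding card_2_iff by (metis insert_commute linorder_neqE)
  then have "\<exists>i<3. f i = x" "\<exists>i<3. f i = y" by (metis imageE insertCI lessThan_iff)+
  then have b: "2 \<le> x" "y \<le> int m - 3" using bounds by fastforce+
  have cases: "f i = x \<or> f i = y" if "i < 3" for i using xy(1) that by blast
  let ?r = "\<lambda>i. if f i = x then 0 else 1 :: nat"
  have "?r ` {..<3} = {0, 1}"
    using \<open>\<exists>i<3. f i = x\<close> \<open>\<exists>i<3. f i = y\<close> xy(2) by force
  moreover have "?r ` {..<3} = {?r 0, ?r 1, ?r 2}" by (auto simp: image_iff less_3)
  ultimately have "{?r 0, ?r 1, ?r 2} = {0, 1}" by simp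
  then show thesis
    by (rule that[of "nat x" "nat (int m - 1 - y)" "nat (y - x - 1)" ?r, rotated 3])
      (use b xy(2) cases in auto)
qed

lemma gaps_3:
  assumes bounds: "\<And>i. i < 3 \<Longrightarrow> f i \<in> {2..int m - 3}" and card: "card (f ` {..<3 :: nat}) = 3"
  obtains a g h b r where "2 \<le> a" "2 \<le> b" "extent [a, g, h, b] = m" "{r 0, r 1, r 2} = {0, 1, 2 :: nat}"
    "\<And>i. i < 3 \<Longrightarrow> f i = int (line [a, g, h, b] (r i))"
proof -
  obtain x y z where xyz: "f ` {..<3} = {x, y, z}" "x < y" "y < z"
  proof -
    obtain u v w where "f ` {..<3} = {u, v, w}" "u \<noteq> v" "v \<noteq> w" "u \<noteq> w"
      using card unfolding card_3_iff by metis
    moreover have "{u, v, w} = {u, w, v}" "{u, v, w} = {v, u, w}" "{u, v, w} = {v, w, u}"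
      "{u, v, w} = {w, u, v}" "{u, v, w} = {w, v, u}" by blast+
    ultimately show thesis using that by (metis linorder_neqE)
  qed
  then have ex: "\<exists>i<3. f i = x" "\<exists>i<3. f i = y" "\<exists>i<3. f i = z"
    by (metis imageE insertCI lessThan_iff)+
  then have b: "2 \<le> x" "z \<le> int m - 3" using bounds by fastforce+
  have cases: "f i = x \<or> f i = y \<or> f i = z" if "i < 3" for i using xyz(1) that by blast
  let ?r = "\<lambda>i. if f i = x then 0 else if f i = y then 1 else 2 :: nat"
  have "?r ` {..<3} = {0, 1, 2}"
    using ex xyz(2,3) by force
  moreover have "?r ` {..<3} = {?r 0, ?r 1, ?r 2}" by (auto simp: image_iff less_3)
  ultimately have "{?r 0, ?r 1, ?r 2} = {0, 1, 2}" by simp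
  then show thesis
    by (rule that[of "nat x" "nat (int m - 1 - z)" "nat (y - x - 1)" "nat (z - y - 1)" ?r, rotated 3])
      (use b xyz(2,3) cases in \<open>auto simp: numeral_2_eq_2\<close>)
qed

lemma perfect_if_good:
  assumes "good [r 0, r 1, r 2] [c 0, c 1, c 2] xs ys" "extent xs = m" "extent ys = n"
    and "\<And>i. i < 3 \<Longrightarrow> fst (s i) = int (line xs (r i))" "\<And>i. i < 3 \<Longrightarrow> snd (s i) = int (line ys (c i))"
  shows "has_perfect_layout m n 3 s"
proof (rule has_perfect_layout_cong)
  show "has_perfect_layout m n 3 (arrangement [r 0, r 1, r 2] [c 0, c 1, c 2] xs ys)"
    using assms(1-3) by (simp add: good_def)
  show "arrangement [r 0, r 1, r 2] [c 0, c 1, c 2] xs ys i = s i" if "i < 3" for i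
    using that assms(4,5)[OF that] by (auto simp: arrangement_def less_3 intro!: prod_eqI)
qed

section \<open>Sufficiency\<close>

lemma two_away_simps:
  "two_away m n 3 s p N \<longleftrightarrow> blank m n 3 s (fst p - 1, snd p) \<and> blank m n 3 s (fst p - 2, snd p) \<and> \<not> in_grid m n (fst p - 3, snd p)"
  "two_away m n 3 s p S \<longleftrightarrow> blank m n 3 s (fst p + 1, snd p) \<and> blank m n 3 s (fst p + 2, snd p) \<and> \<not> in_grid m n (fst p + 3, snd p)"
  "two_away m n 3 s p W \<longleftrightarrow> blank m n 3 s (fst p, snd p - 1) \<and> blank m n 3 s (fst p, snd p - 2) \<and> \<not> in_grid m n (fst p, snd p - 3)"
  "two_away m n 3 s p E \<longleftrightarrow> blank m n 3 s (fst p, snd p + 1) \<and> blank m n 3 s (fst p, snd p + 2) \<and> \<not> in_grid m n (fst p, snd p + 3)"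
  by (simp_all add: two_away_def shift_def)

lemma not_two_away_imp:
  assumes "\<not> config_a m n 3 s" "i < 3" "j < 3" "i \<noteq> j" "s j = shift (s i) d 1"
    and "\<And>e. e \<noteq> d \<Longrightarrow> two_away m n 3 s (s i) e"
  shows False
  using assms unfolding config_a_def adjacent_def by blast

lemma blank_3:
  assumes "{i0, i1, i2} = {0, 1, 2 :: nat}"
  shows "blank m n 3 s p \<longleftrightarrow> in_grid m n p \<and> p \<noteq> s i0 \<and> p \<noteq> s i1 \<and> p \<noteq> s i2"
proof -
  have "is_sink 3 s p \<longleftrightarrow> (\<exists>i \<in> {0, 1, 2}. s i = p)" unfolding is_sink_def by (auto simp: less_3)
  then show ?thesis unfolding assms[symmetric] blank_def by auto
qed

text \<open>All sinks lie in the middle one of five rows, so they are two away from north and south.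
  Gaps of 2 at an end add a third such side, and each excluded case completes one of the
  configurations.\<close>

lemma row_gaps_if_no_config:
  assumes no: "\<not> config_a m n 3 s" "\<not> config_c m n 3 s" "\<not> config_d m n 3 s"
    and i: "{i0, i1, i2} = {0, 1, 2 :: nat}"
    and s: "s i0 = (2, int c)" "s i1 = (2, int (c + g + 1))" "s i2 = (2, int (c + g + h + 2))"
    and mn: "m = 5" "n = c + g + h + d + 3" "2 \<le> c" "2 \<le> d"
  shows "\<not> (g = 0 \<and> h = 0) \<and> \<not> (c = 2 \<and> g = 0) \<and> \<not> (d = 2 \<and> h = 0) \<and>
      \<not> (c = 2 \<and> g = 1 \<and> h = 0) \<and> \<not> (d = 2 \<and> h = 1 \<and> g = 0)"
proof -
  have lt: "i0 < 3" "i1 < 3" "i2 < 3" and ne: "i0 \<noteq> i1" "i0 \<noteq> i2" "i1 \<noteq> i2"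
    using three_values[OF i] by auto
  have all: "t = i0 \<or> t = i1 \<or> t = i2" if "t < 3" for t
    using three_values[OF i] that by (auto simp: less_3)
  note blank = blank_3[OF i]
  have NS: "two_away m n 3 s (s k) N" "two_away m n 3 s (s k) S" if "k < 3" for k
    using all[OF that] s mn by (auto simp: two_away_simps blank in_grid_def)
  have W: "two_away m n 3 s (s i0) W" if "c = 2"
    using s mn that by (auto simp: two_away_simps blank in_grid_def)
  have E: "two_away m n 3 s (s i2) E" if "d = 2"
    using s mn that by (auto simp: two_away_simps blank in_grid_def)
  have adj: "adjacent (x, y) (x, y + 1)" "adjacent (x, y + 1) (x, y)" for x y
    unfolding adjacent_def by (intro exI[of _ E], simp add: shift_def) (intro exI[of _ W], simp add: shift_def)
  have "\<not> (g = 0 \<and> h = 0)"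
  proof
    assume gh: "g = 0 \<and> h = 0"
    have "adjacent (s i1) (s t)" if "t < 3" "t \<noteq> i1" for t
      using all[OF that(1)] that(2) s gh adj[of 2 "int c"] adj[of 2 "int c + 1"] by (auto simp: add.commute)
    then have "config_c m n 3 s"
      unfolding config_c_def using lt(2) NS[OF lt(2)] by (intro exI[of _ i1] conjI exI[of _ N]) simp_all
    with no show False by blast
  qed
  moreover have "\<not> (c = 2 \<and> g = 0)"
  proof
    assume cg: "c = 2 \<and> g = 0"
    have "two_away m n 3 s (s i0) e" if "e \<noteq> E" for e using NS[OF lt(1)] W cg that by (cases e) auto
    moreover have "s i1 = shift (s i0) E 1" using s cg by (simp add: shift_def)
    ultimately show False using not_two_away_imp[OF no(1) lt(1,2) ne(1)] by blast
  qed
  moreover have "\<not> (d = 2 \<and> h = 0)"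
  proof
    assume dh: "d = 2 \<and> h = 0"
    have "two_away m n 3 s (s i2) e" if "e \<noteq> W" for e using NS[OF lt(3)] E dh that by (cases e) auto
    moreover have "s i1 = shift (s i2) W 1" using s dh by (simp add: shift_def)
    ultimately show False using not_two_away_imp[OF no(1) lt(3,2) ne(3)[symmetric]] by blast
  qed
  moreover have "\<not> (c = 2 \<and> g = 1 \<and> h = 0)"
  proof
    assume *: "c = 2 \<and> g = 1 \<and> h = 0"
    have "two_away m n 3 s (s i0) e" if "e \<noteq> E" for e using NS[OF lt(1)] W * that by (cases e) auto
    moreover have "blank m n 3 s (shift (s i0) E 1)" "s i1 = shift (s i0) E 2"
      using s * mn by (auto simp: blank shift_def in_grid_def)
    moreover have "adjacent (s i1) (s i2)" using s * adj(1)[of 2 4] by simp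
    ultimately have "config_d m n 3 s"
      unfolding config_d_def using lt ne
      by (intro exI[of _ i0] exI[of _ E] conjI exI[of _ i1] exI[of _ i2]) auto
    with no show False by blast
  qed
  moreover have "\<not> (d = 2 \<and> h = 1 \<and> g = 0)"
  proof
    assume *: "d = 2 \<and> h = 1 \<and> g = 0"
    have "two_away m n 3 s (s i2) e" if "e \<noteq> W" for e using NS[OF lt(3)] E * that by (cases e) auto
    moreover have "blank m n 3 s (shift (s i2) W 1)" "s i1 = shift (s i2) W 2"
      using s * mn by (auto simp: blank shift_def in_grid_def)
    moreover have "adjacent (s i1) (s i0)" using s * adj(2)[of 2 "int c"] by (simp add: add.commute)
    ultimately have "config_d m n 3 s"
      unfolding config_d_def using lt ne
      by (intro exI[of _ i2] exI[of _ W] conjI exI[of _ i1] exI[of _ i0]) auto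
    with no show False by blast
  qed
  ultimately show ?thesis by blast
qed

lemma perfect_if_one_row:
  assumes bounds: "\<And>i. i < 3 \<Longrightarrow> fst (s i) \<in> {2..int m - 3}" "\<And>i. i < 3 \<Longrightarrow> snd (s i) \<in> {2..int n - 3}"
    and card: "sink_rows 3 s = 1" "sink_cols 3 s = 3"
    and no: "\<not> config_a m n 3 s" "\<not> config_c m n 3 s" "\<not> config_d m n 3 s"
    and size: "7 \<le> m \<or> 6 \<le> m \<and> 9 \<le> n \<or> 11 \<le> n"
  shows "has_perfect_layout m n 3 s"
proof -
  obtain a b where ab: "2 \<le> a" "2 \<le> b" "extent [a, b] = m" "\<And>i. i < 3 \<Longrightarrow> fst (s i) = int (line [a, b] 0)"
    by (rule gaps_1[of "\<lambda>i. fst (s i)" m, OF bounds(1) card(1)[unfolded sink_rows_def]]) (assumption | rule that)+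
  obtain c g h d r where cd: "2 \<le> c" "2 \<le> d" "extent [c, g, h, d] = n" "{r 0, r 1, r 2} = {0, 1, 2 :: nat}"
    "\<And>i. i < 3 \<Longrightarrow> snd (s i) = int (line [c, g, h, d] (r i))"
    by (rule gaps_3[of "\<lambda>i. snd (s i)" n, OF bounds(2) card(2)[unfolded sink_cols_def]]) (assumption | rule that)+
  have m: "m = a + b + 1" and n: "n = c + g + h + d + 3" using ab(3) cd(3) by simp_all
  have "\<not> (g = 0 \<and> h = 0) \<and> \<not> (c = 2 \<and> g = 0) \<and> \<not> (d = 2 \<and> h = 0) \<and>
      \<not> (c = 2 \<and> g = 1 \<and> h = 0) \<and> \<not> (d = 2 \<and> h = 1 \<and> g = 0)" if ab2: "a = 2" "b = 2"
  proof -
    have "0 \<in> {r 0, r 1, r 2}" "1 \<in> {r 0, r 1, r 2}" "2 \<in> {r 0, r 1, r 2}" unfolding cd(4) by simp_all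
    then obtain i0 i1 i2 where i: "i0 < 3" "r i0 = 0" "i1 < 3" "r i1 = 1" "i2 < 3" "r i2 = 2"
      by (metis One_nat_def insertE less_3 singletonD)
    then have "{i0, i1, i2} = {0, 1, 2}" by (auto simp: less_3)
    moreover have "s i0 = (2, int c)" "s i1 = (2, int (c + g + 1))" "s i2 = (2, int (c + g + h + 2))"
      using ab(4) cd(5) i ab2 by (auto intro!: prod_eqI simp: numeral_2_eq_2)
    ultimately show ?thesis
      using row_gaps_if_no_config[OF no] m n ab2 cd(1,2) by simp
  qed
  then have "good [0, 0, 0] [0, 1, 2] [a, b] [c, g, h, d]"
    using size m n ab(1,2) cd(1,2) by (intro good_row) auto
  then have "good [0, 0, 0] [r 0, r 1, r 2] [a, b] [c, g, h, d]"
    by (intro good_sort[OF cd(4)]) simp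
  then show ?thesis
    using perfect_if_good[of "\<lambda>_. 0" r "[a, b]" "[c, g, h, d]" m n s] ab cd by simp
qed

lemma perfect_if_two_rows_three_cols:
  assumes bounds: "\<And>i. i < 3 \<Longrightarrow> fst (s i) \<in> {2..int m - 3}" "\<And>i. i < 3 \<Longrightarrow> snd (s i) \<in> {2..int n - 3}"
    and card: "sink_rows 3 s = 2" "sink_cols 3 s = 3"
    and size: "7 \<le> m \<and> 8 \<le> n \<or> 8 \<le> m \<or> 9 \<le> n"
  shows "has_perfect_layout m n 3 s"
proof -
  obtain a g b p where ab: "2 \<le> a" "2 \<le> b" "extent [a, g, b] = m" "{p 0, p 1, p 2} = {0, 1 :: nat}"
    "\<And>i. i < 3 \<Longrightarrow> fst (s i) = int (line [a, g, b] (p i))"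
    by (rule gaps_2[of "\<lambda>i. fst (s i)" m, OF bounds(1) card(1)[unfolded sink_rows_def]]) (assumption | rule that)+
  obtain c h i d r where cd: "2 \<le> c" "2 \<le> d" "extent [c, h, i, d] = n" "{r 0, r 1, r 2} = {0, 1, 2 :: nat}"
    "\<And>k. k < 3 \<Longrightarrow> snd (s k) = int (line [c, h, i, d] (r k))"
    by (rule gaps_3[of "\<lambda>i. snd (s i)" n, OF bounds(2) card(2)[unfolded sink_cols_def]]) (assumption | rule that)+
  have "5 \<le> a + g + b \<and> 5 \<le> c + h + i + d \<or> 6 \<le> c + h + i + d \<or> 6 \<le> a + g + b"
    using ab(3) cd(3) size by auto
  then have "good [p0, p1, p2] [0, 1, 2] [a, g, b] [c, h, i, d]" if "{p0, p1, p2} = {p 0, p 1, p 2}" for p0 p1 p2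
    using that unfolding ab(4) by (rule good_two_rows[OF ab(1,2) cd(1,2)])
  then have "good [p 0, p 1, p 2] [r 0, r 1, r 2] [a, g, b] [c, h, i, d]" by (rule good_sort[OF cd(4)])
  then show ?thesis by (rule perfect_if_good[OF _ ab(3) cd(3) ab(5) cd(5)])
qed

lemma perfect_if_three_rows_three_cols:
  assumes bounds: "\<And>i. i < 3 \<Longrightarrow> fst (s i) \<in> {2..int m - 3}" "\<And>i. i < 3 \<Longrightarrow> snd (s i) \<in> {2..int n - 3}"
    and card: "sink_rows 3 s = 3" "sink_cols 3 s = 3"
    and size: "8 \<le> m \<or> 8 \<le> n"
  shows "has_perfect_layout m n 3 s"
proof -
  obtain a g g' b p where ab: "2 \<le> a" "2 \<le> b" "extent [a, g, g', b] = m" "{p 0, p 1, p 2} = {0, 1, 2 :: nat}"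
    "\<And>i. i < 3 \<Longrightarrow> fst (s i) = int (line [a, g, g', b] (p i))"
    by (rule gaps_3[of "\<lambda>i. fst (s i)" m, OF bounds(1) card(1)[unfolded sink_rows_def]]) (assumption | rule that)+
  obtain c h i d r where cd: "2 \<le> c" "2 \<le> d" "extent [c, h, i, d] = n" "{r 0, r 1, r 2} = {0, 1, 2 :: nat}"
    "\<And>k. k < 3 \<Longrightarrow> snd (s k) = int (line [c, h, i, d] (r k))"
    by (rule gaps_3[of "\<lambda>i. snd (s i)" n, OF bounds(2) card(2)[unfolded sink_cols_def]]) (assumption | rule that)+
  have "5 \<le> a + g + g' + b \<or> 5 \<le> c + h + i + d"
    using ab(3) cd(3) size by auto
  then have "good [p0, p1, p2] [0, 1, 2] [a, g, g', b] [c, h, i, d]" if "{p0, p1, p2} = {p 0, p 1, p 2}" for p0 p1 p2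
    using that unfolding ab(4) by (rule good_three_rows[OF ab(1,2) cd(1,2)])
  then have "good [p 0, p 1, p 2] [r 0, r 1, r 2] [a, g, g', b] [c, h, i, d]" by (rule good_sort[OF cd(4)])
  then show ?thesis by (rule perfect_if_good[OF _ ab(3) cd(3) ab(5) cd(5)])
qed

text \<open>The other sinks are the neighbours opposite to \<open>d\<close> and \<open>e\<close>, so
  the cells towards these two sides are blank without further assumption.\<close>

lemma config_b_if_corner:
  assumes "\<And>t. t < 3 \<Longrightarrow> t \<noteq> i \<Longrightarrow> s t = shift (s i) (opp d) 1 \<or> s t = shift (s i) (opp e) 1"
    and "i < 3" "perp d e"
    and "in_grid m n (shift (s i) d 2)" "\<not> in_grid m n (shift (s i) d 3)"
    and "in_grid m n (shift (s i) e 2)" "\<not> in_grid m n (shift (s i) e 3)" "in_grid m n (s i)"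
  shows "config_b m n 3 s"
proof -
  have blank: "blank m n 3 s (shift (s i) f k)"
    if f: "f = d \<or> f = e" and k: "k = 1 \<or> k = 2" for f k
  proof -
    have "in_grid m n (shift (s i) f k)"
      using assms(4,6,8) f k by (cases f) (auto simp: in_grid_def shift_def)
    moreover have "shift (s i) f k \<noteq> s t" if t: "t < 3" for t
    proof (cases "t = i")
      case True
      have "shift (s i) f k \<noteq> shift (s i) f 0" using k by (simp only: shift_eq_iff) auto
      then show ?thesis using True by simp
    next
      case False
      then show ?thesis using assms(1)[OF t False] f k \<open>perp d e\<close>
        by (cases d; cases e) (auto simp: shift_def perp_def prod_eq_iff)
    qed
    ultimately show ?thesis unfolding blank_def is_sink_def by metis
  qed
  have "two_away m n 3 s (s i) d" "two_away m n 3 s (s i) e"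
    using blank assms(5,7) by (simp_all add: two_away_def)
  moreover have "adjacent (s i) (s t)" if "t < 3" "t \<noteq> i" for t
    using assms(1)[OF that] unfolding adjacent_def by blast
  ultimately show ?thesis using assms(2,3) unfolding config_b_def by blast
qed

lemma perfect_if_two_rows_two_cols:
  assumes board: "is_board m n 3 s"
    and bounds: "\<And>i. i < 3 \<Longrightarrow> fst (s i) \<in> {2..int m - 3}" "\<And>i. i < 3 \<Longrightarrow> snd (s i) \<in> {2..int n - 3}"
    and card: "sink_rows 3 s = 2" "sink_cols 3 s = 2"
    and no: "\<not> config_b m n 3 s"
    and size: "7 \<le> m \<and> 7 \<le> n \<or> 9 \<le> m \<or> 9 \<le> n"
  shows "has_perfect_layout m n 3 s"
proof -
  obtain a g b p where ab: "2 \<le> a" "2 \<le> b" "extent [a, g, b] = m" "{p 0, p 1, p 2} = {0, 1 :: nat}"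
    "\<And>i. i < 3 \<Longrightarrow> fst (s i) = int (line [a, g, b] (p i))"
    by (rule gaps_2[of "\<lambda>i. fst (s i)" m, OF bounds(1) card(1)[unfolded sink_rows_def]]) (assumption | rule that)+
  obtain c h d r where cd: "2 \<le> c" "2 \<le> d" "extent [c, h, d] = n" "{r 0, r 1, r 2} = {0, 1 :: nat}"
    "\<And>k. k < 3 \<Longrightarrow> snd (s k) = int (line [c, h, d] (r k))"
    by (rule gaps_2[of "\<lambda>i. snd (s i)" n, OF bounds(2) card(2)[unfolded sink_cols_def]]) (assumption | rule that)+
  have m: "m = a + g + b + 2" and n: "n = c + h + d + 2" using ab(3) cd(3) by simp_all
  let ?Z = "{(p 0, r 0), (p 1, r 1), (p 2, r 2)}"
  have Z: "?Z = (\<lambda>i. (p i, r i)) ` {..<3}" by (auto simp: image_iff less_3)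
  have ne: "(p i, r i) \<noteq> (p j, r j)" if "i < 3" "j < 3" "i \<noteq> j" for i j
  proof
    assume "(p i, r i) = (p j, r j)"
    then have "s i = s j" using ab(5) cd(5) that by (auto intro: prod_eqI)
    then show False using board that unfolding is_board_def by (auto dest: inj_onD)
  qed
  have p01: "p i = 0 \<or> p i = 1" "r i = 0 \<or> r i = 1" if "i < 3" for i
    using two_values[OF ab(4)] two_values[OF cd(4)] that by (auto simp: less_3)
  have grid: "in_grid m n (s i)" if "i < 3" for i using board that unfolding is_board_def by blast
  have corner: "\<not> (g = 0 \<and> h = 0 \<and> (if x = 1 then a else b) = 2 \<and> (if y = 1 then c else d) = 2)"
    if xy: "(x, y) \<notin> ?Z" "x = 0 \<or> x = 1" "y = 0 \<or> y = 1" for x y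
  proof
    assume *: "g = 0 \<and> h = 0 \<and> (if x = 1 then a else b) = 2 \<and> (if y = 1 then c else d) = 2"
    \<comment> \<open>The sink opposite to the free crossing is the bend. If that crossing were free
      as well, only two places would be left for three sinks.\<close>
    have "(1 - x, 1 - y) \<in> ?Z"
    proof (rule ccontr)
      assume no': "(1 - x, 1 - y) \<notin> ?Z"
      have "(\<lambda>i. (p i, r i)) ` {..<3} \<subseteq> {(x, 1 - y), (1 - x, y)}"
      proof
        fix q assume "q \<in> (\<lambda>i. (p i, r i)) ` {..<3}"
        then obtain i where i: "i < 3" "q = (p i, r i)" by blast
        then have "q \<noteq> (x, y)" "q \<noteq> (1 - x, 1 - y)" using xy(1) no' unfolding Z by blast+
        then show "q \<in> {(x, 1 - y), (1 - x, y)}" using p01[OF i(1)] i(2) xy(2,3) by auto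
      qed
      then have "card ((\<lambda>i. (p i, r i)) ` {..<3}) \<le> card {(x, 1 - y), (1 - x, y)}" by (intro card_mono) auto
      also have "\<dots> \<le> 2" by (simp add: card_insert_if)
      finally show False using ne by (subst (asm) card_image) (auto simp: inj_on_def)
    qed
    then obtain i where i: "i < 3" "p i = 1 - x" "r i = 1 - y" unfolding Z by auto
    \<comment> \<open>The directions from the bend away from its two neighbours: it lies in the
      first sink row if \<open>x = 1\<close> and in the first sink column if
      \<open>y = 1\<close>.\<close>
    let ?d = "if x = 1 then N else S" and ?e = "if y = 1 then W else E"
    have "config_b m n 3 s"
    proof (rule config_b_if_corner[of i s ?d ?e])
      fix t :: nat assume t: "t < 3" "t \<noteq> i"
      have "(p t, r t) \<noteq> (x, y)" using xy(1) t(1) unfolding Z by blast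
      then show "s t = shift (s i) (opp ?d) 1 \<or> s t = shift (s i) (opp ?e) 1"
        using ne[OF t(1) i(1) t(2)] p01[OF t(1)] i xy(2,3) * ab(5)[OF t(1)] ab(5)[OF i(1)] cd(5)[OF t(1)] cd(5)[OF i(1)]
        by (auto simp: shift_def prod_eq_iff)
    next
      show "perp ?d ?e" by (simp add: perp_def)
    qed (use i xy(2,3) * ab(5)[OF i(1)] cd(5)[OF i(1)] m n ab(1,2) cd(1,2) grid[OF i(1)] in
        \<open>auto simp: in_grid_def shift_def\<close>)
    with no show False by blast
  qed
  have "good [p 0, p 1, p 2] [r 0, r 1, r 2] [a, g, b] [c, h, d]"
  proof (rule good_two_rows_two_cols[OF ab(1,2) cd(1,2)])
    show "5 \<le> a + g + b \<and> 5 \<le> c + h + d \<or> 7 \<le> c + h + d \<or> 7 \<le> a + g + b"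
      using size m n by linarith
    show "distinct [(p 0, r 0), (p 1, r 1), (p 2, r 2)]" using ne by simp
  qed (use p01 corner[of 1 1] corner[of 1 0] corner[of 0 1] corner[of 0 0] in auto)
  then show ?thesis by (rule perfect_if_good[OF _ ab(3) cd(3) ab(5) cd(5)])
qed

context board_symmetry
begin

lemma shift_f_2: "shift (f p) (g d) 2 = f (shift p d 2)" "shift (f p) (g d) 3 = f (shift p d 3)"
proof -
  have "shift p d 2 = shift (shift p d 1) d 1" "shift p d 3 = shift (shift p d 2) d 1" for p d
    by (simp_all add: shift_shift)
  then show "shift (f p) (g d) 2 = f (shift p d 2)" "shift (f p) (g d) 3 = f (shift p d 3)"
    using shift_f by metis+
qed

lemma two_away_f: "two_away m' n' c (\<lambda>i. f (s i)) (f p) (g d) \<longleftrightarrow> two_away m n c s p d"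
  unfolding two_away_def shift_f_2 shift_f by simp

lemma adjacent_f: "adjacent (f p) (f q) \<longleftrightarrow> adjacent p q"
  unfolding adjacent_def by (metis shift_f ff gg)

lemma g_neq: "e \<noteq> g d \<longleftrightarrow> g e \<noteq> d"
  by (metis gg)

lemma two_away_f': "two_away m' n' c (\<lambda>i. f (s i)) (f p) e \<longleftrightarrow> two_away m n c s p (g e)"
  using two_away_f[of c s p "g e"] by simp

end

lemma opp_transpose_dir: "opp (transpose_dir d) = transpose_dir (opp d)"
  by (cases d) auto

text \<open>Transfers the exclusions used for three sinks in one row to three sinks in one
  column.\<close>

lemma configs_transpose:
  shows "config_a m n 3 s \<Longrightarrow> config_a n m 3 (\<lambda>i. prod.swap (s i))"
    and "config_c m n 3 s \<Longrightarrow> config_c n m 3 (\<lambda>i. prod.swap (s i))"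
    and "config_d m n 3 s \<Longrightarrow> config_d n m 3 (\<lambda>i. prod.swap (s i))"
proof -
  let ?s = "\<lambda>i. prod.swap (s i)" and ?g = transpose_dir
  note two = transposition.two_away_f'[of n m 3 s] and adj = transposition.adjacent_f
    and neq = transposition.g_neq
  show "config_a n m 3 ?s" if c: "config_a m n 3 s"
  proof -
    obtain i d t where *: "i < 3" "\<forall>e. e \<noteq> d \<longrightarrow> two_away m n 3 s (s i) e" "t < 3" "t \<noteq> i" "adjacent (s i) (s t)"
      using c unfolding config_a_def by blast
    have "\<forall>e. e \<noteq> ?g d \<longrightarrow> two_away n m 3 ?s (?s i) e" unfolding two using *(2) neq by metis
    moreover have "adjacent (?s i) (?s t)" unfolding adj by (rule *(5))
    ultimately show ?thesis unfolding config_a_def using *(1,3,4) by blast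
  qed
  show "config_c n m 3 ?s" if c: "config_c m n 3 s"
  proof -
    obtain i d where *: "i < 3" "two_away m n 3 s (s i) d" "two_away m n 3 s (s i) (opp d)"
      "\<forall>t<3. t \<noteq> i \<longrightarrow> adjacent (s i) (s t)"
      using c unfolding config_c_def by (elim exE conjE) (rule that)
    have "two_away n m 3 ?s (?s i) (?g d)" "two_away n m 3 ?s (?s i) (opp (?g d))"
      unfolding two opp_transpose_dir transposition.gg by (rule *(2), rule *(3))
    moreover have "\<forall>t<3. t \<noteq> i \<longrightarrow> adjacent (?s i) (?s t)" unfolding adj by (rule *(4))
    ultimately show ?thesis unfolding config_c_def using *(1) by blast
  qed
  show "config_d n m 3 ?s" if c: "config_d m n 3 s"
  proof -
    obtain i d t u where *: "i < 3" "\<forall>e. e \<noteq> d \<longrightarrow> two_away m n 3 s (s i) e"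
      "blank m n 3 s (shift (s i) d 1)" "t < 3" "u < 3" "t \<noteq> i" "u \<noteq> i" "u \<noteq> t"
      "s t = shift (s i) d 2" "adjacent (s t) (s u)"
      using c unfolding config_d_def by (elim exE conjE) (rule that)
    have "blank n m 3 ?s (shift (?s i) (?g d) 1)" "?s t = shift (?s i) (?g d) 2"
      using *(3,9) by (simp_all only: transposition.shift_f transposition.shift_f_2 transposition.blank_f)
    moreover have "\<forall>e. e \<noteq> ?g d \<longrightarrow> two_away n m 3 ?s (?s i) e" unfolding two using *(2) neq by metis
    moreover have "adjacent (?s t) (?s u)" unfolding adj by (rule *(10))
    ultimately show ?thesis unfolding config_d_def using *(1,4-8) by blast
  qed
qed

text \<open>\<open>blanks_towards\<close> counts the blank cells of the whole ray, so it is at most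
  the distance \<open>D\<close> from the sink to the last cell of the grid.\<close>

lemma margins_if_cond1:
  assumes "is_board m n 3 s" "cond1 m n 3 s" "i < 3"
  shows "fst (s i) \<in> {2..int m - 3}" "snd (s i) \<in> {2..int n - 3}"
proof -
  have grid: "in_grid m n (s i)" using assms(1,3) unfolding is_board_def by blast
  have "2 \<le> D" if "\<And>k. in_grid m n (shift (s i) d k) \<Longrightarrow> k \<le> D" for d and D :: nat
  proof -
    have "{k. 1 \<le> k \<and> blank m n 3 s (shift (s i) d k)} \<subseteq> {1..D}" using that by (auto simp: blank_def)
    then have "blanks_towards m n 3 s (s i) d \<le> card {1..D}"
      unfolding blanks_towards_def by (intro card_mono) auto
    then show ?thesis using assms(2,3) unfolding cond1_def by (metis card_atLeastAtMost diff_Suc_1 le_trans)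
  qed
  note * = this
  have "2 \<le> nat (fst (s i))" by (rule *[of N]) (use grid in \<open>auto simp: in_grid_def shift_def\<close>)
  moreover have "2 \<le> nat (int m - 1 - fst (s i))" by (rule *[of S]) (use grid in \<open>auto simp: in_grid_def shift_def\<close>)
  moreover have "2 \<le> nat (snd (s i))" by (rule *[of W]) (use grid in \<open>auto simp: in_grid_def shift_def\<close>)
  moreover have "2 \<le> nat (int n - 1 - snd (s i))" by (rule *[of E]) (use grid in \<open>auto simp: in_grid_def shift_def\<close>)
  ultimately show "fst (s i) \<in> {2..int m - 3}" "snd (s i) \<in> {2..int n - 3}" by auto
qed

lemma three_cols_if_one_row:
  assumes "is_board m n 3 s" "sink_rows 3 s = 1"
  shows "sink_cols 3 s = 3"
proof -
  obtain x where "(\<lambda>i. fst (s i)) ` {..<3} = {x}"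
    using assms(2) unfolding sink_rows_def by (auto simp: card_1_singleton_iff)
  then have x: "fst (s i) = x" if "i < 3" for i using that by blast
  have "inj_on (\<lambda>i. snd (s i)) {..<3}"
  proof (rule inj_onI)
    fix i j :: nat assume ij: "i \<in> {..<3}" "j \<in> {..<3}" "snd (s i) = snd (s j)"
    then have "s i = s j" using x[of i] x[of j] by (auto intro: prod_eqI)
    then show "i = j" using assms(1) ij unfolding is_board_def by (auto dest: inj_onD)
  qed
  then show ?thesis by (simp add: sink_cols_def card_image)
qed

lemma is_board_transpose: "is_board m n c s \<Longrightarrow> is_board n m c (\<lambda>i. prod.swap (s i))"
  by (auto simp: is_board_def inj_on_def inj_eq[OF inj_swap])

lemma sink_lines_transpose:
  "sink_rows c (\<lambda>i. prod.swap (s i)) = sink_cols c s" "sink_cols c (\<lambda>i. prod.swap (s i)) = sink_rows c s"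
  by (simp_all add: sink_rows_def sink_cols_def)

lemma sink_lines_bounds:
  "1 \<le> sink_rows 3 s" "sink_rows 3 s \<le> 3" "1 \<le> sink_cols 3 s" "sink_cols 3 s \<le> 3"
proof -
  have "card (f ` {..<3 :: nat}) \<le> 3" "1 \<le> card (f ` {..<3 :: nat})" for f :: "nat \<Rightarrow> int"
    using card_image_le[of "{..<3}" f] by (simp_all add: card_gt_0_iff Suc_le_eq lessThan_empty_iff)
  then show "1 \<le> sink_rows 3 s" "sink_rows 3 s \<le> 3" "1 \<le> sink_cols 3 s" "sink_cols 3 s \<le> 3"
    unfolding sink_rows_def sink_cols_def by blast+
qed

text \<open>Distinct sinks in one row lie in three columns and vice versa, so six pairs of values of
  \<open>p\<close> and \<open>q\<close> remain; those with \<open>p > q\<close> are reduced by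
  transposition.\<close>

lemma perfect_if_conditions:
  assumes board: "is_board m n 3 s" and c1: "cond1 m n 3 s"
    and no: "\<not> config_a m n 3 s" "\<not> config_b m n 3 s" "\<not> config_c m n 3 s" "\<not> config_d m n 3 s"
    and c3: "cond3 m n 3 s"
  shows "has_perfect_layout m n 3 s"
proof -
  define p q where "p = sink_rows 3 s" and "q = sink_cols 3 s"
  let ?t = "\<lambda>i. prod.swap (s i)"
  have swap_back: "has_perfect_layout m n 3 s" if "has_perfect_layout n m 3 ?t"
    using transposition.perfect_f[OF that] by simp
  note bounds = margins_if_cond1[OF board c1]
  have bounds': "fst (?t i) \<in> {2..int n - 3}" "snd (?t i) \<in> {2..int m - 3}"
    if "i < 3" for i using bounds[OF that] by simp_all
  have size: "p = 3 \<and> q = 3 \<Longrightarrow> size_at_least m n 7 8"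
    "{p, q} = {2, 3} \<Longrightarrow> size_at_least m n 7 8 \<or> size_at_least m n 6 9"
    "p = 2 \<and> q = 2 \<Longrightarrow> size_at_least m n 7 7 \<or> size_at_least m n 6 9"
    "{p, q} = {1, 3} \<Longrightarrow> size_at_least m n 7 7 \<or> size_at_least m n 6 9 \<or> size_at_least m n 5 11"
    using c3 unfolding cond3_def Let_def p_def q_def by blast+
  have q1: "p = 3" if "q = 1"
    using three_cols_if_one_row[OF is_board_transpose[OF board]] that
    by (simp add: sink_lines_transpose p_def q_def)
  have p1: "q = 3" if "p = 1" using three_cols_if_one_row[OF board] that by (simp add: p_def q_def)
  have "1 \<le> p" "p \<le> 3" "1 \<le> q" "q \<le> 3" unfolding p_def q_def using sink_lines_bounds by blast+
  then have "p = 1 \<or> p = 2 \<or> p = 3" "q = 1 \<or> q = 2 \<or> q = 3" by linarith+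
  then consider "p = 1" "q = 3" | "p = 3" "q = 1" | "p = 2" "q = 2" | "p = 2" "q = 3" | "p = 3" "q = 2"
    | "p = 3" "q = 3" using p1 q1 by fastforce
  then show ?thesis
  proof cases
    case 1
    then have "7 \<le> m \<or> 6 \<le> m \<and> 9 \<le> n \<or> 11 \<le> n" using size(4) by (auto simp: size_at_least_def doubleton_eq_iff)
    then show ?thesis using perfect_if_one_row[of s m n, OF bounds] 1 no unfolding p_def q_def by blast
  next
    case 2
    then have "7 \<le> n \<or> 6 \<le> n \<and> 9 \<le> m \<or> 11 \<le> m" using size(4) by (auto simp: size_at_least_def doubleton_eq_iff)
    moreover have "sink_rows 3 ?t = 1" "sink_cols 3 ?t = 3" using 2 by (simp_all add: sink_lines_transpose p_def q_def)
    moreover have "\<not> config_a n m 3 ?t" "\<not> config_c n m 3 ?t" "\<not> config_d n m 3 ?t"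
      using configs_transpose[of n m ?t] no by (simp_all, blast+)
    ultimately show ?thesis by (intro swap_back perfect_if_one_row[of ?t n m, OF bounds'])
  next
    case 3
    then have "7 \<le> m \<and> 7 \<le> n \<or> 9 \<le> m \<or> 9 \<le> n" using size(3) by (auto simp: size_at_least_def doubleton_eq_iff)
    then show ?thesis using perfect_if_two_rows_two_cols[of m n s, OF board bounds] 3 no unfolding p_def q_def by blast
  next
    case 4
    \<comment> \<open>The alternatives are weakened to their longer sides where possible; the
      margins already give six rows and seven columns.\<close>
    then have "7 \<le> m \<and> 8 \<le> n \<or> 8 \<le> m \<or> 9 \<le> n" using size(2) by (auto simp: size_at_least_def doubleton_eq_iff)
    then show ?thesis using perfect_if_two_rows_three_cols[of s m n, OF bounds] 4 unfolding p_def q_def by blast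
  next
    case 5
    then have "7 \<le> n \<and> 8 \<le> m \<or> 8 \<le> n \<or> 9 \<le> m" using size(2) by (auto simp: size_at_least_def doubleton_eq_iff)
    moreover have "sink_rows 3 ?t = 2" "sink_cols 3 ?t = 3" using 5 by (simp_all add: sink_lines_transpose p_def q_def)
    ultimately show ?thesis by (intro swap_back perfect_if_two_rows_three_cols[of ?t n m, OF bounds'])
  next
    case 6
    then have "8 \<le> m \<or> 8 \<le> n" using size(1) by (auto simp: size_at_least_def doubleton_eq_iff)
    then show ?thesis using perfect_if_three_rows_three_cols[of s m n, OF bounds] 6 unfolding p_def q_def by blast
  qed
qed

theorem mainTheorem13:
  fixes m n :: nat and sink :: "nat \<Rightarrow> cell"
  assumes "is_board m n 3 sink"
  shows "has_perfect_layout m n 3 sink \<longleftrightarrow>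
           cond1 m n 3 sink \<and>
           \<not> config_a m n 3 sink \<and> \<not> config_b m n 3 sink \<and>
           \<not> config_c m n 3 sink \<and> \<not> config_d m n 3 sink \<and>
           cond3 m n 3 sink"
proof
  assume "has_perfect_layout m n 3 sink"
  then obtain L where "perfect_layout m n 3 sink L" unfolding has_perfect_layout_def by blast
  then interpret perfect m n sink L using assms by unfold_locales
  show "cond1 m n 3 sink \<and> \<not> config_a m n 3 sink \<and> \<not> config_b m n 3 sink \<and>
      \<not> config_c m n 3 sink \<and> \<not> config_d m n 3 sink \<and> cond3 m n 3 sink"
    using cond1 no_config_a no_config_b no_config_c no_config_d cond3 by blast
next
  assume "cond1 m n 3 sink \<and> \<not> config_a m n 3 sink \<and> \<not> config_b m n 3 sink \<and>
      \<not> config_c m n 3 sink \<and> \<not> config_d m n 3 sink \<and> cond3 m n 3 sink"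
  then show "has_perfect_layout m n 3 sink" using perfect_if_conditions[OF assms] by blast
qed

end
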